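(* The $2$-category $\mathbf{2Term3\text{-}Lie_\infty}$ of $2$-term $3$-$Lie_\infty$-algebras and the $2$-category $\mathbf{3Lie2Alg}$ of $3$-Lie $2$-algebras are $2$-equivalent.
   Context: Vector spaces are over a fixed base field. $2$-equivalent means: there are $2$-functors in both directions whose two composites are naturally isomorphic to the respective identity $2$-functors. **The 2-category $\mathbf{2Term3\text{-}Lie_\infty}$.** Objects. A $2$-term $3$-$Lie_\infty$-algebra $\mathcal V=(V_1,V_0,\mathrm d,l_3,l_5)$ consists of a complex of vector spaces $V_1\xrightarrow{\mathrm d}V_0$; completely skew-symmetric trilinear maps $l_3:V_i\times V_j\times V_k\to V_{i+j+k}$, $0\le i+j+k\le1$; and a multilinear map $l_5:(V_0\wedge V_0)\otimes(V_0\wedge V_0\wedge V_0)\to V_1$, such that for all $x,y,x_i\in V_0$, $f,g,h\in V_1$: (a) $\mathrm d l_3(x,y,f)=l_3(x,y,\mathrm df)$; (b) $l_3(f,g,h)=0$ and $l_3(f,g,x)=0$; (c) $l_3(\mathrm df,g,x)=l_3(f,\mathrm dg,x)$; (d) $\mathrm d l_5(x_1,x_2,x_3,x_4,x_5)=-l_3(x_1,x_2,l_3(x_3,x_4,x_5))+l_3(x_3,l_3(x_1,x_2,x_4),x_5)+l_3(l_3(x_1,x_2,x_3),x_4,x_5)+l_3(x_3,x_4,l_3(x_1,x_2,x_5))$; (e) $l_5(\mathrm df,x_2,x_3,x_4,x_5)=-l_3(f,x_2,l_3(x_3,x_4,x_5))+l_3(x_3,l_3(f,x_2,x_4),x_5)+l_3(l_3(f,x_2,x_3),x_4,x_5)+l_3(x_3,x_4,l_3(f,x_2,x_5))$;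 (f) $l_5(x_1,x_2,\mathrm df,x_4,x_5)=-l_3(x_1,x_2,l_3(f,x_4,x_5))+l_3(f,l_3(x_1,x_2,x_4),x_5)+l_3(l_3(x_1,x_2,f),x_4,x_5)+l_3(f,x_4,l_3(x_1,x_2,x_5))$; (g) $l_3(l_5(x_1,x_2,x_3,x_4,x_5),x_6,x_7)+l_3(x_5,l_5(x_1,x_2,x_3,x_4,x_6),x_7)+l_3(x_1,x_2,l_5(x_3,x_4,x_5,x_6,x_7))+l_3(x_5,x_6,l_5(x_1,x_2,x_3,x_4,x_7))+l_5(x_1,x_2,l_3(x_3,x_4,x_5),x_6,x_7)+l_5(x_1,x_2,x_5,l_3(x_3,x_4,x_6),x_7)+l_5(x_1,x_2,x_5,x_6,l_3(x_3,x_4,x_7))$ $=l_3(x_3,x_4,l_5(x_1,x_2,x_5,x_6,x_7))+l_5(l_3(x_1,x_2,x_3),x_4,x_5,x_6,x_7)+l_5(x_3,l_3(x_1,x_2,x_4),x_5,x_6,x_7)+l_5(x_3,x_4,l_3(x_1,x_2,x_5),x_6,x_7)+l_5(x_3,x_4,x_5,l_3(x_1,x_2,x_6),x_7)+l_5(x_1,x_2,x_3,x_4,l_3(x_5,x_6,x_7))+l_5(x_3,x_4,x_5,x_6,l_3(x_1,x_2,x_7))$. Morphisms. A homomorphism $\phi:\mathcal V\to\mathcal V'$ consists of a chain map $(\phi_0:V_0\to V_0',\ \phi_1:V_1\to V_1')$ and a completely skew-symmetric trilinear $\phi_2:V_0\times V_0\times V_0\to V_1'$ with, for $x_i\in V_0$,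 $h\in V_1$: $\mathrm d'\phi_2(x_1,x_2,x_3)=\phi_0(l_3(x_1,x_2,x_3))-l_3'(\phi_0(x_1),\phi_0(x_2),\phi_0(x_3))$; $\phi_2(x_1,x_2,\mathrm dh)=\phi_1(l_3(x_1,x_2,h))-l_3'(\phi_0(x_1),\phi_0(x_2),\phi_1(h))$; $l_5'(\phi_0(x_1),\dots,\phi_0(x_5))+l_3'(\phi_2(x_1,x_2,x_3),\phi_0(x_4),\phi_0(x_5))+l_3'(\phi_0(x_3),\phi_2(x_1,x_2,x_4),\phi_0(x_5))+l_3'(\phi_0(x_3),\phi_0(x_4),\phi_2(x_1,x_2,x_5))+\phi_2(l_3(x_1,x_2,x_3),x_4,x_5)+\phi_2(x_3,l_3(x_1,x_2,x_4),x_5)+\phi_2(x_3,x_4,l_3(x_1,x_2,x_5))=l_3'(\phi_0(x_1),\phi_0(x_2),\phi_2(x_3,x_4,x_5))+\phi_2(x_1,x_2,l_3(x_3,x_4,x_5))+\phi_1(l_5(x_1,\dots,x_5))$. The composite of $\varphi:\mathcal V\to\mathcal V'$ and $\psi:\mathcal V'\to\mathcal V''$ is $(\psi\circ\varphi)_0=\psi_0\varphi_0$, $(\psi\circ\varphi)_1=\psi_1\varphi_1$, $(\psi\circ\varphi)_2(x,y,z)=\psi_2(\varphi_0(x),\varphi_0(y),\varphi_0(z))+\psi_1(\varphi_2(x,y,z))$. The identity has identity chain map and zero $\phi_2$. 2-morphisms. For $\varphi,\psi:\mathcal V\to\mathcal V'$, a $2$-homomorphism $\tau:\varphi\Rightarrow\psi$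 is a chain homotopy, i.e. a linear map $\tau:V_0\to V_1'$ with $\mathrm d'\tau=\psi_0-\varphi_0$, $\tau\mathrm d=\psi_1-\varphi_1$, such that for all $x_1,x_2,x_3\in V_0$ $(\varphi_2-\psi_2)(x_1,x_2,x_3)=\big[l_3'(\varphi_0(x_1),\varphi_0(x_2),\tau(x_3))+l_3'(\mathrm d'\tau(x_1),\tau(x_2),\varphi_0(x_3))+\text{c.p.}\big]-\tau(l_3(x_1,x_2,x_3))+l_3'(\mathrm d'\tau(x_1),\mathrm d'\tau(x_2),\tau(x_3))$, where c.p. means adding the terms obtained from both displayed terms by the cyclic permutations of $x_1,x_2,x_3$. Vertical composition of $\tau:\varphi\Rightarrow\psi$ and $\tau':\psi\Rightarrow\mu$ is $\tau'+\tau$. Horizontal composition of $\tau:\varphi\Rightarrow\psi$ (between maps $\mathcal V\to\mathcal V'$) and $\tau':\varphi'\Rightarrow\psi'$ (between maps $\mathcal V'\to\mathcal V''$) is $x\mapsto\tau'(\varphi_0(x))+\psi_1'(\tau(x))$. Identity $2$-morphisms are zero homotopies. **The 2-category $\mathbf{3Lie2Alg}$.** A $2$-vector space $L$ is a category internal to vector spaces: vector spaces $L_0$ of objects and $L_1$ of morphisms with all structure maps (source $s$, target $t$, unit $x\mapsto1_x$, composition) linear. Objects. A $3$-Lie $2$-algebra is a $2$-vector space $L$ with a completely skew-symmetric trilinear functor $[\cdot,\cdot,\cdot]:L\times L\times L\to L$ and a multilinear natural isomorphism, for $x_i\in L_0$, $$J_{x_1,x_2,x_3,x_4,x_5}:[x_1,x_2,[x_3,x_4,x_5]]\to[[x_1,x_2,x_3],x_4,x_5]+[x_3,[x_1,x_2,x_4],x_5]+[x_3,x_4,[x_1,x_2,x_5]],$$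 such that for all $x_1,\dots,x_7\in L_0$ the following two composites (written in order of composition, first arrow first) of morphisms starting at $[x_1,x_2,[x_3,x_4,[x_5,x_6,x_7]]]$ agree. First composite: $[x_1,x_2,J_{x_3,x_4,x_5,x_6,x_7}]$; then $J_{x_1,x_2,[x_3,x_4,x_5],x_6,x_7}+J_{x_1,x_2,x_5,[x_3,x_4,x_6],x_7}+J_{x_1,x_2,x_5,x_6,[x_3,x_4,x_7]}$; then $[x_5,x_6,J_{x_1,x_2,x_3,x_4,x_7}]+1$; then $[x_5,J_{x_1,x_2,x_3,x_4,x_6},x_7]+[J_{x_1,x_2,x_3,x_4,x_5},x_6,x_7]+1$. Second composite: $J_{x_1,x_2,x_3,x_4,[x_5,x_6,x_7]}$; then $[x_3,x_4,J_{x_1,x_2,x_5,x_6,x_7}]+1$; then $J_{[x_1,x_2,x_3],x_4,x_5,x_6,x_7}+J_{x_3,[x_1,x_2,x_4],x_5,x_6,x_7}+J_{x_3,x_4,[x_1,x_2,x_5],x_6,x_7}+J_{x_3,x_4,x_5,[x_1,x_2,x_6],x_7}+J_{x_3,x_4,x_5,x_6,[x_1,x_2,x_7]}$. Here an object inside a bracket with a morphism stands for its identity morphism and "$+1$" means adding the identity of the remaining summands of the relevant object. Morphisms. A homomorphism $F:L\to L'$ is a linear functor $(F_0,F_1)$ together with a completely skew-symmetric trilinear natural transformation $F_2(x,y,z):[F_0(x),F_0(y),F_0(z)]'\to F_0[x,y,z]$ such that the following composites from $[F_0(x_1),F_0(x_2),[F_0(x_3),F_0(x_4),F_0(x_5)]']'$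 to $F_0[[x_1,x_2,x_3],x_4,x_5]+F_0[x_3,[x_1,x_2,x_4],x_5]+F_0[x_3,x_4,[x_1,x_2,x_5]]$ agree: (i) $J'_{F_0(x_1),\dots,F_0(x_5)}$, then $[F_2(x_1,x_2,x_3),1,1]'+[1,F_2(x_1,x_2,x_4),1]'+[1,1,F_2(x_1,x_2,x_5)]'$, then $F_2([x_1,x_2,x_3],x_4,x_5)+F_2(x_3,[x_1,x_2,x_4],x_5)+F_2(x_3,x_4,[x_1,x_2,x_5])$; (ii) $[1,1,F_2(x_3,x_4,x_5)]'$, then $F_2(x_1,x_2,[x_3,x_4,x_5])$, then $F_1(J_{x_1,\dots,x_5})$. Composition: $G\circ F$ is the composite functor, with $(G\circ F)_2(x,y,z)$ equal to $G_2(F_0(x),F_0(y),F_0(z))$ followed by $G_1(F_2(x,y,z))$. The identity homomorphism is the identity functor with identity natural transformation. 2-morphisms. A $2$-homomorphism $\theta:F\Rightarrow G$ is a linear natural transformation such that $F_2(x,y,z)$ followed by $\theta_{[x,y,z]}$ equals $[\theta_x,\theta_y,\theta_z]'$ followed by $G_2(x,y,z)$. Vertical and horizontal composition and identities are those of natural transformations.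
   Formalization: The natural isomorphism J of a 3-Lie 2-algebra is additionally required to be skew-symmetric in its first two and in its last three arguments, matching the domain of l_5; with J merely multilinear the two 2-categories are not 2-equivalent (e.g. zero bracket on k, J-part x1x2x3x4x5). *)

theory Defs
  imports "HOL-Algebra.Module" "HOL-Library.FuncSet"
begin

section \<open>Strict 2-categories and 2-equivalence\<close>

text \<open>
  A 1-cell or 2-cell does not carry its boundary. The cells are given by hom-sets, and the operations
  take the boundary as explicit arguments:
  \<^item> \<open>comp1 C A B D g f\<close> is the composite of \<open>f : A \<rightarrow> B\<close> and \<open>g : B \<rightarrow> D\<close>;
  \<^item> \<open>vcomp C A B f g h \<beta> \<alpha>\<close> is the vertical composite of \<open>\<alpha> : f \<Rightarrow> g\<close> and \<open>\<beta> : g \<Rightarrow> h\<close>, where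
    \<open>f, g, h : A \<rightarrow> B\<close>;
  \<^item> \<open>hcomp C A B D f g f' g' \<beta> \<alpha>\<close> is the horizontal composite of \<open>\<alpha> : f \<Rightarrow> g\<close> (with
    \<open>f, g : A \<rightarrow> B\<close>) and \<open>\<beta> : f' \<Rightarrow> g'\<close> (with \<open>f', g' : B \<rightarrow> D\<close>).
\<close>

record ('o, 'm, 'c) two_cat =
  Obj :: "'o set"
  Hom :: "'o \<Rightarrow> 'o \<Rightarrow> 'm set"
  Cell :: "'o \<Rightarrow> 'o \<Rightarrow> 'm \<Rightarrow> 'm \<Rightarrow> 'c set"
  id1 :: "'o \<Rightarrow> 'm"
  comp1 :: "'o \<Rightarrow> 'o \<Rightarrow> 'o \<Rightarrow> 'm \<Rightarrow> 'm \<Rightarrow> 'm"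
  id2 :: "'o \<Rightarrow> 'o \<Rightarrow> 'm \<Rightarrow> 'c"
  vcomp :: "'o \<Rightarrow> 'o \<Rightarrow> 'm \<Rightarrow> 'm \<Rightarrow> 'm \<Rightarrow> 'c \<Rightarrow> 'c \<Rightarrow> 'c"
  hcomp :: "'o \<Rightarrow> 'o \<Rightarrow> 'o \<Rightarrow> 'm \<Rightarrow> 'm \<Rightarrow> 'm \<Rightarrow> 'm \<Rightarrow> 'c \<Rightarrow> 'c \<Rightarrow> 'c"

locale two_category =
  fixes C :: "('o, 'm, 'c) two_cat"
  assumes id1_in: "A \<in> Obj C \<Longrightarrow> id1 C A \<in> Hom C A A"
    and comp1_in: "\<lbrakk>{A, B, D} \<subseteq> Obj C; f \<in> Hom C A B; g \<in> Hom C B D\<rbrakk>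
      \<Longrightarrow> comp1 C A B D g f \<in> Hom C A D"
    and comp1_id: "\<lbrakk>{A, B} \<subseteq> Obj C; f \<in> Hom C A B\<rbrakk> \<Longrightarrow> comp1 C A A B f (id1 C A) = f"
    and id_comp1: "\<lbrakk>{A, B} \<subseteq> Obj C; f \<in> Hom C A B\<rbrakk> \<Longrightarrow> comp1 C A B B (id1 C B) f = f"
    and comp1_assoc: "\<lbrakk>{A, B, D, E} \<subseteq> Obj C; f \<in> Hom C A B; g \<in> Hom C B D; h \<in> Hom C D E\<rbrakk>
      \<Longrightarrow> comp1 C A D E h (comp1 C A B D g f) = comp1 C A B E (comp1 C B D E h g) f"
    and id2_in: "\<lbrakk>{A, B} \<subseteq> Obj C; f \<in> Hom C A B\<rbrakk> \<Longrightarrow> id2 C A B f \<in> Cell C A B f f"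
    and vcomp_in: "\<lbrakk>{A, B} \<subseteq> Obj C; {f, g, h} \<subseteq> Hom C A B;
        \<alpha> \<in> Cell C A B f g; \<beta> \<in> Cell C A B g h\<rbrakk> \<Longrightarrow> vcomp C A B f g h \<beta> \<alpha> \<in> Cell C A B f h"
    and vcomp_id: "\<lbrakk>{A, B} \<subseteq> Obj C; {f, g} \<subseteq> Hom C A B; \<alpha> \<in> Cell C A B f g\<rbrakk>
      \<Longrightarrow> vcomp C A B f f g \<alpha> (id2 C A B f) = \<alpha>"
    and id_vcomp: "\<lbrakk>{A, B} \<subseteq> Obj C; {f, g} \<subseteq> Hom C A B; \<alpha> \<in> Cell C A B f g\<rbrakk>
      \<Longrightarrow> vcomp C A B f g g (id2 C A B g) \<alpha> = \<alpha>"
    and vcomp_assoc: "\<lbrakk>{A, B} \<subseteq> Obj C; {f, g, h, k} \<subseteq> Hom C A B;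
        \<alpha> \<in> Cell C A B f g; \<beta> \<in> Cell C A B g h; \<gamma> \<in> Cell C A B h k\<rbrakk>
      \<Longrightarrow> vcomp C A B f h k \<gamma> (vcomp C A B f g h \<beta> \<alpha>) = vcomp C A B f g k (vcomp C A B g h k \<gamma> \<beta>) \<alpha>"
    and hcomp_in: "\<lbrakk>{A, B, D} \<subseteq> Obj C; {f, g} \<subseteq> Hom C A B; {f', g'} \<subseteq> Hom C B D;
        \<alpha> \<in> Cell C A B f g; \<beta> \<in> Cell C B D f' g'\<rbrakk>
      \<Longrightarrow> hcomp C A B D f g f' g' \<beta> \<alpha> \<in> Cell C A D (comp1 C A B D f' f) (comp1 C A B D g' g)"
    and hcomp_id: "\<lbrakk>{A, B} \<subseteq> Obj C; {f, g} \<subseteq> Hom C A B; \<alpha> \<in> Cell C A B f g\<rbrakk>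
      \<Longrightarrow> hcomp C A A B (id1 C A) (id1 C A) f g \<alpha> (id2 C A A (id1 C A)) = \<alpha>"
    and id_hcomp: "\<lbrakk>{A, B} \<subseteq> Obj C; {f, g} \<subseteq> Hom C A B; \<alpha> \<in> Cell C A B f g\<rbrakk>
      \<Longrightarrow> hcomp C A B B f g (id1 C B) (id1 C B) (id2 C B B (id1 C B)) \<alpha> = \<alpha>"
    and hcomp_assoc: "\<lbrakk>{A, B, D, E} \<subseteq> Obj C; {f, g} \<subseteq> Hom C A B; {f', g'} \<subseteq> Hom C B D;
        {f'', g''} \<subseteq> Hom C D E; \<alpha> \<in> Cell C A B f g; \<beta> \<in> Cell C B D f' g'; \<gamma> \<in> Cell C D E f'' g''\<rbrakk>
      \<Longrightarrow> hcomp C A D E (comp1 C A B D f' f) (comp1 C A B D g' g) f'' g''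
             \<gamma> (hcomp C A B D f g f' g' \<beta> \<alpha>)
         = hcomp C A B E f g (comp1 C B D E f'' f') (comp1 C B D E g'' g')
             (hcomp C B D E f' g' f'' g'' \<gamma> \<beta>) \<alpha>"
    and hcomp_id2: "\<lbrakk>{A, B, D} \<subseteq> Obj C; f \<in> Hom C A B; g \<in> Hom C B D\<rbrakk>
      \<Longrightarrow> hcomp C A B D f f g g (id2 C B D g) (id2 C A B f) = id2 C A D (comp1 C A B D g f)"
    and interchange: "\<lbrakk>{A, B, D} \<subseteq> Obj C; {f, g, h} \<subseteq> Hom C A B; {f', g', h'} \<subseteq> Hom C B D;
        \<alpha> \<in> Cell C A B f g; \<beta> \<in> Cell C A B g h; \<alpha>' \<in> Cell C B D f' g'; \<beta>' \<in> Cell C B D g' h'\<rbrakk>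
      \<Longrightarrow> hcomp C A B D f h f' h' (vcomp C B D f' g' h' \<beta>' \<alpha>') (vcomp C A B f g h \<beta> \<alpha>)
         = vcomp C A D (comp1 C A B D f' f) (comp1 C A B D g' g) (comp1 C A B D h' h)
             (hcomp C A B D g h g' h' \<beta>' \<beta>) (hcomp C A B D f g f' g' \<alpha>' \<alpha>)"

text \<open>As for the operations, the actions on 1-cells and 2-cells take the boundary as arguments.\<close>

record ('o, 'm, 'c, 'p, 'n, 'd) two_fun =
  on_obj :: "'o \<Rightarrow> 'p"
  on_hom :: "'o \<Rightarrow> 'o \<Rightarrow> 'm \<Rightarrow> 'n"
  on_cell :: "'o \<Rightarrow> 'o \<Rightarrow> 'm \<Rightarrow> 'm \<Rightarrow> 'c \<Rightarrow> 'd"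

locale two_functor =
  fixes C :: "('o, 'm, 'c) two_cat" and D :: "('p, 'n, 'd) two_cat"
    and F :: "('o, 'm, 'c, 'p, 'n, 'd) two_fun"
  assumes on_obj_in: "A \<in> Obj C \<Longrightarrow> on_obj F A \<in> Obj D"
    and on_hom_in: "\<lbrakk>{A, B} \<subseteq> Obj C; f \<in> Hom C A B\<rbrakk>
      \<Longrightarrow> on_hom F A B f \<in> Hom D (on_obj F A) (on_obj F B)"
    and on_cell_in: "\<lbrakk>{A, B} \<subseteq> Obj C; {f, g} \<subseteq> Hom C A B; \<alpha> \<in> Cell C A B f g\<rbrakk>
      \<Longrightarrow> on_cell F A B f g \<alpha>
          \<in> Cell D (on_obj F A) (on_obj F B) (on_hom F A B f) (on_hom F A B g)"
    and on_id1: "A \<in> Obj C \<Longrightarrow> on_hom F A A (id1 C A) = id1 D (on_obj F A)"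
    and on_comp1: "\<lbrakk>{A, B, E} \<subseteq> Obj C; f \<in> Hom C A B; g \<in> Hom C B E\<rbrakk>
      \<Longrightarrow> on_hom F A E (comp1 C A B E g f)
         = comp1 D (on_obj F A) (on_obj F B) (on_obj F E) (on_hom F B E g) (on_hom F A B f)"
    and on_id2: "\<lbrakk>{A, B} \<subseteq> Obj C; f \<in> Hom C A B\<rbrakk>
      \<Longrightarrow> on_cell F A B f f (id2 C A B f) = id2 D (on_obj F A) (on_obj F B) (on_hom F A B f)"
    and on_vcomp: "\<lbrakk>{A, B} \<subseteq> Obj C; {f, g, h} \<subseteq> Hom C A B;
        \<alpha> \<in> Cell C A B f g; \<beta> \<in> Cell C A B g h\<rbrakk>
      \<Longrightarrow> on_cell F A B f h (vcomp C A B f g h \<beta> \<alpha>)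
         = vcomp D (on_obj F A) (on_obj F B) (on_hom F A B f) (on_hom F A B g) (on_hom F A B h)
             (on_cell F A B g h \<beta>) (on_cell F A B f g \<alpha>)"
    and on_hcomp: "\<lbrakk>{A, B, E} \<subseteq> Obj C; {f, g} \<subseteq> Hom C A B; {f', g'} \<subseteq> Hom C B E;
        \<alpha> \<in> Cell C A B f g; \<beta> \<in> Cell C B E f' g'\<rbrakk>
      \<Longrightarrow> on_cell F A E (comp1 C A B E f' f) (comp1 C A B E g' g) (hcomp C A B E f g f' g' \<beta> \<alpha>)
         = hcomp D (on_obj F A) (on_obj F B) (on_obj F E)
             (on_hom F A B f) (on_hom F A B g) (on_hom F B E f') (on_hom F B E g')
             (on_cell F B E f' g' \<beta>) (on_cell F A B f g \<alpha>)"

definition id_two_fun :: "('o, 'm, 'c, 'o, 'm, 'c) two_fun" where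
  "id_two_fun = \<lparr>on_obj = \<lambda>A. A, on_hom = \<lambda>A B f. f, on_cell = \<lambda>A B f g \<alpha>. \<alpha>\<rparr>"

definition comp_two_fun ::
  "('p, 'n, 'd, 'q, 'l, 'e) two_fun \<Rightarrow> ('o, 'm, 'c, 'p, 'n, 'd) two_fun
    \<Rightarrow> ('o, 'm, 'c, 'q, 'l, 'e) two_fun" where
  "comp_two_fun G F =
    \<lparr>on_obj = \<lambda>A. on_obj G (on_obj F A),
     on_hom = \<lambda>A B f. on_hom G (on_obj F A) (on_obj F B) (on_hom F A B f),
     on_cell = \<lambda>A B f g \<alpha>. on_cell G (on_obj F A) (on_obj F B)
                 (on_hom F A B f) (on_hom F A B g) (on_cell F A B f g \<alpha>)\<rparr>"

text \<open>
  Strict 2-natural transformations \<open>\<eta> : F \<Rightarrow> G\<close>; in \<open>natural_cell\<close> the two sides are the whiskerings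
  of the images of \<open>\<alpha>\<close> with the components of \<open>\<eta>\<close>.
\<close>

locale two_natural =
  fixes C :: "('o, 'm, 'c) two_cat" and D :: "('p, 'n, 'd) two_cat"
    and F G :: "('o, 'm, 'c, 'p, 'n, 'd) two_fun" and \<eta> :: "'o \<Rightarrow> 'n"
  assumes component_in: "A \<in> Obj C \<Longrightarrow> \<eta> A \<in> Hom D (on_obj F A) (on_obj G A)"
    and natural_hom: "\<lbrakk>{A, B} \<subseteq> Obj C; f \<in> Hom C A B\<rbrakk>
      \<Longrightarrow> comp1 D (on_obj F A) (on_obj G A) (on_obj G B) (on_hom G A B f) (\<eta> A)
         = comp1 D (on_obj F A) (on_obj F B) (on_obj G B) (\<eta> B) (on_hom F A B f)"
    and natural_cell: "\<lbrakk>{A, B} \<subseteq> Obj C; {f, g} \<subseteq> Hom C A B; \<alpha> \<in> Cell C A B f g\<rbrakk>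
      \<Longrightarrow> hcomp D (on_obj F A) (on_obj G A) (on_obj G B)
             (\<eta> A) (\<eta> A) (on_hom G A B f) (on_hom G A B g)
             (on_cell G A B f g \<alpha>) (id2 D (on_obj F A) (on_obj G A) (\<eta> A))
         = hcomp D (on_obj F A) (on_obj F B) (on_obj G B)
             (on_hom F A B f) (on_hom F A B g) (\<eta> B) (\<eta> B)
             (id2 D (on_obj F B) (on_obj G B) (\<eta> B)) (on_cell F A B f g \<alpha>)"

definition naturally_isomorphic ::
  "('o, 'm, 'c) two_cat \<Rightarrow> ('p, 'n, 'd) two_cat
    \<Rightarrow> ('o, 'm, 'c, 'p, 'n, 'd) two_fun \<Rightarrow> ('o, 'm, 'c, 'p, 'n, 'd) two_fun \<Rightarrow> bool" where
  "naturally_isomorphic C D F G \<longleftrightarrow>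
    (\<exists>\<eta> \<theta>. two_natural C D F G \<eta> \<and> two_natural C D G F \<theta> \<and>
      (\<forall>A\<in>Obj C.
        comp1 D (on_obj F A) (on_obj G A) (on_obj F A) (\<theta> A) (\<eta> A) = id1 D (on_obj F A) \<and>
        comp1 D (on_obj G A) (on_obj F A) (on_obj G A) (\<eta> A) (\<theta> A) = id1 D (on_obj G A)))"

definition two_equivalent :: "('o, 'm, 'c) two_cat \<Rightarrow> ('p, 'n, 'd) two_cat \<Rightarrow> bool" where
  "two_equivalent C D \<longleftrightarrow>
    two_category C \<and> two_category D \<and>
    (\<exists>F G. two_functor C D F \<and> two_functor D C G \<and>
      naturally_isomorphic C C (comp_two_fun G F) id_two_fun \<and>
      naturally_isomorphic D D (comp_two_fun F G) id_two_fun)"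


section \<open>Linear and multilinear maps\<close>

text \<open>
  A vector space over the field \<open>K\<close> is a module over \<open>K\<close> whose carrier is a subset of a type. The
  type \<open>'u\<close> of the elements of all spaces below plays the role of the universe; it has to be
  infinite for direct sums of such spaces to exist inside it.
\<close>

definition linear_map ::
  "('k, 'r) ring_scheme \<Rightarrow> ('k, 'u) module \<Rightarrow> ('k, 'v) module \<Rightarrow> ('u \<Rightarrow> 'v) \<Rightarrow> bool" where
  "linear_map K V W f \<longleftrightarrow>
    f \<in> carrier V \<rightarrow> carrier W \<and>
    (\<forall>x\<in>carrier V. \<forall>y\<in>carrier V. f (x \<oplus>\<^bsub>V\<^esub> y) = f x \<oplus>\<^bsub>W\<^esub> f y) \<and>
    (\<forall>a\<in>carrier K. \<forall>x\<in>carrier V. f (a \<odot>\<^bsub>V\<^esub> x) = a \<odot>\<^bsub>W\<^esub> f x)"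

definition trilinear ::
  "('k, 'r) ring_scheme \<Rightarrow> ('k, 'u) module \<Rightarrow> ('k, 'u) module \<Rightarrow> ('k, 'u) module
    \<Rightarrow> ('k, 'v) module \<Rightarrow> ('u \<Rightarrow> 'u \<Rightarrow> 'u \<Rightarrow> 'v) \<Rightarrow> bool" where
  "trilinear K A B C W f \<longleftrightarrow>
    (\<forall>y\<in>carrier B. \<forall>z\<in>carrier C. linear_map K A W (\<lambda>x. f x y z)) \<and>
    (\<forall>x\<in>carrier A. \<forall>z\<in>carrier C. linear_map K B W (\<lambda>y. f x y z)) \<and>
    (\<forall>x\<in>carrier A. \<forall>y\<in>carrier B. linear_map K C W (\<lambda>z. f x y z))"

definition quintilinear ::
  "('k, 'r) ring_scheme \<Rightarrow> ('k, 'u) module \<Rightarrow> ('k, 'v) module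
    \<Rightarrow> ('u \<Rightarrow> 'u \<Rightarrow> 'u \<Rightarrow> 'u \<Rightarrow> 'u \<Rightarrow> 'v) \<Rightarrow> bool" where
  "quintilinear K V W f \<longleftrightarrow>
    (\<forall>p\<in>carrier V. \<forall>q\<in>carrier V. \<forall>r\<in>carrier V. \<forall>s\<in>carrier V.
      linear_map K V W (\<lambda>x. f x p q r s) \<and>
      linear_map K V W (\<lambda>x. f p x q r s) \<and>
      linear_map K V W (\<lambda>x. f p q x r s) \<and>
      linear_map K V W (\<lambda>x. f p q r x s) \<and>
      linear_map K V W (\<lambda>x. f p q r s x))"

text \<open>
  Skew-symmetry means a change of sign under transpositions of the arguments; adjacent
  transpositions suffice. A multilinear map on
  \<open>(V \<and> V) \<otimes> (V \<and> V \<and> V)\<close> is a map of five arguments that is skew-symmetric in the first two and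
  in the last three arguments.
\<close>

definition skew3 :: "('k, 'u) module \<Rightarrow> ('k, 'v) module \<Rightarrow> ('u \<Rightarrow> 'u \<Rightarrow> 'u \<Rightarrow> 'v) \<Rightarrow> bool" where
  "skew3 V W f \<longleftrightarrow>
    (\<forall>x\<in>carrier V. \<forall>y\<in>carrier V. \<forall>z\<in>carrier V.
      f y x z = \<ominus>\<^bsub>W\<^esub> f x y z \<and> f x z y = \<ominus>\<^bsub>W\<^esub> f x y z)"

definition skew23 ::
  "('k, 'u) module \<Rightarrow> ('k, 'v) module \<Rightarrow> ('u \<Rightarrow> 'u \<Rightarrow> 'u \<Rightarrow> 'u \<Rightarrow> 'u \<Rightarrow> 'v) \<Rightarrow> bool" where
  "skew23 V W f \<longleftrightarrow>
    (\<forall>p\<in>carrier V. \<forall>q\<in>carrier V. skew3 V W (f p q)) \<and>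
    (\<forall>p\<in>carrier V. \<forall>q\<in>carrier V. \<forall>x\<in>carrier V. \<forall>y\<in>carrier V. \<forall>z\<in>carrier V.
      f q p x y z = \<ominus>\<^bsub>W\<^esub> f p q x y z)"

text \<open>
  Linear maps that are components of 1-cells and 2-cells are taken to be undefined outside the
  carriers, so that equality of cells in HOL is equality of maps on the carriers.
\<close>

abbreviation extensional3 :: "('k, 'u) module \<Rightarrow> ('u \<Rightarrow> 'u \<Rightarrow> 'u \<Rightarrow> 'v) set" where
  "extensional3 V \<equiv> carrier V \<rightarrow>\<^sub>E carrier V \<rightarrow>\<^sub>E extensional (carrier V)"


section \<open>The 2-category of 2-term 3-Lie-infinity algebras\<close>

text \<open>
  \<open>l3 V i j k\<close> is the component of the trilinear bracket on \<open>V\<^sub>i \<times> V\<^sub>j \<times> V\<^sub>k\<close>.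
  The spaces of degree at least two are zero, so by \<open>ax_b\<close> the components of total degree
  at least two vanish.
\<close>

record ('k, 'u) lie3inf =
  V0 :: "('k, 'u) module"
  V1 :: "('k, 'u) module"
  dif :: "'u \<Rightarrow> 'u"
  l3 :: "nat \<Rightarrow> nat \<Rightarrow> nat \<Rightarrow> 'u \<Rightarrow> 'u \<Rightarrow> 'u \<Rightarrow> 'u"
  l5 :: "'u \<Rightarrow> 'u \<Rightarrow> 'u \<Rightarrow> 'u \<Rightarrow> 'u \<Rightarrow> 'u"

definition degree_part :: "('k, 'u) lie3inf \<Rightarrow> nat \<Rightarrow> ('k, 'u) module" where
  "degree_part V i = (if i = 0 then V0 V else V1 V)"

locale lie3inf_algebra =
  fixes K :: "('k, 'r) ring_scheme" and V :: "('k, 'u) lie3inf"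
  assumes V0_module: "module K (V0 V)"
    and V1_module: "module K (V1 V)"
    and dif_linear: "linear_map K (V1 V) (V0 V) (dif V)"
    and l3_trilinear: "i + j + k \<le> 1 \<Longrightarrow>
      trilinear K (degree_part V i) (degree_part V j) (degree_part V k) (degree_part V (i + j + k))
        (l3 V i j k)"
    and l3_skew:
      "\<lbrakk>i + j + k \<le> 1; x \<in> carrier (degree_part V i); y \<in> carrier (degree_part V j);
        z \<in> carrier (degree_part V k)\<rbrakk>
      \<Longrightarrow> l3 V j i k y x z = \<ominus>\<^bsub>degree_part V (i + j + k)\<^esub> l3 V i j k x y z \<and>
          l3 V i k j x z y = \<ominus>\<^bsub>degree_part V (i + j + k)\<^esub> l3 V i j k x y z"
    and l5_linear: "quintilinear K (V0 V) (V1 V) (l5 V)"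
    and l5_skew: "skew23 (V0 V) (V1 V) (l5 V)"
    and ax_a: "\<lbrakk>{x, y} \<subseteq> carrier (V0 V); f \<in> carrier (V1 V)\<rbrakk>
      \<Longrightarrow> dif V (l3 V 0 0 1 x y f) = l3 V 0 0 0 x y (dif V f)"
    and ax_b: "\<lbrakk>i \<le> 1; j \<le> 1; k \<le> 1; 2 \<le> i + j + k; x \<in> carrier (degree_part V i);
        y \<in> carrier (degree_part V j); z \<in> carrier (degree_part V k)\<rbrakk>
      \<Longrightarrow> l3 V i j k x y z = \<zero>\<^bsub>V1 V\<^esub>"
    and ax_c: "\<lbrakk>x \<in> carrier (V0 V); {f, g} \<subseteq> carrier (V1 V)\<rbrakk>
      \<Longrightarrow> l3 V 0 1 0 (dif V f) g x = l3 V 1 0 0 f (dif V g) x"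
    and ax_d: "{x1, x2, x3, x4, x5} \<subseteq> carrier (V0 V)
      \<Longrightarrow> dif V (l5 V x1 x2 x3 x4 x5)
         = \<ominus>\<^bsub>V0 V\<^esub> l3 V 0 0 0 x1 x2 (l3 V 0 0 0 x3 x4 x5)
           \<oplus>\<^bsub>V0 V\<^esub> l3 V 0 0 0 x3 (l3 V 0 0 0 x1 x2 x4) x5
           \<oplus>\<^bsub>V0 V\<^esub> l3 V 0 0 0 (l3 V 0 0 0 x1 x2 x3) x4 x5
           \<oplus>\<^bsub>V0 V\<^esub> l3 V 0 0 0 x3 x4 (l3 V 0 0 0 x1 x2 x5)"
    and ax_e: "\<lbrakk>f \<in> carrier (V1 V); {x2, x3, x4, x5} \<subseteq> carrier (V0 V)\<rbrakk>
      \<Longrightarrow> l5 V (dif V f) x2 x3 x4 x5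
         = \<ominus>\<^bsub>V1 V\<^esub> l3 V 1 0 0 f x2 (l3 V 0 0 0 x3 x4 x5)
           \<oplus>\<^bsub>V1 V\<^esub> l3 V 0 1 0 x3 (l3 V 1 0 0 f x2 x4) x5
           \<oplus>\<^bsub>V1 V\<^esub> l3 V 1 0 0 (l3 V 1 0 0 f x2 x3) x4 x5
           \<oplus>\<^bsub>V1 V\<^esub> l3 V 0 0 1 x3 x4 (l3 V 1 0 0 f x2 x5)"
    and ax_f: "\<lbrakk>f \<in> carrier (V1 V); {x1, x2, x4, x5} \<subseteq> carrier (V0 V)\<rbrakk>
      \<Longrightarrow> l5 V x1 x2 (dif V f) x4 x5
         = \<ominus>\<^bsub>V1 V\<^esub> l3 V 0 0 1 x1 x2 (l3 V 1 0 0 f x4 x5)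
           \<oplus>\<^bsub>V1 V\<^esub> l3 V 1 0 0 f (l3 V 0 0 0 x1 x2 x4) x5
           \<oplus>\<^bsub>V1 V\<^esub> l3 V 1 0 0 (l3 V 0 0 1 x1 x2 f) x4 x5
           \<oplus>\<^bsub>V1 V\<^esub> l3 V 1 0 0 f x4 (l3 V 0 0 0 x1 x2 x5)"
    and ax_g: "{x1, x2, x3, x4, x5, x6, x7} \<subseteq> carrier (V0 V)
      \<Longrightarrow> l3 V 1 0 0 (l5 V x1 x2 x3 x4 x5) x6 x7
           \<oplus>\<^bsub>V1 V\<^esub> l3 V 0 1 0 x5 (l5 V x1 x2 x3 x4 x6) x7
           \<oplus>\<^bsub>V1 V\<^esub> l3 V 0 0 1 x1 x2 (l5 V x3 x4 x5 x6 x7)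
           \<oplus>\<^bsub>V1 V\<^esub> l3 V 0 0 1 x5 x6 (l5 V x1 x2 x3 x4 x7)
           \<oplus>\<^bsub>V1 V\<^esub> l5 V x1 x2 (l3 V 0 0 0 x3 x4 x5) x6 x7
           \<oplus>\<^bsub>V1 V\<^esub> l5 V x1 x2 x5 (l3 V 0 0 0 x3 x4 x6) x7
           \<oplus>\<^bsub>V1 V\<^esub> l5 V x1 x2 x5 x6 (l3 V 0 0 0 x3 x4 x7)
         = l3 V 0 0 1 x3 x4 (l5 V x1 x2 x5 x6 x7)
           \<oplus>\<^bsub>V1 V\<^esub> l5 V (l3 V 0 0 0 x1 x2 x3) x4 x5 x6 x7
           \<oplus>\<^bsub>V1 V\<^esub> l5 V x3 (l3 V 0 0 0 x1 x2 x4) x5 x6 x7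
           \<oplus>\<^bsub>V1 V\<^esub> l5 V x3 x4 (l3 V 0 0 0 x1 x2 x5) x6 x7
           \<oplus>\<^bsub>V1 V\<^esub> l5 V x3 x4 x5 (l3 V 0 0 0 x1 x2 x6) x7
           \<oplus>\<^bsub>V1 V\<^esub> l5 V x1 x2 x3 x4 (l3 V 0 0 0 x5 x6 x7)
           \<oplus>\<^bsub>V1 V\<^esub> l5 V x3 x4 x5 x6 (l3 V 0 0 0 x1 x2 x7)"

record 'u lie3inf_map =
  ph0 :: "'u \<Rightarrow> 'u"
  ph1 :: "'u \<Rightarrow> 'u"
  ph2 :: "'u \<Rightarrow> 'u \<Rightarrow> 'u \<Rightarrow> 'u"

locale lie3inf_hom =
  fixes K :: "('k, 'r) ring_scheme" and V V' :: "('k, 'u) lie3inf" and \<phi> :: "'u lie3inf_map"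
  assumes ph_extensional:
      "ph0 \<phi> \<in> extensional (carrier (V0 V))" "ph1 \<phi> \<in> extensional (carrier (V1 V))"
      "ph2 \<phi> \<in> extensional3 (V0 V)"
    and ph0_linear: "linear_map K (V0 V) (V0 V') (ph0 \<phi>)"
    and ph1_linear: "linear_map K (V1 V) (V1 V') (ph1 \<phi>)"
    and chain_map: "f \<in> carrier (V1 V) \<Longrightarrow> ph0 \<phi> (dif V f) = dif V' (ph1 \<phi> f)"
    and ph2_trilinear: "trilinear K (V0 V) (V0 V) (V0 V) (V1 V') (ph2 \<phi>)"
    and ph2_skew: "skew3 (V0 V) (V1 V') (ph2 \<phi>)"
    and dif_ph2: "{x1, x2, x3} \<subseteq> carrier (V0 V)
      \<Longrightarrow> dif V' (ph2 \<phi> x1 x2 x3)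
         = ph0 \<phi> (l3 V 0 0 0 x1 x2 x3) \<ominus>\<^bsub>V0 V'\<^esub> l3 V' 0 0 0 (ph0 \<phi> x1) (ph0 \<phi> x2) (ph0 \<phi> x3)"
    and ph2_dif: "\<lbrakk>{x1, x2} \<subseteq> carrier (V0 V); h \<in> carrier (V1 V)\<rbrakk>
      \<Longrightarrow> ph2 \<phi> x1 x2 (dif V h)
         = ph1 \<phi> (l3 V 0 0 1 x1 x2 h) \<ominus>\<^bsub>V1 V'\<^esub> l3 V' 0 0 1 (ph0 \<phi> x1) (ph0 \<phi> x2) (ph1 \<phi> h)"
    and ph_coherence: "{x1, x2, x3, x4, x5} \<subseteq> carrier (V0 V)
      \<Longrightarrow> l5 V' (ph0 \<phi> x1) (ph0 \<phi> x2) (ph0 \<phi> x3) (ph0 \<phi> x4) (ph0 \<phi> x5)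
           \<oplus>\<^bsub>V1 V'\<^esub> l3 V' 1 0 0 (ph2 \<phi> x1 x2 x3) (ph0 \<phi> x4) (ph0 \<phi> x5)
           \<oplus>\<^bsub>V1 V'\<^esub> l3 V' 0 1 0 (ph0 \<phi> x3) (ph2 \<phi> x1 x2 x4) (ph0 \<phi> x5)
           \<oplus>\<^bsub>V1 V'\<^esub> l3 V' 0 0 1 (ph0 \<phi> x3) (ph0 \<phi> x4) (ph2 \<phi> x1 x2 x5)
           \<oplus>\<^bsub>V1 V'\<^esub> ph2 \<phi> (l3 V 0 0 0 x1 x2 x3) x4 x5
           \<oplus>\<^bsub>V1 V'\<^esub> ph2 \<phi> x3 (l3 V 0 0 0 x1 x2 x4) x5
           \<oplus>\<^bsub>V1 V'\<^esub> ph2 \<phi> x3 x4 (l3 V 0 0 0 x1 x2 x5)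
         = l3 V' 0 0 1 (ph0 \<phi> x1) (ph0 \<phi> x2) (ph2 \<phi> x3 x4 x5)
           \<oplus>\<^bsub>V1 V'\<^esub> ph2 \<phi> x1 x2 (l3 V 0 0 0 x3 x4 x5)
           \<oplus>\<^bsub>V1 V'\<^esub> ph1 \<phi> (l5 V x1 x2 x3 x4 x5)"

definition lie3inf_id :: "('k, 'u) lie3inf \<Rightarrow> 'u lie3inf_map" where
  "lie3inf_id V =
    \<lparr>ph0 = \<lambda>x\<in>carrier (V0 V). x,
     ph1 = \<lambda>f\<in>carrier (V1 V). f,
     ph2 = \<lambda>x\<in>carrier (V0 V). \<lambda>y\<in>carrier (V0 V). \<lambda>z\<in>carrier (V0 V). \<zero>\<^bsub>V1 V\<^esub>\<rparr>"

definition lie3inf_comp ::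
  "('k, 'u) lie3inf \<Rightarrow> ('k, 'u) lie3inf \<Rightarrow> ('k, 'u) lie3inf
    \<Rightarrow> 'u lie3inf_map \<Rightarrow> 'u lie3inf_map \<Rightarrow> 'u lie3inf_map" where
  "lie3inf_comp V V' V'' \<psi> \<phi> =
    \<lparr>ph0 = \<lambda>x\<in>carrier (V0 V). ph0 \<psi> (ph0 \<phi> x),
     ph1 = \<lambda>f\<in>carrier (V1 V). ph1 \<psi> (ph1 \<phi> f),
     ph2 = \<lambda>x\<in>carrier (V0 V). \<lambda>y\<in>carrier (V0 V). \<lambda>z\<in>carrier (V0 V).
       ph2 \<psi> (ph0 \<phi> x) (ph0 \<phi> y) (ph0 \<phi> z) \<oplus>\<^bsub>V1 V''\<^esub> ph1 \<psi> (ph2 \<phi> x y z)\<rparr>"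

locale lie3inf_2hom =
  fixes K :: "('k, 'r) ring_scheme" and V V' :: "('k, 'u) lie3inf" and \<phi> \<psi> :: "'u lie3inf_map"
    and \<tau> :: "'u \<Rightarrow> 'u"
  assumes extensional: "\<tau> \<in> extensional (carrier (V0 V))"
    and linear: "linear_map K (V0 V) (V1 V') \<tau>"
    and dif_homotopy: "x \<in> carrier (V0 V) \<Longrightarrow> dif V' (\<tau> x) = ph0 \<psi> x \<ominus>\<^bsub>V0 V'\<^esub> ph0 \<phi> x"
    and homotopy_dif: "f \<in> carrier (V1 V) \<Longrightarrow> \<tau> (dif V f) = ph1 \<psi> f \<ominus>\<^bsub>V1 V'\<^esub> ph1 \<phi> f"
    and homotopy_ph2: "{x1, x2, x3} \<subseteq> carrier (V0 V)
      \<Longrightarrow> ph2 \<phi> x1 x2 x3 \<ominus>\<^bsub>V1 V'\<^esub> ph2 \<psi> x1 x2 x3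
         = (l3 V' 0 0 1 (ph0 \<phi> x1) (ph0 \<phi> x2) (\<tau> x3)
             \<oplus>\<^bsub>V1 V'\<^esub> l3 V' 0 1 0 (dif V' (\<tau> x1)) (\<tau> x2) (ph0 \<phi> x3)
             \<oplus>\<^bsub>V1 V'\<^esub> l3 V' 0 0 1 (ph0 \<phi> x2) (ph0 \<phi> x3) (\<tau> x1)
             \<oplus>\<^bsub>V1 V'\<^esub> l3 V' 0 1 0 (dif V' (\<tau> x2)) (\<tau> x3) (ph0 \<phi> x1)
             \<oplus>\<^bsub>V1 V'\<^esub> l3 V' 0 0 1 (ph0 \<phi> x3) (ph0 \<phi> x1) (\<tau> x2)
             \<oplus>\<^bsub>V1 V'\<^esub> l3 V' 0 1 0 (dif V' (\<tau> x3)) (\<tau> x1) (ph0 \<phi> x2))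
           \<ominus>\<^bsub>V1 V'\<^esub> \<tau> (l3 V 0 0 0 x1 x2 x3)
           \<oplus>\<^bsub>V1 V'\<^esub> l3 V' 0 0 1 (dif V' (\<tau> x1)) (dif V' (\<tau> x2)) (\<tau> x3)"

definition TwoTerm3LieInf ::
  "('k, 'r) ring_scheme \<Rightarrow> (('k, 'u) lie3inf, 'u lie3inf_map, 'u \<Rightarrow> 'u) two_cat" where
  "TwoTerm3LieInf K =
    \<lparr>Obj = {V. lie3inf_algebra K V},
     Hom = \<lambda>V V'. {\<phi>. lie3inf_hom K V V' \<phi>},
     Cell = \<lambda>V V' \<phi> \<psi>. {\<tau>. lie3inf_2hom K V V' \<phi> \<psi> \<tau>},
     id1 = lie3inf_id,
     comp1 = lie3inf_comp,
     id2 = \<lambda>V V' \<phi>. \<lambda>x\<in>carrier (V0 V). \<zero>\<^bsub>V1 V'\<^esub>,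
     vcomp = \<lambda>V V' \<phi> \<psi> \<mu> \<tau>' \<tau>. \<lambda>x\<in>carrier (V0 V). \<tau>' x \<oplus>\<^bsub>V1 V'\<^esub> \<tau> x,
     hcomp = \<lambda>V V' V'' \<phi> \<psi> \<phi>' \<psi>' \<tau>' \<tau>. \<lambda>x\<in>carrier (V0 V). \<tau>' (ph0 \<phi> x) \<oplus>\<^bsub>V1 V''\<^esub> ph1 \<psi>' (\<tau> x)\<rparr>"


section \<open>The 2-category of 3-Lie 2-algebras\<close>

text \<open>
  A category internal to vector spaces. Composition is written in diagrammatic order:
  \<open>seq L f g\<close> is \<open>f\<close> followed by \<open>g\<close>, meaningful if the target of \<open>f\<close> is the source of \<open>g\<close>.
\<close>

record ('k, 'u) two_vect =
  L0 :: "('k, 'u) module"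
  L1 :: "('k, 'u) module"
  src :: "'u \<Rightarrow> 'u"
  tgt :: "'u \<Rightarrow> 'u"
  unt :: "'u \<Rightarrow> 'u"
  seq :: "'u \<Rightarrow> 'u \<Rightarrow> 'u"

definition arr :: "('k, 'u, 'x) two_vect_scheme \<Rightarrow> 'u \<Rightarrow> 'u \<Rightarrow> 'u set" where
  "arr L x y = {f \<in> carrier (L1 L). src L f = x \<and> tgt L f = y}"

definition composable :: "('k, 'u, 'x) two_vect_scheme \<Rightarrow> 'u \<Rightarrow> 'u \<Rightarrow> bool" where
  "composable L f g \<longleftrightarrow> f \<in> carrier (L1 L) \<and> g \<in> carrier (L1 L) \<and> tgt L f = src L g"

definition invertible_arr :: "('k, 'u, 'x) two_vect_scheme \<Rightarrow> 'u \<Rightarrow> bool" where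
  "invertible_arr L f \<longleftrightarrow> f \<in> carrier (L1 L) \<and>
    (\<exists>g \<in> arr L (tgt L f) (src L f). seq L f g = unt L (src L f) \<and> seq L g f = unt L (tgt L f))"

locale two_vector_space =
  fixes K :: "('k, 'r) ring_scheme" and L :: "('k, 'u, 'x) two_vect_scheme"
  assumes L0_module: "module K (L0 L)"
    and L1_module: "module K (L1 L)"
    and src_linear: "linear_map K (L1 L) (L0 L) (src L)"
    and tgt_linear: "linear_map K (L1 L) (L0 L) (tgt L)"
    and unt_linear: "linear_map K (L0 L) (L1 L) (unt L)"
    and unt_arr: "x \<in> carrier (L0 L) \<Longrightarrow> unt L x \<in> arr L x x"
    and seq_arr: "composable L f g \<Longrightarrow> seq L f g \<in> arr L (src L f) (tgt L g)"
    and unt_seq: "f \<in> carrier (L1 L) \<Longrightarrow> seq L (unt L (src L f)) f = f"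
    and seq_unt: "f \<in> carrier (L1 L) \<Longrightarrow> seq L f (unt L (tgt L f)) = f"
    and seq_assoc: "\<lbrakk>composable L f g; composable L g h\<rbrakk>
      \<Longrightarrow> seq L (seq L f g) h = seq L f (seq L g h)"
    and seq_add: "\<lbrakk>composable L f g; composable L f' g'\<rbrakk>
      \<Longrightarrow> seq L (f \<oplus>\<^bsub>L1 L\<^esub> f') (g \<oplus>\<^bsub>L1 L\<^esub> g') = seq L f g \<oplus>\<^bsub>L1 L\<^esub> seq L f' g'"
    and seq_smult: "\<lbrakk>a \<in> carrier K; composable L f g\<rbrakk>
      \<Longrightarrow> seq L (a \<odot>\<^bsub>L1 L\<^esub> f) (a \<odot>\<^bsub>L1 L\<^esub> g) = a \<odot>\<^bsub>L1 L\<^esub> seq L f g"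

text \<open>
  \<open>br0\<close> and \<open>br1\<close> are the actions of the bracket functor on objects and on morphisms.
\<close>

record ('k, 'u) three_lie2 = "('k, 'u) two_vect" +
  br0 :: "'u \<Rightarrow> 'u \<Rightarrow> 'u \<Rightarrow> 'u"
  br1 :: "'u \<Rightarrow> 'u \<Rightarrow> 'u \<Rightarrow> 'u"
  Jac :: "'u \<Rightarrow> 'u \<Rightarrow> 'u \<Rightarrow> 'u \<Rightarrow> 'u \<Rightarrow> 'u"

locale bracket_functor = two_vector_space K L
  for K :: "('k, 'r) ring_scheme" and L :: "('k, 'u) three_lie2" +
  assumes br0_trilinear: "trilinear K (L0 L) (L0 L) (L0 L) (L0 L) (br0 L)"
    and br1_trilinear: "trilinear K (L1 L) (L1 L) (L1 L) (L1 L) (br1 L)"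
    and br0_skew: "skew3 (L0 L) (L0 L) (br0 L)"
    and br1_skew: "skew3 (L1 L) (L1 L) (br1 L)"
    and src_br: "{f, g, h} \<subseteq> carrier (L1 L)
      \<Longrightarrow> src L (br1 L f g h) = br0 L (src L f) (src L g) (src L h)"
    and tgt_br: "{f, g, h} \<subseteq> carrier (L1 L)
      \<Longrightarrow> tgt L (br1 L f g h) = br0 L (tgt L f) (tgt L g) (tgt L h)"
    and br_unt: "{x, y, z} \<subseteq> carrier (L0 L)
      \<Longrightarrow> br1 L (unt L x) (unt L y) (unt L z) = unt L (br0 L x y z)"
    and br_seq: "\<lbrakk>composable L f f'; composable L g g'; composable L h h'\<rbrakk>
      \<Longrightarrow> br1 L (seq L f f') (seq L g g') (seq L h h') = seq L (br1 L f g h) (br1 L f' g' h')"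
begin

abbreviation b ("b'(_,/ _,/ _')") where "b(x, y, z) \<equiv> br0 L x y z"
abbreviation m ("m'(_,/ _,/ _')") where "m(f, g, h) \<equiv> br1 L f g h"
abbreviation add0 (infixl "+\<^sub>0" 65) where "x +\<^sub>0 y \<equiv> x \<oplus>\<^bsub>L0 L\<^esub> y"
abbreviation add1 (infixl "+\<^sub>1" 65) where "f +\<^sub>1 g \<equiv> f \<oplus>\<^bsub>L1 L\<^esub> g"
abbreviation seq_infix (infixl ";;" 55) where "f ;; g \<equiv> seq L f g"
abbreviation unit_arr ("\<iota>") where "\<iota> \<equiv> unt L"
abbreviation "J \<equiv> Jac L"

end

text \<open>
  The isomorphism \<open>J\<close> is multilinear on \<open>(L \<and> L) \<otimes> (L \<and> L \<and> L)\<close>: like its source and target, it is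
  skew-symmetric in the first two and in the last three arguments. This has to be required, since
  \<open>J\<close> corresponds to the map \<open>l\<^sub>5\<close>, which is defined on \<open>(V\<^sub>0 \<and> V\<^sub>0) \<otimes> (V\<^sub>0 \<and> V\<^sub>0 \<and> V\<^sub>0)\<close>, and it
  does not follow from multilinearity and naturality.

  In \<open>J_coherence\<close> the units in the third and fourth factor on the left and in the second factor on
  the right are those of the summands of the current object that the bracketed \<open>J\<close> does not touch.
\<close>

locale three_lie_2_algebra = bracket_functor K L
  for K :: "('k, 'r) ring_scheme" and L :: "('k, 'u) three_lie2" +
  assumes J_linear: "quintilinear K (L0 L) (L1 L) J"
    and J_skew: "skew23 (L0 L) (L1 L) J"
    and J_arr: "{x1, x2, x3, x4, x5} \<subseteq> carrier (L0 L)
      \<Longrightarrow> J x1 x2 x3 x4 x5 \<in> arr L (b(x1, x2, b(x3, x4, x5)))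
            (b(b(x1, x2, x3), x4, x5) +\<^sub>0 b(x3, b(x1, x2, x4), x5) +\<^sub>0 b(x3, x4, b(x1, x2, x5)))"
    and J_natural: "{f1, f2, f3, f4, f5} \<subseteq> carrier (L1 L)
      \<Longrightarrow> m(f1, f2, m(f3, f4, f5)) ;; J (tgt L f1) (tgt L f2) (tgt L f3) (tgt L f4) (tgt L f5)
         = J (src L f1) (src L f2) (src L f3) (src L f4) (src L f5) ;;
           m(m(f1, f2, f3), f4, f5) +\<^sub>1 m(f3, m(f1, f2, f4), f5) +\<^sub>1 m(f3, f4, m(f1, f2, f5))"
    and J_iso: "{x1, x2, x3, x4, x5} \<subseteq> carrier (L0 L) \<Longrightarrow> invertible_arr L (J x1 x2 x3 x4 x5)"
    and J_coherence: "{x1, x2, x3, x4, x5, x6, x7} \<subseteq> carrier (L0 L)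
      \<Longrightarrow> m(\<iota> x1, \<iota> x2, J x3 x4 x5 x6 x7) ;;
           (J x1 x2 (b(x3, x4, x5)) x6 x7 +\<^sub>1 J x1 x2 x5 (b(x3, x4, x6)) x7
             +\<^sub>1 J x1 x2 x5 x6 (b(x3, x4, x7))) ;;
           (m(\<iota> x5, \<iota> x6, J x1 x2 x3 x4 x7)
             +\<^sub>1 \<iota> (b(b(x1, x2, b(x3, x4, x5)), x6, x7)
                  +\<^sub>0 b(b(x3, x4, x5), b(x1, x2, x6), x7)
                  +\<^sub>0 b(b(x3, x4, x5), x6, b(x1, x2, x7))
                  +\<^sub>0 b(b(x1, x2, x5), b(x3, x4, x6), x7)
                  +\<^sub>0 b(x5, b(x1, x2, b(x3, x4, x6)), x7)
                  +\<^sub>0 b(x5, b(x3, x4, x6), b(x1, x2, x7))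
                  +\<^sub>0 b(b(x1, x2, x5), x6, b(x3, x4, x7))
                  +\<^sub>0 b(x5, b(x1, x2, x6), b(x3, x4, x7)))) ;;
           (m(\<iota> x5, J x1 x2 x3 x4 x6, \<iota> x7) +\<^sub>1 m(J x1 x2 x3 x4 x5, \<iota> x6, \<iota> x7)
             +\<^sub>1 \<iota> (b(b(x3, x4, x5), b(x1, x2, x6), x7)
                  +\<^sub>0 b(b(x3, x4, x5), x6, b(x1, x2, x7))
                  +\<^sub>0 b(b(x1, x2, x5), b(x3, x4, x6), x7)
                  +\<^sub>0 b(x5, b(x3, x4, x6), b(x1, x2, x7))
                  +\<^sub>0 b(b(x1, x2, x5), x6, b(x3, x4, x7))
                  +\<^sub>0 b(x5, b(x1, x2, x6), b(x3, x4, x7))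
                  +\<^sub>0 b(x5, x6, b(b(x1, x2, x3), x4, x7))
                  +\<^sub>0 b(x5, x6, b(x3, b(x1, x2, x4), x7))
                  +\<^sub>0 b(x5, x6, b(x3, x4, b(x1, x2, x7)))))
         = J x1 x2 x3 x4 (b(x5, x6, x7)) ;;
           (m(\<iota> x3, \<iota> x4, J x1 x2 x5 x6 x7)
             +\<^sub>1 \<iota> (b(b(x1, x2, x3), x4, b(x5, x6, x7)) +\<^sub>0 b(x3, b(x1, x2, x4), b(x5, x6, x7)))) ;;
           (J (b(x1, x2, x3)) x4 x5 x6 x7 +\<^sub>1 J x3 (b(x1, x2, x4)) x5 x6 x7
             +\<^sub>1 J x3 x4 (b(x1, x2, x5)) x6 x7 +\<^sub>1 J x3 x4 x5 (b(x1, x2, x6)) x7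
             +\<^sub>1 J x3 x4 x5 x6 (b(x1, x2, x7)))"

record 'u three_lie2_map =
  fn0 :: "'u \<Rightarrow> 'u"
  fn1 :: "'u \<Rightarrow> 'u"
  fn2 :: "'u \<Rightarrow> 'u \<Rightarrow> 'u \<Rightarrow> 'u"

locale three_lie2_hom =
  fixes K :: "('k, 'r) ring_scheme" and L L' :: "('k, 'u) three_lie2" and F :: "'u three_lie2_map"
  assumes fn_extensional:
      "fn0 F \<in> extensional (carrier (L0 L))" "fn1 F \<in> extensional (carrier (L1 L))"
      "fn2 F \<in> extensional3 (L0 L)"
    and fn0_linear: "linear_map K (L0 L) (L0 L') (fn0 F)"
    and fn1_linear: "linear_map K (L1 L) (L1 L') (fn1 F)"
    and fn_src: "f \<in> carrier (L1 L) \<Longrightarrow> src L' (fn1 F f) = fn0 F (src L f)"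
    and fn_tgt: "f \<in> carrier (L1 L) \<Longrightarrow> tgt L' (fn1 F f) = fn0 F (tgt L f)"
    and fn_unt: "x \<in> carrier (L0 L) \<Longrightarrow> fn1 F (unt L x) = unt L' (fn0 F x)"
    and fn_seq: "composable L f g \<Longrightarrow> fn1 F (seq L f g) = seq L' (fn1 F f) (fn1 F g)"
    and fn2_trilinear: "trilinear K (L0 L) (L0 L) (L0 L) (L1 L') (fn2 F)"
    and fn2_skew: "skew3 (L0 L) (L1 L') (fn2 F)"
    and fn2_arr: "{x, y, z} \<subseteq> carrier (L0 L)
      \<Longrightarrow> fn2 F x y z \<in> arr L' (br0 L' (fn0 F x) (fn0 F y) (fn0 F z)) (fn0 F (br0 L x y z))"
    and fn2_natural: "{f, g, h} \<subseteq> carrier (L1 L)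
      \<Longrightarrow> seq L' (br1 L' (fn1 F f) (fn1 F g) (fn1 F h)) (fn2 F (tgt L f) (tgt L g) (tgt L h))
         = seq L' (fn2 F (src L f) (src L g) (src L h)) (fn1 F (br1 L f g h))"
    and fn_coherence: "{x1, x2, x3, x4, x5} \<subseteq> carrier (L0 L)
      \<Longrightarrow> seq L' (seq L'
             (Jac L' (fn0 F x1) (fn0 F x2) (fn0 F x3) (fn0 F x4) (fn0 F x5))
             (br1 L' (fn2 F x1 x2 x3) (unt L' (fn0 F x4)) (unt L' (fn0 F x5))
               \<oplus>\<^bsub>L1 L'\<^esub> br1 L' (unt L' (fn0 F x3)) (fn2 F x1 x2 x4) (unt L' (fn0 F x5))
               \<oplus>\<^bsub>L1 L'\<^esub> br1 L' (unt L' (fn0 F x3)) (unt L' (fn0 F x4)) (fn2 F x1 x2 x5)))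
             (fn2 F (br0 L x1 x2 x3) x4 x5
               \<oplus>\<^bsub>L1 L'\<^esub> fn2 F x3 (br0 L x1 x2 x4) x5
               \<oplus>\<^bsub>L1 L'\<^esub> fn2 F x3 x4 (br0 L x1 x2 x5))
         = seq L' (seq L'
             (br1 L' (unt L' (fn0 F x1)) (unt L' (fn0 F x2)) (fn2 F x3 x4 x5))
             (fn2 F x1 x2 (br0 L x3 x4 x5)))
             (fn1 F (Jac L x1 x2 x3 x4 x5))"

definition three_lie2_id :: "('k, 'u) three_lie2 \<Rightarrow> 'u three_lie2_map" where
  "three_lie2_id L =
    \<lparr>fn0 = \<lambda>x\<in>carrier (L0 L). x,
     fn1 = \<lambda>f\<in>carrier (L1 L). f,
     fn2 = \<lambda>x\<in>carrier (L0 L). \<lambda>y\<in>carrier (L0 L). \<lambda>z\<in>carrier (L0 L). unt L (br0 L x y z)\<rparr>"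

definition three_lie2_comp ::
  "('k, 'u) three_lie2 \<Rightarrow> ('k, 'u) three_lie2 \<Rightarrow> ('k, 'u) three_lie2
    \<Rightarrow> 'u three_lie2_map \<Rightarrow> 'u three_lie2_map \<Rightarrow> 'u three_lie2_map" where
  "three_lie2_comp L L' L'' G F =
    \<lparr>fn0 = \<lambda>x\<in>carrier (L0 L). fn0 G (fn0 F x),
     fn1 = \<lambda>f\<in>carrier (L1 L). fn1 G (fn1 F f),
     fn2 = \<lambda>x\<in>carrier (L0 L). \<lambda>y\<in>carrier (L0 L). \<lambda>z\<in>carrier (L0 L).
       seq L'' (fn2 G (fn0 F x) (fn0 F y) (fn0 F z)) (fn1 G (fn2 F x y z))\<rparr>"

locale three_lie2_2hom =
  fixes K :: "('k, 'r) ring_scheme" and L L' :: "('k, 'u) three_lie2" and F G :: "'u three_lie2_map"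
    and \<theta> :: "'u \<Rightarrow> 'u"
  assumes extensional: "\<theta> \<in> extensional (carrier (L0 L))"
    and linear: "linear_map K (L0 L) (L1 L') \<theta>"
    and component: "x \<in> carrier (L0 L) \<Longrightarrow> \<theta> x \<in> arr L' (fn0 F x) (fn0 G x)"
    and natural: "f \<in> carrier (L1 L)
      \<Longrightarrow> seq L' (fn1 F f) (\<theta> (tgt L f)) = seq L' (\<theta> (src L f)) (fn1 G f)"
    and bracket: "{x, y, z} \<subseteq> carrier (L0 L)
      \<Longrightarrow> seq L' (fn2 F x y z) (\<theta> (br0 L x y z))
         = seq L' (br1 L' (\<theta> x) (\<theta> y) (\<theta> z)) (fn2 G x y z)"

definition ThreeLie2Alg ::
  "('k, 'r) ring_scheme \<Rightarrow> (('k, 'u) three_lie2, 'u three_lie2_map, 'u \<Rightarrow> 'u) two_cat" where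
  "ThreeLie2Alg K =
    \<lparr>Obj = {L. three_lie_2_algebra K L},
     Hom = \<lambda>L L'. {F. three_lie2_hom K L L' F},
     Cell = \<lambda>L L' F G. {\<theta>. three_lie2_2hom K L L' F G \<theta>},
     id1 = three_lie2_id,
     comp1 = three_lie2_comp,
     id2 = \<lambda>L L' F. \<lambda>x\<in>carrier (L0 L). unt L' (fn0 F x),
     vcomp = \<lambda>L L' F G H \<theta>' \<theta>. \<lambda>x\<in>carrier (L0 L). seq L' (\<theta> x) (\<theta>' x),
     hcomp = \<lambda>L L' L'' F G F' G' \<theta>' \<theta>. \<lambda>x\<in>carrier (L0 L). seq L'' (\<theta>' (fn0 F x)) (fn1 G' (\<theta> x))\<rparr>"

end

(*
  A 2-vector space with space of objects V0 is V0 (+) V1, where V1 is the kernel of the source map: an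
  arrow is a pair of its source x and its arrow part f, with target x + df, and composition adds arrow
  parts. In these terms a 3-Lie 2-algebra is a 2-term 3-Lie-infinity algebra: functoriality
  of the bracket is the compatibility of l3 with d, the arrow part of the Jacobiator is l5, and
  the coherence laws say that sums of arrow parts agree. The same translation applies to
  homomorphisms and 2-homomorphisms. It gives an operation-preserving bijection of hom-categories from
  2Term3-Lie-infinity to 3Lie2Alg, which is essentially surjective because L is strictly isomorphic
  to the 3-Lie 2-algebra built from its kernel complex. Any such bijection is half of a 2-equivalence;
  moreover it makes 2Term3-Lie-infinity inherit its 2-category laws from 3Lie2Alg, where they
  follow from pasting of diagrams.
*)
theory Submission
  imports Defs "HOL-Library.Function_Algebras"
begin

section \<open>The word problem for abelian groups\<close>

text \<open>Linearity leaves no choice for composition: if \<open>y\<close> is the middle object,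
  \<open>f\<close> followed by \<open>g\<close> must be \<open>f + g - 1_y\<close>. Two things still
  resist a direct translation. The bracket of three arrows has no formula symmetric in its
  arguments: its arrow part is summed along a path on which the arguments move one after another,
  and independence of the order of the moves is what \<open>ax_c\<close> provides. Likewise the
  Jacobiator must be natural in five arrows at once, whereas \<open>ax_e\<close> and
  \<open>ax_f\<close> each move a single argument; composing naturality squares bridges the gap,
  with skew-symmetry supplying the remaining arguments. A third obstacle is the universe: the direct
  sum of two spaces on a type has to live on the same type, hence an injective coding of pairs,
  available because the type is infinite. Finally, boundaries are arguments of the operations, so a
  law for 2-cells can be stated on one hom-set only after the matching law for 1-cells has
  identified the boundaries.\<close>

context abelian_group
begin

text \<open>
  \<open>combines e \<phi>\<close> says that \<open>e\<close> is the integer linear combination of group elements with coefficients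
  \<open>\<phi>\<close>. Equality of two expressions then follows from equality of their coefficient functions, which
  live in a type of class \<open>ab_group_add\<close>, where the simplifier decides it.
\<close>

definition combines :: "'a \<Rightarrow> ('a \<Rightarrow> int) \<Rightarrow> bool" where
  "combines e \<phi> \<longleftrightarrow> (\<exists>S. finite S \<and> S \<subseteq> carrier G \<and> (\<forall>a. a \<notin> S \<longrightarrow> \<phi> a = 0) \<and>
    e = (\<Oplus>a\<in>S. [\<phi> a] \<cdot> a))"

definition delta :: "'a \<Rightarrow> 'a \<Rightarrow> int" where
  "delta a = (\<lambda>x. if x = a then 1 else 0)"

text \<open>Zero coefficients contribute nothing, so a support may be enlarged. This puts two
  combinations over the union of their supports, where they can be compared and added.\<close>

lemma combination_superset:
  assumes "finite T" "S \<subseteq> T" "T \<subseteq> carrier G" "\<And>a. a \<notin> S \<Longrightarrow> \<phi> a = (0::int)"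
  shows "(\<Oplus>a\<in>S. [\<phi> a] \<cdot> a) = (\<Oplus>a\<in>T. [\<phi> a] \<cdot> a)"
proof -
  have "[(0::int)] \<cdot> a = \<zero>" for a
    by (simp add: add_pow_def)
  then show ?thesis
    using assms by (intro add.finprod_mono_neutral_cong_left) auto
qed

text \<open>The value depends on the coefficients only, not on the chosen support. Used backwards,
  with \<open>combines_ops\<close> and \<open>combines_atom\<close> building \<phi> and \<psi> from
  the two expressions, it leaves an equation between integer-valued functions.\<close>

lemma combines_unique: "\<lbrakk>combines x \<phi>; combines y \<psi>; \<phi> = \<psi>\<rbrakk> \<Longrightarrow> x = y"
  unfolding combines_def
proof (elim exE conjE, goal_cases)
  case (1 S T)
  then have "x = (\<Oplus>a\<in>S \<union> T. [\<phi> a] \<cdot> a)" "y = (\<Oplus>a\<in>S \<union> T. [\<phi> a] \<cdot> a)"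
    using combination_superset[of "S \<union> T" S \<phi>] combination_superset[of "S \<union> T" T \<phi>] by auto
  then show ?case by simp
qed

lemma combines_closed: "combines x \<phi> \<Longrightarrow> x \<in> carrier G"
  unfolding combines_def by (auto intro!: finsum_closed)

lemma combines_atom: "a \<in> carrier G \<Longrightarrow> combines a (delta a)"
  unfolding combines_def delta_def
  by (rule exI[of _ "{a}"]) (auto simp: add.int_pow_1)

lemma combines_zero: "combines \<zero> 0"
  unfolding combines_def by (rule exI[of _ "{}"]) auto

lemma combines_add:
  assumes "combines x \<phi>" "combines y \<psi>"
  shows "combines (x \<oplus> y) (\<phi> + \<psi>)"
proof -
  obtain S T where S: "finite S" "S \<subseteq> carrier G" "\<And>a. a \<notin> S \<Longrightarrow> \<phi> a = 0" "x = (\<Oplus>a\<in>S. [\<phi> a] \<cdot> a)"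
    and T: "finite T" "T \<subseteq> carrier G" "\<And>a. a \<notin> T \<Longrightarrow> \<psi> a = 0" "y = (\<Oplus>a\<in>T. [\<psi> a] \<cdot> a)"
    using assms unfolding combines_def by blast
  let ?U = "S \<union> T"
  have "x = (\<Oplus>a\<in>?U. [\<phi> a] \<cdot> a)" "y = (\<Oplus>a\<in>?U. [\<psi> a] \<cdot> a)"
    using S T combination_superset[of ?U S \<phi>] combination_superset[of ?U T \<psi>] by auto
  moreover have "(\<Oplus>a\<in>?U. [\<phi> a] \<cdot> a) \<oplus> (\<Oplus>a\<in>?U. [\<psi> a] \<cdot> a) = (\<Oplus>a\<in>?U. [\<phi> a] \<cdot> a \<oplus> [\<psi> a] \<cdot> a)"
    using S T by (subst finsum_addf) auto
  moreover have "\<dots> = (\<Oplus>a\<in>?U. [(\<phi> + \<psi>) a] \<cdot> a)"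
    using S T by (intro finsum_cong') (auto simp: add.int_pow_mult)
  ultimately show ?thesis
    unfolding combines_def using S T by (intro exI[of _ ?U]) auto
qed

text \<open>The combination with coefficients \<open>- \<phi>\<close> is an additive inverse of
  \<open>x\<close>, because the sum of the two has coefficient function zero.\<close>

lemma combines_neg:
  assumes "combines x \<phi>"
  shows "combines (\<ominus> x) (- \<phi>)"
proof -
  obtain S where S: "finite S" "S \<subseteq> carrier G" "\<And>a. a \<notin> S \<Longrightarrow> \<phi> a = 0" "x = (\<Oplus>a\<in>S. [\<phi> a] \<cdot> a)"
    using assms unfolding combines_def by blast
  let ?y = "\<Oplus>a\<in>S. [(- \<phi>) a] \<cdot> a"
  have y: "combines ?y (- \<phi>)"
    unfolding combines_def using S by (intro exI[of _ S]) auto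
  have "?y \<oplus> x = \<zero>"
    using combines_unique[OF combines_add[OF y assms] combines_zero] by simp
  then have "\<ominus> x = ?y"
    using combines_closed[OF y] combines_closed[OF assms] by (simp add: minus_equality)
  with y show ?thesis by simp
qed

lemma combines_minus: "\<lbrakk>combines x \<phi>; combines y \<psi>\<rbrakk> \<Longrightarrow> combines (x \<ominus> y) (\<phi> - \<psi>)"
  using combines_add[of x \<phi> "\<ominus> y" "- \<psi>"] combines_neg[of y \<psi>] by (simp add: minus_eq)

lemmas combines_ops = combines_add combines_neg combines_minus combines_zero

end

section \<open>Linear and multilinear maps\<close>

abbreviation "Ob L \<equiv> carrier (L0 L)"
abbreviation "Ar L \<equiv> carrier (L1 L)"
abbreviation "deg0 V \<equiv> carrier (V0 V)"
abbreviation "deg1 V \<equiv> carrier (V1 V)"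

lemma linear_map_closed: "\<lbrakk>linear_map K V W f; x \<in> carrier V\<rbrakk> \<Longrightarrow> f x \<in> carrier W"
  unfolding linear_map_def by auto

lemma linear_map_add:
  "\<lbrakk>linear_map K V W f; x \<in> carrier V; y \<in> carrier V\<rbrakk> \<Longrightarrow> f (x \<oplus>\<^bsub>V\<^esub> y) = f x \<oplus>\<^bsub>W\<^esub> f y"
  unfolding linear_map_def by auto

lemma linear_map_smult:
  "\<lbrakk>linear_map K V W f; a \<in> carrier K; x \<in> carrier V\<rbrakk> \<Longrightarrow> f (a \<odot>\<^bsub>V\<^esub> x) = a \<odot>\<^bsub>W\<^esub> f x"
  unfolding linear_map_def by auto

lemma linear_map_comp:
  "\<lbrakk>linear_map K U V f; linear_map K V W g\<rbrakk> \<Longrightarrow> linear_map K U W (\<lambda>x. g (f x))"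
  unfolding linear_map_def by (auto simp: Pi_iff)

lemma linear_map_cong:
  assumes "module K V" "linear_map K V W f" "\<And>x. x \<in> carrier V \<Longrightarrow> g x = f x"
  shows "linear_map K V W g"
proof -
  interpret module K V by fact
  show ?thesis using assms(2,3) unfolding linear_map_def by (auto simp: Pi_iff)
qed

locale linear_between = V: module K V + W: module K W
  for K :: "('k, 'r) ring_scheme" and V :: "('k, 'u) module" and W :: "('k, 'v) module" +
  fixes f
  assumes lin: "linear_map K V W f"
begin

lemma closed: "x \<in> carrier V \<Longrightarrow> f x \<in> carrier W"
  using lin by (rule linear_map_closed)

lemma add: "\<lbrakk>x \<in> carrier V; y \<in> carrier V\<rbrakk> \<Longrightarrow> f (x \<oplus>\<^bsub>V\<^esub> y) = f x \<oplus>\<^bsub>W\<^esub> f y"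
  using lin by (rule linear_map_add)

lemma smult: "\<lbrakk>a \<in> carrier K; x \<in> carrier V\<rbrakk> \<Longrightarrow> f (a \<odot>\<^bsub>V\<^esub> x) = a \<odot>\<^bsub>W\<^esub> f x"
  using lin by (rule linear_map_smult)

lemma zero: "f \<zero>\<^bsub>V\<^esub> = \<zero>\<^bsub>W\<^esub>"
  using add[of "\<zero>\<^bsub>V\<^esub>" "\<zero>\<^bsub>V\<^esub>"] closed[of "\<zero>\<^bsub>V\<^esub>"] by (simp add: W.add.l_cancel_one)

lemma neg: "x \<in> carrier V \<Longrightarrow> f (\<ominus>\<^bsub>V\<^esub> x) = \<ominus>\<^bsub>W\<^esub> f x"
  using add[of "\<ominus>\<^bsub>V\<^esub> x" x] zero by (metis V.a_inv_closed V.l_neg W.minus_equality closed)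

lemma minus: "\<lbrakk>x \<in> carrier V; y \<in> carrier V\<rbrakk> \<Longrightarrow> f (x \<ominus>\<^bsub>V\<^esub> y) = f x \<ominus>\<^bsub>W\<^esub> f y"
  by (simp add: V.minus_eq W.minus_eq add neg)

lemmas rules = closed zero add neg minus smult

end

locale trilinear_between = A: module K A + B: module K B + C: module K C + W: module K W
  for K :: "('k, 'r) ring_scheme" and A B C :: "('k, 'u) module" and W :: "('k, 'v) module" +
  fixes f
  assumes tri: "trilinear K A B C W f"
begin

lemma linear1: "\<lbrakk>y \<in> carrier B; z \<in> carrier C\<rbrakk> \<Longrightarrow> linear_between K A W (\<lambda>x. f x y z)"
  and linear2: "\<lbrakk>x \<in> carrier A; z \<in> carrier C\<rbrakk> \<Longrightarrow> linear_between K B W (\<lambda>y. f x y z)"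
  and linear3: "\<lbrakk>x \<in> carrier A; y \<in> carrier B\<rbrakk> \<Longrightarrow> linear_between K C W (\<lambda>z. f x y z)"
  using tri A.module_axioms B.module_axioms C.module_axioms W.module_axioms unfolding trilinear_def
  by (simp_all add: linear_between_def linear_between_axioms_def module_def)

text \<open>Selections by index follow this order: 1 closure, 2-4 zero, 5-7 sums, 8-10 negatives,
  11-13 differences, 14-16 scalars, each group listed by argument.\<close>

lemmas rules = linear_between.closed[OF linear1]
  linear_between.zero[OF linear1] linear_between.zero[OF linear2] linear_between.zero[OF linear3]
  linear_between.add[OF linear1] linear_between.add[OF linear2] linear_between.add[OF linear3]
  linear_between.neg[OF linear1] linear_between.neg[OF linear2] linear_between.neg[OF linear3]
  linear_between.minus[OF linear1] linear_between.minus[OF linear2] linear_between.minus[OF linear3]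
  linear_between.smult[OF linear1] linear_between.smult[OF linear2] linear_between.smult[OF linear3]

end

locale quintilinear_between = V: module K V + W: module K W
  for K :: "('k, 'r) ring_scheme" and V :: "('k, 'u) module" and W :: "('k, 'v) module" +
  fixes f
  assumes quin: "quintilinear K V W f"
begin

context
  fixes p q r s
  assumes pqrs: "p \<in> carrier V" "q \<in> carrier V" "r \<in> carrier V" "s \<in> carrier V"
begin

lemma linear1: "linear_between K V W (\<lambda>x. f x p q r s)"
  and linear2: "linear_between K V W (\<lambda>x. f p x q r s)"
  and linear3: "linear_between K V W (\<lambda>x. f p q x r s)"
  and linear4: "linear_between K V W (\<lambda>x. f p q r x s)"
  and linear5: "linear_between K V W (\<lambda>x. f p q r s x)"
  using quin V.module_axioms W.module_axioms pqrs unfolding quintilinear_def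
  by (simp_all add: linear_between_def linear_between_axioms_def module_def)

end

text \<open>The order is 1 closure, 2-6 zero, 7-11 sums, 12-16 scalars, again by argument.\<close>

lemmas rules = linear_between.closed[OF linear1]
  linear_between.zero[OF linear1] linear_between.zero[OF linear2] linear_between.zero[OF linear3]
  linear_between.zero[OF linear4] linear_between.zero[OF linear5]
  linear_between.add[OF linear1] linear_between.add[OF linear2] linear_between.add[OF linear3]
  linear_between.add[OF linear4] linear_between.add[OF linear5]
  linear_between.smult[OF linear1] linear_between.smult[OF linear2] linear_between.smult[OF linear3]
  linear_between.smult[OF linear4] linear_between.smult[OF linear5]

end

text \<open>Transpositions carry the first argument to the other places at the cost of a sign, and
  the negative of a linear map is linear; so one argument is enough.\<close>

lemma trilinearI_skew:
  assumes "module K V" "module K W"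
    and skew: "skew3 V W f"
    and lin: "\<And>y z. \<lbrakk>y \<in> carrier V; z \<in> carrier V\<rbrakk> \<Longrightarrow> linear_map K V W (\<lambda>x. f x y z)"
  shows "trilinear K V V V W f"
proof -
  interpret V: module K V by fact
  interpret W: module K W by fact
  have neg: "linear_map K V W (\<lambda>x. \<ominus>\<^bsub>W\<^esub> g x)" if "linear_map K V W g" for g
    using that unfolding linear_map_def by (simp add: Pi_iff W.minus_add W.smult_r_minus)
  have swap: "f x y z = \<ominus>\<^bsub>W\<^esub> f y x z" "f x y z = \<ominus>\<^bsub>W\<^esub> f x z y"
    if "x \<in> carrier V" "y \<in> carrier V" "z \<in> carrier V" for x y z
    using skew that unfolding skew3_def by blast+
  have 2: "linear_map K V W (\<lambda>y. f x y z)" if "x \<in> carrier V" "z \<in> carrier V" for x z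
    by (rule linear_map_cong[OF assms(1) neg[OF lin[of x z]]]) (use that swap(1)[of x _ z] in auto)
  have 3: "linear_map K V W (\<lambda>z. f x y z)" if "x \<in> carrier V" "y \<in> carrier V" for x y
    by (rule linear_map_cong[OF assms(1) neg[OF 2[of x y]]]) (use that swap(2)[of x y] in auto)
  show ?thesis unfolding trilinear_def using lin 2 3 by blast
qed

section \<open>Transport of 2-category structures\<close>

context two_category
begin

lemmas cells_in = id1_in comp1_in id2_in vcomp_in hcomp_in

text \<open>Inserting \<open>u\<close> and its left inverse \<open>w\<close> between \<alpha> and
  \<beta> changes nothing: associativity brings the two whiskerings together, and
  \<open>hcomp_id2\<close> merges them into the identity 2-cell of the composite of \<open>u\<close>
  and \<open>w\<close>, an identity.\<close>

lemma hcomp_cancel: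
  assumes "A \<in> Obj C" "B \<in> Obj C" "D \<in> Obj C" "E \<in> Obj C"
    "f \<in> Hom C A B" "g \<in> Hom C A B" "f' \<in> Hom C B D" "g' \<in> Hom C B D"
    "\<alpha> \<in> Cell C A B f g" "\<beta> \<in> Cell C B D f' g'"
    "u \<in> Hom C B E" "w \<in> Hom C E B" "comp1 C B E B w u = id1 C B"
  shows "hcomp C A E D (comp1 C A B E u f) (comp1 C A B E u g) (comp1 C E B D f' w) (comp1 C E B D g' w)
      (hcomp C E B D w w f' g' \<beta> (id2 C E B w)) (hcomp C A B E f g u u (id2 C B E u) \<alpha>)
    = hcomp C A B D f g f' g' \<beta> \<alpha>"
proof -
  \<comment> \<open>Boundaries are arguments of \<open>hcomp\<close>, so the same cancellation has
    to be known for the bounding 1-cells.\<close>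
  have uf: "comp1 C A E B w (comp1 C A B E u h) = h" if "h \<in> Hom C A B" for h
    using assms that by (simp add: comp1_assoc id_comp1)
  have "hcomp C A E B (comp1 C A B E u f) (comp1 C A B E u g) w w (id2 C E B w)
      (hcomp C A B E f g u u (id2 C B E u) \<alpha>)
    = hcomp C A B B f g (id1 C B) (id1 C B)
      (hcomp C B E B u u w w (id2 C E B w) (id2 C B E u)) \<alpha>"
    using assms hcomp_assoc[of A B E B f g u u w w \<alpha> "id2 C B E u" "id2 C E B w"]
    by (simp add: id2_in)
  also have "\<dots> = \<alpha>"
    using assms by (simp add: hcomp_id2 id_hcomp)
  finally have *: "hcomp C A E B (comp1 C A B E u f) (comp1 C A B E u g) w w (id2 C E B w)
      (hcomp C A B E f g u u (id2 C B E u) \<alpha>) = \<alpha>" .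
  show ?thesis
    using hcomp_assoc[of A E B D "comp1 C A B E u f" "comp1 C A B E u g" w w f' g'
        "hcomp C A B E f g u u (id2 C B E u) \<alpha>" "id2 C E B w" \<beta>] assms
    by (simp add: cells_in uf *)
qed

end

text \<open>
  \<open>rh\<close> and \<open>rc\<close> are inverse to \<open>T\<close> on 1-cells and 2-cells. That \<open>C\<close> is closed under its operations and
  satisfies the laws of a 2-category is inherited from \<open>D\<close>.
\<close>

locale local_iso = D: two_category D
  for C :: "('o, 'm, 'c) two_cat" and D :: "('p, 'n, 'd) two_cat" +
  fixes T :: "('o, 'm, 'c, 'p, 'n, 'd) two_fun"
    and rh :: "'o \<Rightarrow> 'o \<Rightarrow> 'n \<Rightarrow> 'm" and rc :: "'o \<Rightarrow> 'o \<Rightarrow> 'm \<Rightarrow> 'm \<Rightarrow> 'd \<Rightarrow> 'c"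
  assumes T_obj: "A \<in> Obj C \<Longrightarrow> on_obj T A \<in> Obj D"
    and T_hom: "\<lbrakk>A \<in> Obj C; B \<in> Obj C; f \<in> Hom C A B\<rbrakk>
      \<Longrightarrow> on_hom T A B f \<in> Hom D (on_obj T A) (on_obj T B)"
    and rh_in: "\<lbrakk>A \<in> Obj C; B \<in> Obj C; F \<in> Hom D (on_obj T A) (on_obj T B)\<rbrakk>
      \<Longrightarrow> rh A B F \<in> Hom C A B"
    and rh_T: "\<lbrakk>A \<in> Obj C; B \<in> Obj C; f \<in> Hom C A B\<rbrakk> \<Longrightarrow> rh A B (on_hom T A B f) = f"
    and T_rh: "\<lbrakk>A \<in> Obj C; B \<in> Obj C; F \<in> Hom D (on_obj T A) (on_obj T B)\<rbrakk>
      \<Longrightarrow> on_hom T A B (rh A B F) = F"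
    and T_cell: "\<lbrakk>A \<in> Obj C; B \<in> Obj C; f \<in> Hom C A B; g \<in> Hom C A B; \<alpha> \<in> Cell C A B f g\<rbrakk>
      \<Longrightarrow> on_cell T A B f g \<alpha> \<in> Cell D (on_obj T A) (on_obj T B) (on_hom T A B f) (on_hom T A B g)"
    and rc_in: "\<lbrakk>A \<in> Obj C; B \<in> Obj C; f \<in> Hom C A B; g \<in> Hom C A B;
        \<theta> \<in> Cell D (on_obj T A) (on_obj T B) (on_hom T A B f) (on_hom T A B g)\<rbrakk>
      \<Longrightarrow> rc A B f g \<theta> \<in> Cell C A B f g"
    and rc_T: "\<lbrakk>A \<in> Obj C; B \<in> Obj C; f \<in> Hom C A B; g \<in> Hom C A B; \<alpha> \<in> Cell C A B f g\<rbrakk>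
      \<Longrightarrow> rc A B f g (on_cell T A B f g \<alpha>) = \<alpha>"
    and T_rc: "\<lbrakk>A \<in> Obj C; B \<in> Obj C; f \<in> Hom C A B; g \<in> Hom C A B;
        \<theta> \<in> Cell D (on_obj T A) (on_obj T B) (on_hom T A B f) (on_hom T A B g)\<rbrakk>
      \<Longrightarrow> on_cell T A B f g (rc A B f g \<theta>) = \<theta>"
    and id1_eq: "A \<in> Obj C \<Longrightarrow> id1 C A = rh A A (id1 D (on_obj T A))"
    and comp1_eq: "\<lbrakk>A \<in> Obj C; B \<in> Obj C; E \<in> Obj C; f \<in> Hom C A B; g \<in> Hom C B E\<rbrakk>
      \<Longrightarrow> comp1 C A B E g f = rh A E (comp1 D (on_obj T A) (on_obj T B) (on_obj T E)
            (on_hom T B E g) (on_hom T A B f))"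
    and id2_eq: "\<lbrakk>A \<in> Obj C; B \<in> Obj C; f \<in> Hom C A B\<rbrakk>
      \<Longrightarrow> id2 C A B f = rc A B f f (id2 D (on_obj T A) (on_obj T B) (on_hom T A B f))"
    and vcomp_eq: "\<lbrakk>A \<in> Obj C; B \<in> Obj C; f \<in> Hom C A B; g \<in> Hom C A B; h \<in> Hom C A B;
        \<alpha> \<in> Cell C A B f g; \<beta> \<in> Cell C A B g h\<rbrakk>
      \<Longrightarrow> vcomp C A B f g h \<beta> \<alpha> = rc A B f h (vcomp D (on_obj T A) (on_obj T B)
            (on_hom T A B f) (on_hom T A B g) (on_hom T A B h)
            (on_cell T A B g h \<beta>) (on_cell T A B f g \<alpha>))"
    and hcomp_eq: "\<lbrakk>A \<in> Obj C; B \<in> Obj C; E \<in> Obj C; f \<in> Hom C A B; g \<in> Hom C A B;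
        f' \<in> Hom C B E; g' \<in> Hom C B E; \<alpha> \<in> Cell C A B f g; \<beta> \<in> Cell C B E f' g'\<rbrakk>
      \<Longrightarrow> hcomp C A B E f g f' g' \<beta> \<alpha> = rc A E (comp1 C A B E f' f) (comp1 C A B E g' g)
            (hcomp D (on_obj T A) (on_obj T B) (on_obj T E)
              (on_hom T A B f) (on_hom T A B g) (on_hom T B E f') (on_hom T B E g')
              (on_cell T B E f' g' \<beta>) (on_cell T A B f g \<alpha>))"
begin

abbreviation "T0 \<equiv> on_obj T"
abbreviation "T1 \<equiv> on_hom T"
abbreviation "T2 \<equiv> on_cell T"

lemmas T_in = T_obj T_hom T_cell

lemma C_id1_in: "A \<in> Obj C \<Longrightarrow> id1 C A \<in> Hom C A A"
  by (simp add: id1_eq rh_in T_in D.cells_in)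

lemma T_id1: "A \<in> Obj C \<Longrightarrow> T1 A A (id1 C A) = id1 D (T0 A)"
  by (simp add: id1_eq T_rh T_in D.cells_in)

lemma C_comp1_in: "\<lbrakk>A \<in> Obj C; B \<in> Obj C; E \<in> Obj C; f \<in> Hom C A B; g \<in> Hom C B E\<rbrakk>
    \<Longrightarrow> comp1 C A B E g f \<in> Hom C A E"
  by (simp add: comp1_eq rh_in T_in D.cells_in)

lemma T_comp1: "\<lbrakk>A \<in> Obj C; B \<in> Obj C; E \<in> Obj C; f \<in> Hom C A B; g \<in> Hom C B E\<rbrakk>
    \<Longrightarrow> T1 A E (comp1 C A B E g f)
      = comp1 D (T0 A) (T0 B) (T0 E) (T1 B E g) (T1 A B f)"
  by (simp add: comp1_eq T_rh T_in D.cells_in)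

lemma C_id2_in: "\<lbrakk>A \<in> Obj C; B \<in> Obj C; f \<in> Hom C A B\<rbrakk> \<Longrightarrow> id2 C A B f \<in> Cell C A B f f"
  by (simp add: id2_eq rc_in T_in D.cells_in)

lemma T_id2: "\<lbrakk>A \<in> Obj C; B \<in> Obj C; f \<in> Hom C A B\<rbrakk>
    \<Longrightarrow> T2 A B f f (id2 C A B f) = id2 D (T0 A) (T0 B) (T1 A B f)"
  by (simp add: id2_eq T_rc T_in D.cells_in)

lemma
  assumes "A \<in> Obj C" "B \<in> Obj C" "f \<in> Hom C A B" "g \<in> Hom C A B" "h \<in> Hom C A B"
    "\<alpha> \<in> Cell C A B f g" "\<beta> \<in> Cell C A B g h"
  shows C_vcomp_in: "vcomp C A B f g h \<beta> \<alpha> \<in> Cell C A B f h"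
    and T_vcomp: "T2 A B f h (vcomp C A B f g h \<beta> \<alpha>)
      = vcomp D (T0 A) (T0 B) (T1 A B f) (T1 A B g) (T1 A B h)
          (T2 A B g h \<beta>) (T2 A B f g \<alpha>)"
  using assms D.vcomp_in[of "T0 A" "T0 B" "T1 A B f" "T1 A B g" "T1 A B h"
      "T2 A B f g \<alpha>" "T2 A B g h \<beta>"]
  by (simp_all add: vcomp_eq rc_in T_rc T_in)

lemma
  assumes "A \<in> Obj C" "B \<in> Obj C" "E \<in> Obj C" "f \<in> Hom C A B" "g \<in> Hom C A B"
    "f' \<in> Hom C B E" "g' \<in> Hom C B E" "\<alpha> \<in> Cell C A B f g" "\<beta> \<in> Cell C B E f' g'"
  shows C_hcomp_in: "hcomp C A B E f g f' g' \<beta> \<alpha> \<in> Cell C A E (comp1 C A B E f' f) (comp1 C A B E g' g)"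
    and T_hcomp: "T2 A E (comp1 C A B E f' f) (comp1 C A B E g' g) (hcomp C A B E f g f' g' \<beta> \<alpha>)
      = hcomp D (T0 A) (T0 B) (T0 E)
          (T1 A B f) (T1 A B g) (T1 B E f') (T1 B E g')
          (T2 B E f' g' \<beta>) (T2 A B f g \<alpha>)"
  using assms D.hcomp_in[of "T0 A" "T0 B" "T0 E" "T1 A B f" "T1 A B g"
      "T1 B E f'" "T1 B E g'" "T2 A B f g \<alpha>" "T2 B E f' g' \<beta>"]
  by (simp_all add: hcomp_eq rc_in T_rc C_comp1_in T_comp1 T_in)

lemmas C_in = C_id1_in C_comp1_in C_id2_in C_vcomp_in C_hcomp_in
lemmas T_ops = T_id1 T_comp1 T_id2 T_vcomp T_hcomp

lemma hom_eqI: "\<lbrakk>T1 A B f = T1 A B g; A \<in> Obj C; B \<in> Obj C; f \<in> Hom C A B; g \<in> Hom C A B\<rbrakk> \<Longrightarrow> f = g"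
  by (metis rh_T)

lemma cell_eqI: "\<lbrakk>T2 A B f g \<alpha> = T2 A B f g \<beta>; A \<in> Obj C; B \<in> Obj C;
    f \<in> Hom C A B; g \<in> Hom C A B; \<alpha> \<in> Cell C A B f g; \<beta> \<in> Cell C A B f g\<rbrakk> \<Longrightarrow> \<alpha> = \<beta>"
  by (metis rc_T)

lemma C_comp1_id: "\<lbrakk>A \<in> Obj C; B \<in> Obj C; f \<in> Hom C A B\<rbrakk> \<Longrightarrow> comp1 C A A B f (id1 C A) = f"
  by (rule hom_eqI[of A B]) (simp_all add: C_in T_ops T_in D.comp1_id)

lemma C_id_comp1: "\<lbrakk>A \<in> Obj C; B \<in> Obj C; f \<in> Hom C A B\<rbrakk> \<Longrightarrow> comp1 C A B B (id1 C B) f = f"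
  by (rule hom_eqI[of A B]) (simp_all add: C_in T_ops T_in D.id_comp1)

lemma C_comp1_assoc: "\<lbrakk>A \<in> Obj C; B \<in> Obj C; E \<in> Obj C; H \<in> Obj C; f \<in> Hom C A B; g \<in> Hom C B E; h \<in> Hom C E H\<rbrakk>
    \<Longrightarrow> comp1 C A E H h (comp1 C A B E g f) = comp1 C A B H (comp1 C B E H h g) f"
  by (rule hom_eqI[of A H]) (simp_all add: C_in T_ops T_in D.comp1_assoc)

text \<open>\<open>cell_eqI\<close> compares cells with equal boundaries, while these horizontal
  composites run between 1-cells composed with identities; the unit laws for 1-cells, already
  reflected from \<open>D\<close>, make them cells from \<open>f\<close> to
  \<open>g\<close>.\<close>

lemma C_hcomp_unit:
  assumes "A \<in> Obj C" "B \<in> Obj C" "f \<in> Hom C A B" "g \<in> Hom C A B" "\<alpha> \<in> Cell C A B f g"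
  shows "hcomp C A A B (id1 C A) (id1 C A) f g \<alpha> (id2 C A A (id1 C A)) = \<alpha>"
    and "hcomp C A B B f g (id1 C B) (id1 C B) (id2 C B B (id1 C B)) \<alpha> = \<alpha>"
proof -
  let ?l = "hcomp C A A B (id1 C A) (id1 C A) f g \<alpha> (id2 C A A (id1 C A))"
  let ?r = "hcomp C A B B f g (id1 C B) (id1 C B) (id2 C B B (id1 C B)) \<alpha>"
  have "?l \<in> Cell C A B f g" "?r \<in> Cell C A B f g"
    using assms C_hcomp_in[of A A B "id1 C A" "id1 C A" f g "id2 C A A (id1 C A)" \<alpha>]
      C_hcomp_in[of A B B f g "id1 C B" "id1 C B" \<alpha> "id2 C B B (id1 C B)"]
    by (simp_all add: C_in C_comp1_id C_id_comp1)
  moreover have "T2 A B f g ?l = T2 A B f g \<alpha>" "T2 A B f g ?r = T2 A B f g \<alpha>"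
    using assms T_hcomp[of A A B "id1 C A" "id1 C A" f g "id2 C A A (id1 C A)" \<alpha>]
      T_hcomp[of A B B f g "id1 C B" "id1 C B" \<alpha> "id2 C B B (id1 C B)"]
    by (simp_all add: C_in T_ops T_in C_comp1_id C_id_comp1 D.hcomp_id D.id_hcomp)
  ultimately show "?l = \<alpha>" "?r = \<alpha>"
    using assms by (auto intro: cell_eqI)
qed

text \<open>Associativity of 1-cells places both sides in one set of cells; there the law of
  \<open>D\<close> is reflected by the injective action \<open>T2\<close>.\<close>

lemma C_hcomp_assoc:
  assumes "A \<in> Obj C" "B \<in> Obj C" "E \<in> Obj C" "H \<in> Obj C" "f \<in> Hom C A B" "g \<in> Hom C A B"
    "f' \<in> Hom C B E" "g' \<in> Hom C B E" "f'' \<in> Hom C E H" "g'' \<in> Hom C E H"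
    "\<alpha> \<in> Cell C A B f g" "\<beta> \<in> Cell C B E f' g'" "\<gamma> \<in> Cell C E H f'' g''"
  shows "hcomp C A E H (comp1 C A B E f' f) (comp1 C A B E g' g) f'' g'' \<gamma> (hcomp C A B E f g f' g' \<beta> \<alpha>)
    = hcomp C A B H f g (comp1 C B E H f'' f') (comp1 C B E H g'' g') (hcomp C B E H f' g' f'' g'' \<gamma> \<beta>) \<alpha>"
    (is "?l = ?r")
proof -
  let ?f = "comp1 C A E H f'' (comp1 C A B E f' f)" and ?g = "comp1 C A E H g'' (comp1 C A B E g' g)"
  have fg: "?f = comp1 C A B H (comp1 C B E H f'' f') f" "?g = comp1 C A B H (comp1 C B E H g'' g') g"
    using assms by (simp_all add: C_comp1_assoc)
  have "?l \<in> Cell C A H ?f ?g" "?r \<in> Cell C A H ?f ?g"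
    using assms by (simp add: C_in, unfold fg, simp add: C_in)
  moreover have "T2 A H ?f ?g ?l = T2 A H ?f ?g ?r"
  proof -
    have "T2 A H ?f ?g ?l = hcomp D (T0 A) (T0 E) (T0 H)
        (T1 A E (comp1 C A B E f' f)) (T1 A E (comp1 C A B E g' g)) (T1 E H f'') (T1 E H g'')
        (T2 E H f'' g'' \<gamma>) (T2 A E (comp1 C A B E f' f) (comp1 C A B E g' g) (hcomp C A B E f g f' g' \<beta> \<alpha>))"
      using assms by (intro T_hcomp) (simp_all add: C_in)
    moreover have "T2 A H ?f ?g ?r = hcomp D (T0 A) (T0 B) (T0 H)
        (T1 A B f) (T1 A B g) (T1 B H (comp1 C B E H f'' f')) (T1 B H (comp1 C B E H g'' g'))
        (T2 B H (comp1 C B E H f'' f') (comp1 C B E H g'' g') (hcomp C B E H f' g' f'' g'' \<gamma> \<beta>)) (T2 A B f g \<alpha>)"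
      unfolding fg using assms by (intro T_hcomp) (simp_all add: C_in)
    ultimately show ?thesis
      using assms by (simp add: T_ops T_in D.hcomp_assoc)
  qed
  ultimately show ?thesis
    using assms by (intro cell_eqI[of A H ?f ?g]) (simp_all add: C_in)
qed

text \<open>Each law holds after applying \<open>T\<close>, which commutes with the operations and
  is injective on 1-cells and 2-cells, hence it holds already in \<open>C\<close>.\<close>

sublocale C: two_category C
proof (standard, goal_cases)
  case (8 A B f g \<alpha>)
  then show ?case by (intro cell_eqI[of A B f g]) (simp_all add: C_in T_vcomp T_id2 T_in D.vcomp_id)
next
  case (9 A B f g \<alpha>)
  then show ?case by (intro cell_eqI[of A B f g]) (simp_all add: C_in T_vcomp T_id2 T_in D.id_vcomp)
next
  case (10 A B f g h k \<alpha> \<beta> \<gamma>)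
  then show ?case by (intro cell_eqI[of A B f k]) (simp_all add: C_in T_vcomp T_in D.vcomp_assoc)
next
  case (15 A B E f g)
  then show ?case
    by (intro cell_eqI[of A E "comp1 C A B E g f" "comp1 C A B E g f"])
      (simp_all add: C_in T_hcomp T_id2 T_comp1 T_in D.hcomp_id2)
next
  case (16 A B E f g h f' g' h' \<alpha> \<beta> \<alpha>' \<beta>')
  then show ?case
    by (intro cell_eqI[of A E "comp1 C A B E f' f" "comp1 C A B E h' h"])
      (simp_all add: C_in T_hcomp T_vcomp T_comp1 T_in D.interchange)
qed (simp_all add: C_in C_comp1_id C_id_comp1 C_comp1_assoc C_hcomp_unit C_hcomp_assoc)

lemma two_functor_T: "two_functor C D T"
  by standard (simp_all add: T_in T_ops)

end

section \<open>The quasi-inverse of a locally bijective, essentially surjective 2-functor\<close>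

locale local_iso_dense = local_iso C D T rh rc
  for C :: "('o, 'm, 'c) two_cat" and D :: "('p, 'n, 'd) two_cat" and T rh rc +
  fixes v :: "'p \<Rightarrow> 'o" and e e' :: "'p \<Rightarrow> 'n"
  assumes v_in: "L \<in> Obj D \<Longrightarrow> v L \<in> Obj C"
    and e_in: "L \<in> Obj D \<Longrightarrow> e L \<in> Hom D (T0 (v L)) L"
    and e'_in: "L \<in> Obj D \<Longrightarrow> e' L \<in> Hom D L (T0 (v L))"
    and e'_e: "L \<in> Obj D \<Longrightarrow>
      comp1 D (T0 (v L)) L (T0 (v L)) (e' L) (e L) = id1 D (T0 (v L))"
    and e_e': "L \<in> Obj D \<Longrightarrow> comp1 D L (T0 (v L)) L (e L) (e' L) = id1 D L"
begin

abbreviation P :: "'p \<Rightarrow> 'p" where "P L \<equiv> T0 (v L)"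

text \<open>Conjugation with the isomorphisms \<open>e\<close>: it carries 1-cells of
  \<open>D\<close> to 1-cells between objects in the image of \<open>T\<close>, where
  \<open>rh\<close> can pull them back.\<close>

definition Ph :: "'p \<Rightarrow> 'p \<Rightarrow> 'n \<Rightarrow> 'n" where
  "Ph L M F = comp1 D (P L) L (P M) (comp1 D L M (P M) (e' M) F) (e L)"

text \<open>The same conjugation for 2-cells, written as two whiskerings.\<close>

definition Pc :: "'p \<Rightarrow> 'p \<Rightarrow> 'n \<Rightarrow> 'n \<Rightarrow> 'd \<Rightarrow> 'd" where
  "Pc L M F G \<theta> = hcomp D (P L) L (P M) (e L) (e L) (comp1 D L M (P M) (e' M) F) (comp1 D L M (P M) (e' M) G)
    (hcomp D L M (P M) F G (e' M) (e' M) (id2 D M (P M) (e' M)) \<theta>) (id2 D (P L) L (e L))"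

lemmas P_in = v_in e_in e'_in T_in D.cells_in

lemma Ph_in: "\<lbrakk>L \<in> Obj D; M \<in> Obj D; F \<in> Hom D L M\<rbrakk> \<Longrightarrow> Ph L M F \<in> Hom D (P L) (P M)"
  by (simp add: Ph_def P_in)

lemma Pc_in: "\<lbrakk>L \<in> Obj D; M \<in> Obj D; F \<in> Hom D L M; G \<in> Hom D L M; \<theta> \<in> Cell D L M F G\<rbrakk>
    \<Longrightarrow> Pc L M F G \<theta> \<in> Cell D (P L) (P M) (Ph L M F) (Ph L M G)"
  unfolding Pc_def Ph_def by (simp add: P_in)

text \<open>The inner factors \<open>e' M\<close> and \<open>e M\<close> meet after reassociation
  and cancel; this is what makes conjugation functorial.\<close>

lemma e'_cancel:
  assumes "L \<in> Obj D" "M \<in> Obj D" "N \<in> Obj D" "F \<in> Hom D L M" "G \<in> Hom D M N"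
  shows "comp1 D L (P M) N (comp1 D (P M) M N G (e M)) (comp1 D L M (P M) (e' M) F) = comp1 D L M N G F"
proof -
  have "comp1 D L (P M) N (comp1 D (P M) M N G (e M)) (comp1 D L M (P M) (e' M) F)
    = comp1 D L M N G (comp1 D L (P M) M (e M) (comp1 D L M (P M) (e' M) F))"
    using assms by (simp add: P_in D.comp1_assoc)
  also have "comp1 D L (P M) M (e M) (comp1 D L M (P M) (e' M) F)
    = comp1 D L M M (comp1 D M (P M) M (e M) (e' M)) F"
    using assms by (simp add: P_in D.comp1_assoc)
  finally show ?thesis
    using assms by (simp add: e_e' D.id_comp1)
qed

lemma Ph_comp1:
  assumes "L \<in> Obj D" "M \<in> Obj D" "N \<in> Obj D" "F \<in> Hom D L M" "G \<in> Hom D M N"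
  shows "Ph L N (comp1 D L M N G F) = comp1 D (P L) (P M) (P N) (Ph M N G) (Ph L M F)"
proof -
  have "comp1 D L (P M) (P N) (Ph M N G) (comp1 D L M (P M) (e' M) F)
    = comp1 D L M (P N) (comp1 D M N (P N) (e' N) G) F"
    unfolding Ph_def using assms by (intro e'_cancel) (simp_all add: P_in)
  then show ?thesis
    using assms D.comp1_assoc[of "P L" L "P M" "P N" "e L" "comp1 D L M (P M) (e' M) F" "Ph M N G"]
    unfolding Ph_def[of L] by (simp add: P_in Ph_in D.comp1_assoc)
qed

text \<open>Between the two conjugates the inner pair \<open>e' M\<close>, \<open>e M\<close>
  cancels, and reassociation shows the outer whiskerings to be those of the conjugated horizontal
  composite.\<close>

lemma Pc_hcomp:
  assumes "L \<in> Obj D" "M \<in> Obj D" "N \<in> Obj D" "F \<in> Hom D L M" "G \<in> Hom D L M"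
    "F' \<in> Hom D M N" "G' \<in> Hom D M N" "\<alpha> \<in> Cell D L M F G" "\<beta> \<in> Cell D M N F' G'"
  shows "Pc L N (comp1 D L M N F' F) (comp1 D L M N G' G) (hcomp D L M N F G F' G' \<beta> \<alpha>)
    = hcomp D (P L) (P M) (P N) (Ph L M F) (Ph L M G) (Ph M N F') (Ph M N G')
        (Pc M N F' G' \<beta>) (Pc L M F G \<alpha>)"
proof -
  let ?X = "hcomp D M N (P N) F' G' (e' N) (e' N) (id2 D N (P N) (e' N)) \<beta>"
  let ?Y = "hcomp D L M (P M) F G (e' M) (e' M) (id2 D M (P M) (e' M)) \<alpha>"
  let ?e'F = "comp1 D L M (P M) (e' M) F" and ?e'G = "comp1 D L M (P M) (e' M) G"
  let ?e'F' = "comp1 D M N (P N) (e' N) F'" and ?e'G' = "comp1 D M N (P N) (e' N) G'"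
  have X: "?X \<in> Cell D M (P N) ?e'F' ?e'G'" and Y: "?Y \<in> Cell D L (P M) ?e'F ?e'G"
    using assms by (simp_all add: P_in)
  have "hcomp D (P L) (P M) (P N) (Ph L M F) (Ph L M G) (Ph M N F') (Ph M N G')
      (Pc M N F' G' \<beta>) (Pc L M F G \<alpha>)
    = hcomp D (P L) L (P N) (e L) (e L)
        (comp1 D L (P M) (P N) (Ph M N F') ?e'F) (comp1 D L (P M) (P N) (Ph M N G') ?e'G)
        (hcomp D L (P M) (P N) ?e'F ?e'G (Ph M N F') (Ph M N G') (Pc M N F' G' \<beta>) ?Y) (id2 D (P L) L (e L))"
    unfolding Pc_def[of L] Ph_def[of L]
    using assms X Y by (intro D.hcomp_assoc) (simp_all add: P_in Ph_in Pc_in)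
  \<comment> \<open>\<open>hcomp_cancel\<close> with \<open>u = e' M\<close> and
    \<open>w = e M\<close> removes the inner pair.\<close>
  also have "hcomp D L (P M) (P N) ?e'F ?e'G (Ph M N F') (Ph M N G') (Pc M N F' G' \<beta>) ?Y
    = hcomp D L M (P N) F G ?e'F' ?e'G' ?X \<alpha>"
    unfolding Pc_def[of M] Ph_def[of M]
    using assms X by (intro D.hcomp_cancel) (simp_all add: P_in e_e')
  also have "hcomp D L M (P N) F G ?e'F' ?e'G' ?X \<alpha>
    = hcomp D L N (P N) (comp1 D L M N F' F) (comp1 D L M N G' G) (e' N) (e' N)
        (id2 D N (P N) (e' N)) (hcomp D L M N F G F' G' \<beta> \<alpha>)"
    using assms by (intro D.hcomp_assoc[symmetric]) (simp_all add: P_in)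
  finally have main: "hcomp D (P L) (P M) (P N) (Ph L M F) (Ph L M G) (Ph M N F') (Ph M N G')
      (Pc M N F' G' \<beta>) (Pc L M F G \<alpha>)
    = hcomp D (P L) L (P N) (e L) (e L)
        (comp1 D L (P M) (P N) (Ph M N F') ?e'F) (comp1 D L (P M) (P N) (Ph M N G') ?e'G)
        (hcomp D L N (P N) (comp1 D L M N F' F) (comp1 D L M N G' G) (e' N) (e' N)
          (id2 D N (P N) (e' N)) (hcomp D L M N F G F' G' \<beta> \<alpha>)) (id2 D (P L) L (e L))" .
  have "comp1 D L (P M) (P N) (Ph M N H') (comp1 D L M (P M) (e' M) H)
      = comp1 D L N (P N) (e' N) (comp1 D L M N H' H)" if "H \<in> Hom D L M" "H' \<in> Hom D M N" for H H'
  proof -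
    have "comp1 D L (P M) (P N) (Ph M N H') (comp1 D L M (P M) (e' M) H)
      = comp1 D L M (P N) (comp1 D M N (P N) (e' N) H') H"
      unfolding Ph_def using assms that by (intro e'_cancel) (simp_all add: P_in)
    then show ?thesis
      using assms that by (simp add: P_in D.comp1_assoc)
  qed
  with main show ?thesis
    using assms unfolding Pc_def[of L N] by simp
qed

text \<open>The naturality square of \<open>e\<close>: composing with \<open>e M\<close> cancels the
  \<open>e' M\<close> inside the conjugate.\<close>

lemma Ph_e: "\<lbrakk>L \<in> Obj D; M \<in> Obj D; F \<in> Hom D L M\<rbrakk>
    \<Longrightarrow> comp1 D (P L) (P M) M (e M) (Ph L M F) = comp1 D (P L) L M F (e L)"
  using e'_cancel[of L M M F "id1 D M"]
    D.comp1_assoc[of "P L" L "P M" M "e L" "comp1 D L M (P M) (e' M) F" "e M"]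
  by (simp add: Ph_def P_in D.id_comp1)

lemma e'_Ph: "\<lbrakk>L \<in> Obj D; M \<in> Obj D; F \<in> Hom D L M\<rbrakk>
    \<Longrightarrow> comp1 D L (P L) (P M) (Ph L M F) (e' L) = comp1 D L M (P M) (e' M) F"
  unfolding Ph_def using e'_cancel[of L L "P M" "id1 D L" "comp1 D L M (P M) (e' M) F"]
  by (simp add: P_in D.comp1_id)

lemma Pc_e:
  assumes "L \<in> Obj D" "M \<in> Obj D" "F \<in> Hom D L M" "G \<in> Hom D L M" "\<theta> \<in> Cell D L M F G"
  shows "hcomp D (P L) (P M) M (Ph L M F) (Ph L M G) (e M) (e M) (id2 D (P M) M (e M)) (Pc L M F G \<theta>)
    = hcomp D (P L) L M (e L) (e L) F G \<theta> (id2 D (P L) L (e L))"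
proof -
  let ?Y = "hcomp D L M (P M) F G (e' M) (e' M) (id2 D M (P M) (e' M)) \<theta>"
  let ?e'F = "comp1 D L M (P M) (e' M) F" and ?e'G = "comp1 D L M (P M) (e' M) G"
  have Y: "?Y \<in> Cell D L (P M) ?e'F ?e'G"
    using assms by (simp add: P_in)
  have eF: "comp1 D L (P M) M (e M) ?e'F = F" "comp1 D L (P M) M (e M) ?e'G = G"
    using assms by (simp_all add: P_in D.comp1_assoc e_e' D.id_comp1)
  have "hcomp D (P L) (P M) M (Ph L M F) (Ph L M G) (e M) (e M) (id2 D (P M) M (e M)) (Pc L M F G \<theta>)
    = hcomp D (P L) L M (e L) (e L) (comp1 D L (P M) M (e M) ?e'F) (comp1 D L (P M) M (e M) ?e'G)
        (hcomp D L (P M) M ?e'F ?e'G (e M) (e M) (id2 D (P M) M (e M)) ?Y) (id2 D (P L) L (e L))"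
    unfolding Pc_def Ph_def using assms Y by (intro D.hcomp_assoc) (simp_all add: P_in)
  also have "hcomp D L (P M) M ?e'F ?e'G (e M) (e M) (id2 D (P M) M (e M)) ?Y
    = hcomp D L M M F G (comp1 D M (P M) M (e M) (e' M)) (comp1 D M (P M) M (e M) (e' M))
        (hcomp D M (P M) M (e' M) (e' M) (e M) (e M) (id2 D (P M) M (e M)) (id2 D M (P M) (e' M))) \<theta>"
    using assms by (intro D.hcomp_assoc) (simp_all add: P_in)
  also have "\<dots> = \<theta>"
    using assms by (simp add: P_in D.hcomp_id2 e_e' D.id_hcomp)
  finally show ?thesis unfolding eF .
qed

lemma e'_Pc:
  assumes "L \<in> Obj D" "M \<in> Obj D" "F \<in> Hom D L M" "G \<in> Hom D L M" "\<theta> \<in> Cell D L M F G"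
  shows "hcomp D L (P L) (P M) (e' L) (e' L) (Ph L M F) (Ph L M G) (Pc L M F G \<theta>) (id2 D L (P L) (e' L))
    = hcomp D L M (P M) F G (e' M) (e' M) (id2 D M (P M) (e' M)) \<theta>"
proof -
  let ?Y = "hcomp D L M (P M) F G (e' M) (e' M) (id2 D M (P M) (e' M)) \<theta>"
  let ?e'F = "comp1 D L M (P M) (e' M) F" and ?e'G = "comp1 D L M (P M) (e' M) G"
  have "hcomp D L (P L) (P M) (e' L) (e' L) (Ph L M F) (Ph L M G) (Pc L M F G \<theta>) (id2 D L (P L) (e' L))
    = hcomp D L L (P M) (comp1 D L (P L) L (e L) (e' L)) (comp1 D L (P L) L (e L) (e' L)) ?e'F ?e'G ?Y
        (hcomp D L (P L) L (e' L) (e' L) (e L) (e L) (id2 D (P L) L (e L)) (id2 D L (P L) (e' L)))"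
    unfolding Pc_def Ph_def using assms by (intro D.hcomp_assoc[symmetric]) (simp_all add: P_in)
  also have "\<dots> = ?Y"
    using assms D.hcomp_id[of L "P M" ?e'F ?e'G ?Y]
    by (simp add: P_in D.hcomp_id2 e_e')
  finally show ?thesis .
qed

text \<open>Conjugates are pulled back by the exact inverses \<open>rh\<close> and
  \<open>rc\<close>, so \<open>T\<close> after \<open>R\<close> is conjugation on the nose.\<close>

definition R :: "('p, 'n, 'd, 'o, 'm, 'c) two_fun" where
  "R = \<lparr>on_obj = v, on_hom = \<lambda>L M F. rh (v L) (v M) (Ph L M F),
    on_cell = \<lambda>L M F G \<theta>. rc (v L) (v M) (rh (v L) (v M) (Ph L M F)) (rh (v L) (v M) (Ph L M G)) (Pc L M F G \<theta>)\<rparr>"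

lemma R_simps [simp]:
  "on_obj R L = v L" "on_hom R L M F = rh (v L) (v M) (Ph L M F)"
  "on_cell R L M F G \<theta> = rc (v L) (v M) (rh (v L) (v M) (Ph L M F)) (rh (v L) (v M) (Ph L M G)) (Pc L M F G \<theta>)"
  by (simp_all add: R_def)

lemma R_hom: "\<lbrakk>L \<in> Obj D; M \<in> Obj D; F \<in> Hom D L M\<rbrakk> \<Longrightarrow> rh (v L) (v M) (Ph L M F) \<in> Hom C (v L) (v M)"
  by (simp add: rh_in v_in Ph_in)

lemma T_R_hom: "\<lbrakk>L \<in> Obj D; M \<in> Obj D; F \<in> Hom D L M\<rbrakk>
    \<Longrightarrow> T1 (v L) (v M) (rh (v L) (v M) (Ph L M F)) = Ph L M F"
  by (simp add: T_rh v_in Ph_in)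

lemma
  assumes "L \<in> Obj D" "M \<in> Obj D" "F \<in> Hom D L M" "G \<in> Hom D L M" "\<theta> \<in> Cell D L M F G"
  shows R_cell: "rc (v L) (v M) (rh (v L) (v M) (Ph L M F)) (rh (v L) (v M) (Ph L M G)) (Pc L M F G \<theta>)
      \<in> Cell C (v L) (v M) (rh (v L) (v M) (Ph L M F)) (rh (v L) (v M) (Ph L M G))"
    and T_R_cell: "T2 (v L) (v M) (rh (v L) (v M) (Ph L M F)) (rh (v L) (v M) (Ph L M G))
      (rc (v L) (v M) (rh (v L) (v M) (Ph L M F)) (rh (v L) (v M) (Ph L M G)) (Pc L M F G \<theta>)) = Pc L M F G \<theta>"
  using assms by (simp_all add: rc_in T_rc v_in R_hom T_R_hom Pc_in)

lemmas R_rules = v_in R_hom T_R_hom R_cell T_R_cell C_in T_ops T_in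

lemma Ph_id: "L \<in> Obj D \<Longrightarrow> Ph L L (id1 D L) = id1 D (P L)"
  by (simp add: Ph_def P_in D.comp1_id e'_e)

lemma Pc_id: "\<lbrakk>L \<in> Obj D; M \<in> Obj D; F \<in> Hom D L M\<rbrakk>
    \<Longrightarrow> Pc L M F F (id2 D L M F) = id2 D (P L) (P M) (Ph L M F)"
  by (simp add: Pc_def Ph_def P_in D.hcomp_id2)

lemma Pc_vcomp:
  assumes "L \<in> Obj D" "M \<in> Obj D" "F \<in> Hom D L M" "G \<in> Hom D L M" "H \<in> Hom D L M"
    "\<alpha> \<in> Cell D L M F G" "\<beta> \<in> Cell D L M G H"
  shows "Pc L M F H (vcomp D L M F G H \<beta> \<alpha>)
    = vcomp D (P L) (P M) (Ph L M F) (Ph L M G) (Ph L M H) (Pc L M G H \<beta>) (Pc L M F G \<alpha>)"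
proof -
  \<comment> \<open>An identity 2-cell is its own vertical square; this gives a whiskered vertical
    composite the form that \<open>interchange\<close> expects.\<close>
  have 1: "id2 D A B f = vcomp D A B f f f (id2 D A B f) (id2 D A B f)"
    if "A \<in> Obj D" "B \<in> Obj D" "f \<in> Hom D A B" for A B f
    using that by (simp add: D.vcomp_id D.cells_in)
  have "hcomp D L M (P M) F H (e' M) (e' M) (id2 D M (P M) (e' M)) (vcomp D L M F G H \<beta> \<alpha>)
    = vcomp D L (P M) (comp1 D L M (P M) (e' M) F) (comp1 D L M (P M) (e' M) G) (comp1 D L M (P M) (e' M) H)
      (hcomp D L M (P M) G H (e' M) (e' M) (id2 D M (P M) (e' M)) \<beta>)
      (hcomp D L M (P M) F G (e' M) (e' M) (id2 D M (P M) (e' M)) \<alpha>)"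
    using assms
    by (subst 1) (simp_all add: P_in D.interchange)
  then show ?thesis
    unfolding Pc_def Ph_def using assms
    by (subst (2) 1) (simp_all add: P_in D.interchange)
qed

lemma two_functor_R: "two_functor D C R"
proof (standard, goal_cases)
  case (8 L M N F G F' G' \<alpha> \<beta>)
  \<comment> \<open>The 1-cells bounding the horizontal composite have to be matched before the
    2-cells can be compared.\<close>
  then have "comp1 C (v L) (v M) (v N) (rh (v M) (v N) (Ph M N H')) (rh (v L) (v M) (Ph L M H))
      = rh (v L) (v N) (Ph L N (comp1 D L M N H' H))" if "H \<in> Hom D L M" "H' \<in> Hom D M N" for H H'
    using that by (simp add: Ph_comp1 comp1_eq R_rules)
  with 8 show ?case
    by (simp add: Pc_hcomp hcomp_eq R_rules)
qed (simp_all add: R_rules Ph_id Ph_comp1 Pc_id Pc_vcomp id1_eq comp1_eq id2_eq vcomp_eq D.cells_in)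

text \<open>\<open>T\<close> after \<open>R\<close> is conjugation by \<open>e\<close>, so
  \<open>e\<close> and \<open>e'\<close> themselves serve as components.\<close>

lemma T_R_iso: "naturally_isomorphic D D (comp_two_fun T R) id_two_fun"
  unfolding naturally_isomorphic_def
proof (intro exI conjI ballI)
  show "two_natural D D (comp_two_fun T R) id_two_fun e"
    by standard (simp_all add: comp_two_fun_def id_two_fun_def R_rules e_in Ph_e Pc_e)
  show "two_natural D D id_two_fun (comp_two_fun T R) e'"
    by standard (simp_all add: comp_two_fun_def id_two_fun_def R_rules e'_in e'_Ph e'_Pc)
qed (simp_all add: comp_two_fun_def id_two_fun_def e_e' e'_e)

text \<open>The components are the preimages under \<open>T\<close> of \<open>e\<close> and
  \<open>e'\<close> at \<open>T0 A\<close>; their naturality is that of \<open>e\<close> and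
  \<open>e'\<close>, pulled back along \<open>T\<close>.\<close>

lemma R_T_iso: "naturally_isomorphic C C (comp_two_fun R T) id_two_fun"
proof -
  let ?v = "\<lambda>A. v (T0 A)"
  let ?\<eta> = "\<lambda>A. rh (?v A) A (e (T0 A))" and ?\<theta> = "\<lambda>A. rh A (?v A) (e' (T0 A))"
  let ?R = "\<lambda>A B h. rh (?v A) (?v B) (Ph (T0 A) (T0 B) (T1 A B h))"
  have in_C: "?\<eta> A \<in> Hom C (?v A) A" "?\<theta> A \<in> Hom C A (?v A)"
    and T_C: "T1 (?v A) A (?\<eta> A) = e (T0 A)" "T1 A (?v A) (?\<theta> A) = e' (T0 A)"
    if "A \<in> Obj C" for A
    using that by (simp_all add: rh_in T_rh P_in)
  note rules = in_C T_C R_rules comp_two_fun_def id_two_fun_def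
  show ?thesis
    unfolding naturally_isomorphic_def
  proof (intro exI conjI ballI)
    show "two_natural C C (comp_two_fun R T) id_two_fun ?\<eta>"
    proof (standard, goal_cases)
      case (3 A B f g \<alpha>)
      then have "comp1 C (?v A) A B h (?\<eta> A) = comp1 C (?v A) (?v B) B (?\<eta> B) (?R A B h)"
        if "h \<in> Hom C A B" for h
        using that by (simp add: comp1_eq rules Ph_e)
      with 3 show ?case by (simp add: hcomp_eq rules Pc_e)
    qed (simp_all add: comp1_eq rules Ph_e)
    show "two_natural C C id_two_fun (comp_two_fun R T) ?\<theta>"
    proof (standard, goal_cases)
      case (3 A B f g \<alpha>)
      then have "comp1 C A (?v A) (?v B) (?R A B h) (?\<theta> A) = comp1 C A B (?v B) (?\<theta> B) h"
        if "h \<in> Hom C A B" for h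
        using that by (simp add: comp1_eq rules e'_Ph)
      with 3 show ?case by (simp add: hcomp_eq rules e'_Pc)
    qed (simp_all add: comp1_eq rules e'_Ph)
  qed (simp_all add: comp1_eq id1_eq rules e_e' e'_e)
qed

lemma equivalence: "two_equivalent C D"
  unfolding two_equivalent_def
  using C.two_category_axioms D.two_category_axioms two_functor_T two_functor_R R_T_iso T_R_iso
  by blast

end

section \<open>3-Lie 2-algebras form a 2-category\<close>

context two_vector_space
begin

sublocale L0: module K "L0 L" by (rule L0_module)
sublocale L1: module K "L1 L" by (rule L1_module)
sublocale src: linear_between K "L1 L" "L0 L" "src L" by standard (rule src_linear)
sublocale tgt: linear_between K "L1 L" "L0 L" "tgt L" by standard (rule tgt_linear)
sublocale unt: linear_between K "L0 L" "L1 L" "unt L" by standard (rule unt_linear)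

lemma src_unt: "x \<in> Ob L \<Longrightarrow> src L (unt L x) = x"
  and tgt_unt: "x \<in> Ob L \<Longrightarrow> tgt L (unt L x) = x"
  using unt_arr by (auto simp: arr_def)

lemma
  assumes "f \<in> Ar L" "g \<in> Ar L" "tgt L f = src L g"
  shows seq_closed: "seq L f g \<in> Ar L"
    and src_seq: "src L (seq L f g) = src L f"
    and tgt_seq: "tgt L (seq L f g) = tgt L g"
  using seq_arr[of f g] assms by (auto simp: arr_def composable_def)

lemma seq_assoc':
  "\<lbrakk>f \<in> Ar L; g \<in> Ar L; h \<in> Ar L; tgt L f = src L g; tgt L g = src L h\<rbrakk>
    \<Longrightarrow> seq L (seq L f g) h = seq L f (seq L g h)"
  using seq_assoc by (auto simp: composable_def)

lemma seq_add':
  "\<lbrakk>f \<in> Ar L; g \<in> Ar L; f' \<in> Ar L; g' \<in> Ar L;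
      tgt L f = src L g; tgt L f' = src L g'\<rbrakk>
    \<Longrightarrow> seq L (f \<oplus>\<^bsub>L1 L\<^esub> f') (g \<oplus>\<^bsub>L1 L\<^esub> g') = seq L f g \<oplus>\<^bsub>L1 L\<^esub> seq L f' g'"
  using seq_add by (auto simp: composable_def)

lemma seq_smult':
  "\<lbrakk>a \<in> carrier K; f \<in> Ar L; g \<in> Ar L; tgt L f = src L g\<rbrakk>
    \<Longrightarrow> seq L (a \<odot>\<^bsub>L1 L\<^esub> f) (a \<odot>\<^bsub>L1 L\<^esub> g) = a \<odot>\<^bsub>L1 L\<^esub> seq L f g"
  using seq_smult by (auto simp: composable_def)

text \<open>Linearity of composition at the scalar minus one.\<close>

lemma seq_neg:
  assumes "f \<in> Ar L" "g \<in> Ar L" "tgt L f = src L g"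
  shows "seq L (\<ominus>\<^bsub>L1 L\<^esub> f) (\<ominus>\<^bsub>L1 L\<^esub> g) = \<ominus>\<^bsub>L1 L\<^esub> seq L f g"
  using seq_smult'[of "\<ominus>\<^bsub>K\<^esub> \<one>\<^bsub>K\<^esub>" f g] assms by (simp add: L1.smult_l_minus seq_closed)

lemma unt_seq': "\<lbrakk>f \<in> Ar L; src L f = x\<rbrakk> \<Longrightarrow> seq L (unt L x) f = f"
  and seq_unt': "\<lbrakk>f \<in> Ar L; tgt L f = x\<rbrakk> \<Longrightarrow> seq L f (unt L x) = f"
  using unt_seq seq_unt by auto

lemmas struct_rules = src.rules tgt.rules unt.rules src_unt tgt_unt seq_closed src_seq tgt_seq

text \<open>Write \<open>f = f + 0\<close> and \<open>g = 1 + (g - 1)\<close> with \<open>1\<close> the unit of the middle object.\<close>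

lemma seq_eq:
  assumes "f \<in> Ar L" "g \<in> Ar L" "tgt L f = src L g"
  shows "seq L f g = f \<oplus>\<^bsub>L1 L\<^esub> (g \<ominus>\<^bsub>L1 L\<^esub> unt L (src L g))"
proof -
  let ?u = "unt L (src L g)" and ?k = "g \<ominus>\<^bsub>L1 L\<^esub> unt L (src L g)"
  have k: "?k \<in> Ar L" "src L ?k = \<zero>\<^bsub>L0 L\<^esub>" "?u \<in> Ar L"
    using assms by (simp_all add: struct_rules L0.minus_eq L0.r_neg)
  have "seq L (f \<oplus>\<^bsub>L1 L\<^esub> \<zero>\<^bsub>L1 L\<^esub>) (?u \<oplus>\<^bsub>L1 L\<^esub> ?k) = seq L f ?u \<oplus>\<^bsub>L1 L\<^esub> seq L \<zero>\<^bsub>L1 L\<^esub> ?k"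
    using assms k by (intro seq_add') (simp_all add: struct_rules)
  moreover have "seq L \<zero>\<^bsub>L1 L\<^esub> ?k = ?k"
    using k unt_seq'[of ?k "\<zero>\<^bsub>L0 L\<^esub>"] by (simp add: unt.zero)
  moreover have "?u \<oplus>\<^bsub>L1 L\<^esub> ?k = g"
    using assms k(3) by (simp add: L1.minus_eq L1.a_lcomm L1.r_neg)
  ultimately show ?thesis
    using assms by (simp add: seq_unt')
qed

end

context bracket_functor
begin

sublocale br0: trilinear_between K "L0 L" "L0 L" "L0 L" "L0 L" "br0 L"
  by standard (rule br0_trilinear)
sublocale br1: trilinear_between K "L1 L" "L1 L" "L1 L" "L1 L" "br1 L"
  by standard (rule br1_trilinear)

lemma src_br1: "\<lbrakk>f \<in> Ar L; g \<in> Ar L; h \<in> Ar L\<rbrakk>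
    \<Longrightarrow> src L (br1 L f g h) = br0 L (src L f) (src L g) (src L h)"
  and tgt_br1: "\<lbrakk>f \<in> Ar L; g \<in> Ar L; h \<in> Ar L\<rbrakk>
    \<Longrightarrow> tgt L (br1 L f g h) = br0 L (tgt L f) (tgt L g) (tgt L h)"
  by (simp_all add: src_br tgt_br)

lemma br1_unt: "\<lbrakk>x \<in> Ob L; y \<in> Ob L; z \<in> Ob L\<rbrakk>
    \<Longrightarrow> br1 L (unt L x) (unt L y) (unt L z) = unt L (br0 L x y z)"
  by (simp add: br_unt)

lemma br1_seq: "\<lbrakk>f \<in> Ar L; f' \<in> Ar L; g \<in> Ar L; g' \<in> Ar L;
      h \<in> Ar L; h' \<in> Ar L; tgt L f = src L f'; tgt L g = src L g'; tgt L h = src L h'\<rbrakk>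
    \<Longrightarrow> br1 L (seq L f f') (seq L g g') (seq L h h') = seq L (br1 L f g h) (br1 L f' g' h')"
  using br_seq by (auto simp: composable_def)

lemmas br_rules = struct_rules br0.rules(1) br1.rules(1) src_br1 tgt_br1

context
  fixes f f' assumes f: "f \<in> Ar L" "f' \<in> Ar L" "tgt L f = src L f'"
begin

text \<open>A unit is the composite of itself with itself, so joint functoriality of the bracket
  splits a composite standing in a single argument.\<close>

lemma br1_seq1: "\<lbrakk>y \<in> Ob L; z \<in> Ob L\<rbrakk> \<Longrightarrow> br1 L (seq L f f') (unt L y) (unt L z)
    = seq L (br1 L f (unt L y) (unt L z)) (br1 L f' (unt L y) (unt L z))"
  using f br1_seq[of f f' "unt L y" "unt L y" "unt L z" "unt L z"] by (simp add: struct_rules unt_seq')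

lemma br1_seq2: "\<lbrakk>y \<in> Ob L; z \<in> Ob L\<rbrakk> \<Longrightarrow> br1 L (unt L y) (seq L f f') (unt L z)
    = seq L (br1 L (unt L y) f (unt L z)) (br1 L (unt L y) f' (unt L z))"
  using f br1_seq[of "unt L y" "unt L y" f f' "unt L z" "unt L z"] by (simp add: struct_rules unt_seq')

lemma br1_seq3: "\<lbrakk>y \<in> Ob L; z \<in> Ob L\<rbrakk> \<Longrightarrow> br1 L (unt L y) (unt L z) (seq L f f')
    = seq L (br1 L (unt L y) (unt L z) f) (br1 L (unt L y) (unt L z) f')"
  using f br1_seq[of "unt L y" "unt L y" "unt L z" "unt L z" f f'] by (simp add: struct_rules unt_seq')

end

end

context three_lie_2_algebra
begin

sublocale Jac: quintilinear_between K "L0 L" "L1 L" "Jac L"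
  by standard (rule J_linear)

lemma
  assumes "x1 \<in> Ob L" "x2 \<in> Ob L" "x3 \<in> Ob L" "x4 \<in> Ob L"
    "x5 \<in> Ob L"
  shows src_Jac: "src L (Jac L x1 x2 x3 x4 x5) = br0 L x1 x2 (br0 L x3 x4 x5)"
    and tgt_Jac: "tgt L (Jac L x1 x2 x3 x4 x5) = br0 L (br0 L x1 x2 x3) x4 x5
      \<oplus>\<^bsub>L0 L\<^esub> br0 L x3 (br0 L x1 x2 x4) x5 \<oplus>\<^bsub>L0 L\<^esub> br0 L x3 x4 (br0 L x1 x2 x5)"
  using J_arr[of x1 x2 x3 x4 x5] assms by (auto simp: arr_def)

lemmas lie2_rules = br_rules Jac.rules(1) src_Jac tgt_Jac

end

locale lie2_hom_between = S: three_lie_2_algebra K L + S': three_lie_2_algebra K L' + three_lie2_hom K L L' F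
  for K :: "('k, 'r) ring_scheme" and L L' :: "('k, 'u) three_lie2" and F :: "'u three_lie2_map"
begin

sublocale fn0: linear_between K "L0 L" "L0 L'" "fn0 F" by standard (rule fn0_linear)
sublocale fn1: linear_between K "L1 L" "L1 L'" "fn1 F" by standard (rule fn1_linear)
sublocale fn2: trilinear_between K "L0 L" "L0 L" "L0 L" "L1 L'" "fn2 F" by standard (rule fn2_trilinear)

lemma
  assumes "x \<in> Ob L" "y \<in> Ob L" "z \<in> Ob L"
  shows src_fn2: "src L' (fn2 F x y z) = br0 L' (fn0 F x) (fn0 F y) (fn0 F z)"
    and tgt_fn2: "tgt L' (fn2 F x y z) = fn0 F (br0 L x y z)"
  using fn2_arr[of x y z] assms by (auto simp: arr_def)

lemma fn1_seq: "\<lbrakk>f \<in> Ar L; g \<in> Ar L; tgt L f = src L g\<rbrakk>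
    \<Longrightarrow> fn1 F (seq L f g) = seq L' (fn1 F f) (fn1 F g)"
  using fn_seq by (auto simp: composable_def)

lemma fn2_nat: "\<lbrakk>f \<in> Ar L; g \<in> Ar L; h \<in> Ar L\<rbrakk>
    \<Longrightarrow> seq L' (br1 L' (fn1 F f) (fn1 F g) (fn1 F h)) (fn2 F (tgt L f) (tgt L g) (tgt L h))
       = seq L' (fn2 F (src L f) (src L g) (src L h)) (fn1 F (br1 L f g h))"
  by (rule fn2_natural) simp

lemmas hom_rules = fn0.closed fn1.closed fn2.rules(1) src_fn2 tgt_fn2 fn_src fn_tgt

end


lemma extensional3_restrict:
  "(\<lambda>x\<in>carrier V. \<lambda>y\<in>carrier V. \<lambda>z\<in>carrier V. f x y z) \<in> extensional3 V"
  by (auto simp: PiE_iff extensional_def)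


lemma extensional3_eqI:
  assumes "f \<in> extensional3 V" "g \<in> extensional3 V"
    "\<And>x y z. \<lbrakk>x \<in> carrier V; y \<in> carrier V; z \<in> carrier V\<rbrakk> \<Longrightarrow> f x y z = g x y z"
  shows "f = g"
proof (rule PiE_ext[OF assms(1,2)])
  fix x assume x: "x \<in> carrier V"
  then have fx: "f x \<in> carrier V \<rightarrow>\<^sub>E extensional (carrier V)" "g x \<in> carrier V \<rightarrow>\<^sub>E extensional (carrier V)"
    using assms(1,2) by auto
  show "f x = g x"
  proof (rule PiE_ext[OF fx])
    fix y assume y: "y \<in> carrier V"
    then have "f x y \<in> extensional (carrier V)" "g x y \<in> extensional (carrier V)"
      using fx by auto
    then show "f x y = g x y"
      by (rule extensionalityI) (use assms(3) x y in auto)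
  qed
qed

lemma skew3I:
  "\<lbrakk>\<And>x y z. \<lbrakk>x \<in> carrier V; y \<in> carrier V; z \<in> carrier V\<rbrakk> \<Longrightarrow> f y x z = \<ominus>\<^bsub>W\<^esub> f x y z;
    \<And>x y z. \<lbrakk>x \<in> carrier V; y \<in> carrier V; z \<in> carrier V\<rbrakk> \<Longrightarrow> f x z y = \<ominus>\<^bsub>W\<^esub> f x y z\<rbrakk> \<Longrightarrow> skew3 V W f"
  unfolding skew3_def by blast

lemma skew3D:
  assumes "skew3 V W f" "x \<in> carrier V" "y \<in> carrier V" "z \<in> carrier V"
  shows "f y x z = \<ominus>\<^bsub>W\<^esub> f x y z" "f x z y = \<ominus>\<^bsub>W\<^esub> f x y z"
  using assms unfolding skew3_def by blast+

section \<open>Homomorphisms of 3-Lie 2-algebras: identities and composites\<close>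

lemma three_lie2_id_hom:
  assumes "three_lie_2_algebra K L"
  shows "three_lie2_hom K L L (three_lie2_id L)"
proof -
  interpret three_lie_2_algebra K L by fact
  note rules = lie2_rules
  let ?I = "three_lie2_id L"
  have [simp]: "fn0 ?I x = x" if "x \<in> Ob L" for x
    using that by (simp add: three_lie2_id_def)
  have [simp]: "fn1 ?I x = x" if "x \<in> Ar L" for x
    using that by (simp add: three_lie2_id_def)
  have [simp]: "fn2 ?I x y z = unt L (br0 L x y z)" if "x \<in> Ob L" "y \<in> Ob L" "z \<in> Ob L" for x y z
    using that by (simp add: three_lie2_id_def)
  have sk: "skew3 (L0 L) (L1 L) (fn2 ?I)"
  proof (rule skew3I)
    fix x y z assume x: "x \<in> Ob L" "y \<in> Ob L" "z \<in> Ob L"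
    then show "fn2 ?I y x z = \<ominus>\<^bsub>L1 L\<^esub> fn2 ?I x y z" "fn2 ?I x z y = \<ominus>\<^bsub>L1 L\<^esub> fn2 ?I x y z"
      using skew3D[OF br0_skew x] by (simp_all add: rules unt.neg)
  qed
  show ?thesis
  proof (rule three_lie2_hom.intro, goal_cases)
    case 10
    show ?case
      by (rule trilinearI_skew[OF L0_module L1_module sk]) (auto simp: linear_map_def rules br0.rules)
  next
    case 11 show ?case by (rule sk)
  next
    case (14 x1 x2 x3 x4 x5)
    \<comment> \<open>For the identity every factor other than \<open>?J\<close> is a unit: on one
      side of the coherence law at the target of \<open>?J\<close>, on the other at its
      source.\<close>
    let ?J = "Jac L x1 x2 x3 x4 x5"
    have "seq L (seq L ?J (unt L (tgt L ?J))) (unt L (tgt L ?J))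
      = seq L (seq L (unt L (src L ?J)) (unt L (src L ?J))) ?J"
      using 14 Jac.rules(1)[of x2 x3 x4 x5 x1]
      by (simp add: unt_seq' seq_unt' src.closed tgt.closed src_unt unt.closed)
    with 14 show ?case
      by (simp add: rules br1_unt)
  next
    case 3 show ?case
      by (simp only: three_lie2_id_def three_lie2_map.simps extensional3_restrict)
  qed (auto simp: three_lie2_id_def linear_map_def rules arr_def composable_def br1_unt unt_seq' seq_unt')
qed

text \<open>Coherence of a composite is a pasting of four regions: the coherence law of
  \<open>G\<close> at the images under \<open>F\<close>, the image under \<open>G\<close> of the
  coherence law of \<open>F\<close>, and two naturality squares of \<open>fn2 G\<close>.\<close>

lemma three_lie2_comp_hom:
  assumes "three_lie_2_algebra K L" "three_lie_2_algebra K L'" "three_lie_2_algebra K L''"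
    and "three_lie2_hom K L L' F" "three_lie2_hom K L' L'' G"
  shows "three_lie2_hom K L L'' (three_lie2_comp L L' L'' G F)"
proof -
  interpret F: lie2_hom_between K L L' F using assms by (simp add: lie2_hom_between_def)
  interpret G: lie2_hom_between K L' L'' G using assms by (simp add: lie2_hom_between_def)
  note rules = F.S.lie2_rules F.S'.lie2_rules G.S'.lie2_rules F.hom_rules G.hom_rules
  let ?C = "three_lie2_comp L L' L'' G F"
  have C0 [simp]: "fn0 ?C x = fn0 G (fn0 F x)" if "x \<in> Ob L" for x
    using that by (simp add: three_lie2_comp_def)
  have C1 [simp]: "fn1 ?C x = fn1 G (fn1 F x)" if "x \<in> Ar L" for x
    using that by (simp add: three_lie2_comp_def)
  have C2 [simp]: "fn2 ?C x y z = seq L'' (fn2 G (fn0 F x) (fn0 F y) (fn0 F z)) (fn1 G (fn2 F x y z))"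
    if "x \<in> Ob L" "y \<in> Ob L" "z \<in> Ob L" for x y z
    using that by (simp add: three_lie2_comp_def)
  have sk: "skew3 (L0 L) (L1 L'') (fn2 ?C)"
  proof (rule skew3I)
    fix x y z assume x: "x \<in> Ob L" "y \<in> Ob L" "z \<in> Ob L"
    then show "fn2 ?C y x z = \<ominus>\<^bsub>L1 L''\<^esub> fn2 ?C x y z" "fn2 ?C x z y = \<ominus>\<^bsub>L1 L''\<^esub> fn2 ?C x y z"
      using skew3D[OF F.fn2_skew x] skew3D[OF G.fn2_skew, of "fn0 F x" "fn0 F y" "fn0 F z"]
      by (simp_all add: rules G.fn1.neg G.S'.seq_neg)
  qed
  show ?thesis
  proof (rule three_lie2_hom.intro, goal_cases)
    case 3 show ?case
      by (simp only: three_lie2_comp_def three_lie2_map.simps extensional3_restrict)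
  next
    case 10
    show ?case
      by (rule trilinearI_skew[OF F.S.L0_module G.S'.L1_module sk])
        (auto simp: linear_map_def rules F.fn0.rules G.fn1.rules F.fn2.rules G.fn2.rules
          G.S'.seq_add' G.S'.seq_smult')
  next
    case 11 show ?case by (rule sk)
  next
    case (14 x1 x2 x3 x4 x5)
    then have x: "x1 \<in> Ob L" "x2 \<in> Ob L" "x3 \<in> Ob L"
      "x4 \<in> Ob L" "x5 \<in> Ob L"
      by auto
    define y1 y2 y3 y4 y5 where y_def: "y1 = fn0 F x1" "y2 = fn0 F x2" "y3 = fn0 F x3"
      "y4 = fn0 F x4" "y5 = fn0 F x5"
    have y: "y1 \<in> Ob L'" "y2 \<in> Ob L'" "y3 \<in> Ob L'"
      "y4 \<in> Ob L'" "y5 \<in> Ob L'"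
      using x by (simp_all add: y_def rules)
    \<comment> \<open>The outer boundary is \<open>A1, A2, A3, A4, A5\<close> on one side and
      \<open>C1, D1, D2, E2, E3\<close> on the other. Inside, \<open>A1, A2, B4\<close> against
      \<open>C1, C2, C3\<close> is the region of \<open>G\<close>, and \<open>C3, B5, A5\<close>
      against \<open>E1, E2, E3\<close> is the image of the region of \<open>F\<close>.\<close>
    define A1 where "A1 = Jac L'' (fn0 G y1) (fn0 G y2) (fn0 G y3) (fn0 G y4) (fn0 G y5)"
    define A2 where "A2 = br1 L'' (fn2 G y1 y2 y3) (unt L'' (fn0 G y4)) (unt L'' (fn0 G y5))
      \<oplus>\<^bsub>L1 L''\<^esub> br1 L'' (unt L'' (fn0 G y3)) (fn2 G y1 y2 y4) (unt L'' (fn0 G y5))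
      \<oplus>\<^bsub>L1 L''\<^esub> br1 L'' (unt L'' (fn0 G y3)) (unt L'' (fn0 G y4)) (fn2 G y1 y2 y5)"
    define A3 where "A3 = br1 L'' (fn1 G (fn2 F x1 x2 x3)) (unt L'' (fn0 G y4)) (unt L'' (fn0 G y5))
      \<oplus>\<^bsub>L1 L''\<^esub> br1 L'' (unt L'' (fn0 G y3)) (fn1 G (fn2 F x1 x2 x4)) (unt L'' (fn0 G y5))
      \<oplus>\<^bsub>L1 L''\<^esub> br1 L'' (unt L'' (fn0 G y3)) (unt L'' (fn0 G y4)) (fn1 G (fn2 F x1 x2 x5))"
    define A4 where "A4 = fn2 G (fn0 F (br0 L x1 x2 x3)) y4 y5
      \<oplus>\<^bsub>L1 L''\<^esub> fn2 G y3 (fn0 F (br0 L x1 x2 x4)) y5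
      \<oplus>\<^bsub>L1 L''\<^esub> fn2 G y3 y4 (fn0 F (br0 L x1 x2 x5))"
    define A5 where "A5 = fn1 G (fn2 F (br0 L x1 x2 x3) x4 x5
      \<oplus>\<^bsub>L1 L'\<^esub> fn2 F x3 (br0 L x1 x2 x4) x5 \<oplus>\<^bsub>L1 L'\<^esub> fn2 F x3 x4 (br0 L x1 x2 x5))"
    define B4 where "B4 = fn2 G (br0 L' y1 y2 y3) y4 y5 \<oplus>\<^bsub>L1 L''\<^esub> fn2 G y3 (br0 L' y1 y2 y4) y5
      \<oplus>\<^bsub>L1 L''\<^esub> fn2 G y3 y4 (br0 L' y1 y2 y5)"
    define B5 where "B5 = fn1 G (br1 L' (fn2 F x1 x2 x3) (unt L' y4) (unt L' y5)
      \<oplus>\<^bsub>L1 L'\<^esub> br1 L' (unt L' y3) (fn2 F x1 x2 x4) (unt L' y5)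
      \<oplus>\<^bsub>L1 L'\<^esub> br1 L' (unt L' y3) (unt L' y4) (fn2 F x1 x2 x5))"
    define C1 where "C1 = br1 L'' (unt L'' (fn0 G y1)) (unt L'' (fn0 G y2)) (fn2 G y3 y4 y5)"
    define C2 where "C2 = fn2 G y1 y2 (br0 L' y3 y4 y5)"
    define C3 where "C3 = fn1 G (Jac L' y1 y2 y3 y4 y5)"
    define D1 where "D1 = br1 L'' (unt L'' (fn0 G y1)) (unt L'' (fn0 G y2)) (fn1 G (fn2 F x3 x4 x5))"
    define D2 where "D2 = fn2 G y1 y2 (fn0 F (br0 L x3 x4 x5))"
    define E1 where "E1 = fn1 G (br1 L' (unt L' y1) (unt L' y2) (fn2 F x3 x4 x5))"
    define E2 where "E2 = fn1 G (fn2 F x1 x2 (br0 L x3 x4 x5))"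
    define E3 where "E3 = fn1 G (fn1 F (Jac L x1 x2 x3 x4 x5))"
    note defs = A1_def A2_def A3_def A4_def A5_def B4_def B5_def C1_def C2_def C3_def D1_def D2_def
      E1_def E2_def E3_def
    have in_L: "A1 \<in> Ar L''" "A2 \<in> Ar L''" "A3 \<in> Ar L''"
      "A4 \<in> Ar L''" "A5 \<in> Ar L''" "B4 \<in> Ar L''" "B5 \<in> Ar L''"
      "C1 \<in> Ar L''" "C2 \<in> Ar L''" "C3 \<in> Ar L''"
      "D1 \<in> Ar L''" "D2 \<in> Ar L''"
      "E1 \<in> Ar L''" "E2 \<in> Ar L''" "E3 \<in> Ar L''"
      unfolding defs using x y by (simp_all add: rules)
    have ends: "tgt L'' A1 = src L'' A2" "tgt L'' A2 = src L'' A3" "tgt L'' A3 = src L'' A4"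
      "tgt L'' A4 = src L'' A5" "tgt L'' A2 = src L'' B4" "tgt L'' B4 = src L'' B5"
      "tgt L'' B5 = src L'' A5" "tgt L'' C1 = src L'' C2" "tgt L'' C2 = src L'' C3"
      "tgt L'' C3 = src L'' B5" "tgt L'' C1 = src L'' D1" "tgt L'' D1 = src L'' D2"
      "tgt L'' D2 = src L'' E2" "tgt L'' C2 = src L'' E1" "tgt L'' E1 = src L'' E2"
      "tgt L'' E2 = src L'' E3"
      unfolding defs using x y
      by (simp_all add: rules y_def[symmetric] G.fn0.add)
    note in_L = in_L ends G.S'.struct_rules
    have nat: "seq L'' (br1 L'' (fn1 G f) (fn1 G g) (fn1 G h)) (fn2 G (tgt L' f) (tgt L' g) (tgt L' h))
       = seq L'' (fn2 G (src L' f) (src L' g) (src L' h)) (fn1 G (br1 L' f g h))"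
      if "f \<in> Ar L'" "g \<in> Ar L'" "h \<in> Ar L'" for f g h
      using that by (rule G.fn2_nat)
    \<comment> \<open>Naturality of \<open>fn2 G\<close> at the three triples consisting of one
      arrow \<open>fn2 F\<close> and two units, added up.\<close>
    have A34: "seq L'' A3 A4 = seq L'' B4 B5"
      using nat[of "fn2 F x1 x2 x3" "unt L' y4" "unt L' y5"] nat[of "unt L' y3" "fn2 F x1 x2 x4" "unt L' y5"]
        nat[of "unt L' y3" "unt L' y4" "fn2 F x1 x2 x5"] x y unfolding defs
      by (simp add: rules y_def[symmetric] G.fn1.add G.fn_unt G.S'.seq_add')
    have D12: "seq L'' D1 D2 = seq L'' C2 E1"
      using nat[of "unt L' y1" "unt L' y2" "fn2 F x3 x4 x5"] x y unfolding defs
      by (simp add: rules y_def[symmetric] G.fn_unt)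
    have G_coh: "seq L'' (seq L'' A1 A2) B4 = seq L'' (seq L'' C1 C2) C3"
      using G.fn_coherence[of y1 y2 y3 y4 y5] y unfolding defs by simp
    have F_coh: "seq L'' (seq L'' C3 B5) A5 = seq L'' (seq L'' E1 E2) E3"
      using arg_cong[OF F.fn_coherence[of x1 x2 x3 x4 x5], of "fn1 G"] x y unfolding defs
      by (simp add: rules y_def[symmetric] G.fn1_seq)
    have "seq L'' (seq L'' A1 (seq L'' A2 A3)) (seq L'' A4 A5)
      = seq L'' (seq L'' A1 A2) (seq L'' (seq L'' A3 A4) A5)"
      using in_L by (simp add: G.S'.seq_assoc')
    also have "\<dots> = seq L'' (seq L'' (seq L'' A1 A2) B4) (seq L'' B5 A5)"
      unfolding A34 using in_L by (simp add: G.S'.seq_assoc')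
    also have "\<dots> = seq L'' (seq L'' C1 C2) (seq L'' (seq L'' C3 B5) A5)"
      unfolding G_coh using in_L by (simp add: G.S'.seq_assoc')
    also have "\<dots> = seq L'' C1 (seq L'' (seq L'' C2 E1) (seq L'' E2 E3))"
      unfolding F_coh using in_L by (simp add: G.S'.seq_assoc')
    also have "\<dots> = seq L'' (seq L'' (seq L'' C1 D1) (seq L'' D2 E2)) E3"
      unfolding D12[symmetric] using in_L by (simp add: G.S'.seq_assoc')
    finally have "seq L'' (seq L'' A1 (seq L'' A2 A3)) (seq L'' A4 A5)
      = seq L'' (seq L'' (seq L'' C1 D1) (seq L'' D2 E2)) E3" .
    then show ?case
      unfolding defs using x y
      by (simp add: rules y_def[symmetric] G.S'.seq_add' G.S'.br1_seq1 G.S'.br1_seq2 G.S'.br1_seq3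
          G.fn1.add)
  next
    case (13 f g h)
    then have f: "f \<in> Ar L" "g \<in> Ar L" "h \<in> Ar L" by auto
    let ?p = "br1 L'' (fn1 G (fn1 F f)) (fn1 G (fn1 F g)) (fn1 G (fn1 F h))"
    let ?G = "\<lambda>k. fn2 G (fn0 F (k f)) (fn0 F (k g)) (fn0 F (k h))"
    let ?F = "\<lambda>k. fn2 F (k f) (k g) (k h)"
    \<comment> \<open>Two naturality squares side by side: that of \<open>fn2 G\<close> at the
      images of the arrows, and the image under \<open>G\<close> of that of
      \<open>fn2 F\<close>.\<close>
    have "seq L'' ?p (seq L'' (?G (tgt L)) (fn1 G (?F (tgt L))))
      = seq L'' (seq L'' ?p (?G (tgt L))) (fn1 G (?F (tgt L)))"
      using f by (simp add: rules G.S'.seq_assoc')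
    also have "seq L'' ?p (?G (tgt L)) = seq L'' (?G (src L)) (fn1 G (br1 L' (fn1 F f) (fn1 F g) (fn1 F h)))"
      using f G.fn2_nat[of "fn1 F f" "fn1 F g" "fn1 F h"] by (simp add: rules)
    also have "seq L'' \<dots> (fn1 G (?F (tgt L)))
      = seq L'' (?G (src L)) (fn1 G (seq L' (br1 L' (fn1 F f) (fn1 F g) (fn1 F h)) (?F (tgt L))))"
      using f by (simp add: rules G.S'.seq_assoc' G.fn1_seq)
    also have "\<dots> = seq L'' (?G (src L)) (seq L'' (fn1 G (?F (src L))) (fn1 G (fn1 F (br1 L f g h))))"
      using f by (simp add: rules F.fn2_nat G.fn1_seq)
    also have "\<dots> = seq L'' (seq L'' (?G (src L)) (fn1 G (?F (src L)))) (fn1 G (fn1 F (br1 L f g h)))"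
      using f by (simp add: rules G.S'.seq_assoc')
    finally show ?case
      using f by (simp add: rules)
  qed (auto simp: three_lie2_comp_def linear_map_def F.fn0.rules G.fn0.rules F.fn1.rules G.fn1.rules
      rules arr_def composable_def F.fn_unt G.fn_unt F.fn1_seq G.fn1_seq)
qed

section \<open>2-homomorphisms of 3-Lie 2-algebras and their compositions\<close>

locale lie2_cell_between = F: lie2_hom_between K L L' F + G: lie2_hom_between K L L' G
    + three_lie2_2hom K L L' F G \<theta>
  for K :: "('k, 'r) ring_scheme" and L L' :: "('k, 'u) three_lie2" and F G :: "'u three_lie2_map"
    and \<theta> :: "'u \<Rightarrow> 'u"
begin

sublocale comp: linear_between K "L0 L" "L1 L'" \<theta> by standard (rule linear)

lemma src_comp: "x \<in> Ob L \<Longrightarrow> src L' (\<theta> x) = fn0 F x"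
  and tgt_comp: "x \<in> Ob L \<Longrightarrow> tgt L' (\<theta> x) = fn0 G x"
  using component by (auto simp: arr_def)

lemma bracket': "\<lbrakk>x \<in> Ob L; y \<in> Ob L; z \<in> Ob L\<rbrakk>
    \<Longrightarrow> seq L' (fn2 F x y z) (\<theta> (br0 L x y z)) = seq L' (br1 L' (\<theta> x) (\<theta> y) (\<theta> z)) (fn2 G x y z)"
  using bracket by simp

lemmas cell_rules = F.S.lie2_rules F.S'.lie2_rules F.hom_rules G.hom_rules comp.closed src_comp tgt_comp

end

lemma lie2_cell_betweenI:
  "\<lbrakk>three_lie_2_algebra K L; three_lie_2_algebra K L'; three_lie2_hom K L L' F; three_lie2_hom K L L' G;
    three_lie2_2hom K L L' F G \<theta>\<rbrakk> \<Longrightarrow> lie2_cell_between K L L' F G \<theta>"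
  by (simp add: lie2_cell_between_def lie2_hom_between_def)

lemma three_lie2_id_cell:
  assumes "three_lie_2_algebra K L" "three_lie_2_algebra K L'" "three_lie2_hom K L L' F"
  shows "three_lie2_2hom K L L' F F (\<lambda>x\<in>Ob L. unt L' (fn0 F x))"
proof -
  interpret F: lie2_hom_between K L L' F using assms by (simp add: lie2_hom_between_def)
  note rules = F.S.lie2_rules F.S'.lie2_rules F.hom_rules
  show ?thesis
    by standard (auto simp: rules linear_map_def F.fn0.rules arr_def F.S'.unt_seq' F.S'.seq_unt' F.S'.br1_unt)
qed

text \<open>Naturality squares and bracket laws are pasted; the two brackets of components combine
  into one because the bracket is a functor.\<close>

lemma three_lie2_vcomp_cell:
  assumes "three_lie_2_algebra K L" "three_lie_2_algebra K L'" "three_lie2_hom K L L' F"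
    "three_lie2_hom K L L' G" "three_lie2_hom K L L' H"
    "three_lie2_2hom K L L' F G \<theta>" "three_lie2_2hom K L L' G H \<theta>'"
  shows "three_lie2_2hom K L L' F H (\<lambda>x\<in>Ob L. seq L' (\<theta> x) (\<theta>' x))"
proof -
  interpret A: lie2_cell_between K L L' F G \<theta> using assms by (intro lie2_cell_betweenI)
  interpret B: lie2_cell_between K L L' G H \<theta>' using assms by (intro lie2_cell_betweenI)
  note rules = A.cell_rules B.cell_rules
  show ?thesis
  proof (standard, goal_cases)
    case (4 f)
    note f = this
    then have "seq L' (fn1 F f) (seq L' (\<theta> (tgt L f)) (\<theta>' (tgt L f)))
      = seq L' (seq L' (fn1 F f) (\<theta> (tgt L f))) (\<theta>' (tgt L f))"
      by (simp add: rules A.F.S'.seq_assoc')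
    also have "\<dots> = seq L' (\<theta> (src L f)) (seq L' (fn1 G f) (\<theta>' (tgt L f)))"
      using f by (simp add: rules A.natural A.F.S'.seq_assoc')
    also have "\<dots> = seq L' (seq L' (\<theta> (src L f)) (\<theta>' (src L f))) (fn1 H f)"
      using f by (simp add: rules B.natural A.F.S'.seq_assoc')
    finally show ?case
      using f by (simp add: rules)
  next
    case (5 x y z)
    then have x: "x \<in> Ob L" "y \<in> Ob L" "z \<in> Ob L" by auto
    have "seq L' (fn2 F x y z) (seq L' (\<theta> (br0 L x y z)) (\<theta>' (br0 L x y z)))
      = seq L' (seq L' (fn2 F x y z) (\<theta> (br0 L x y z))) (\<theta>' (br0 L x y z))"
      using x by (simp add: rules A.F.S'.seq_assoc')
    also have "\<dots> = seq L' (br1 L' (\<theta> x) (\<theta> y) (\<theta> z)) (seq L' (fn2 G x y z) (\<theta>' (br0 L x y z)))"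
      using x by (simp add: rules A.bracket' A.F.S'.seq_assoc')
    also have "\<dots> = seq L' (seq L' (br1 L' (\<theta> x) (\<theta> y) (\<theta> z)) (br1 L' (\<theta>' x) (\<theta>' y) (\<theta>' z))) (fn2 H x y z)"
      using x by (simp add: rules B.bracket' A.F.S'.seq_assoc')
    also have "\<dots> = seq L' (br1 L' (seq L' (\<theta> x) (\<theta>' x)) (seq L' (\<theta> y) (\<theta>' y)) (seq L' (\<theta> z) (\<theta>' z))) (fn2 H x y z)"
      using x by (simp add: rules A.F.S'.br1_seq)
    finally show ?case
      using x by (simp add: rules)
  qed (auto simp: rules linear_map_def A.comp.rules B.comp.rules A.F.S'.seq_add' A.F.S'.seq_smult' arr_def)
qed

text \<open>The bracket law is pasted from naturality of \<theta>' at \<open>fn2 F x y z\<close>,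
  the bracket laws of \<theta> and \<theta>', and naturality of \<open>fn2 G'\<close> at the
  components of \<theta>.\<close>

lemma three_lie2_hcomp_cell:
  assumes "three_lie_2_algebra K L" "three_lie_2_algebra K L'" "three_lie_2_algebra K L''"
    "three_lie2_hom K L L' F" "three_lie2_hom K L L' G"
    "three_lie2_hom K L' L'' F'" "three_lie2_hom K L' L'' G'"
    "three_lie2_2hom K L L' F G \<theta>" "three_lie2_2hom K L' L'' F' G' \<theta>'"
  shows "three_lie2_2hom K L L'' (three_lie2_comp L L' L'' F' F) (three_lie2_comp L L' L'' G' G)
    (\<lambda>x\<in>Ob L. seq L'' (\<theta>' (fn0 F x)) (fn1 G' (\<theta> x)))"
proof -
  interpret A: lie2_cell_between K L L' F G \<theta> using assms by (intro lie2_cell_betweenI)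
  interpret B: lie2_cell_between K L' L'' F' G' \<theta>' using assms by (intro lie2_cell_betweenI)
  note rules = A.cell_rules B.cell_rules
  note assoc = B.F.S'.seq_assoc'
  show ?thesis
  proof (standard, goal_cases)
    case (4 f)
    note f = this
    then have "seq L'' (fn1 F' (fn1 F f)) (seq L'' (\<theta>' (fn0 F (tgt L f))) (fn1 G' (\<theta> (tgt L f))))
      = seq L'' (seq L'' (fn1 F' (fn1 F f)) (\<theta>' (tgt L' (fn1 F f)))) (fn1 G' (\<theta> (tgt L f)))"
      by (simp add: rules assoc)
    also have "\<dots> = seq L'' (\<theta>' (fn0 F (src L f))) (fn1 G' (seq L' (fn1 F f) (\<theta> (tgt L f))))"
      using f B.natural[of "fn1 F f"] by (simp add: rules assoc B.G.fn1_seq)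
    also have "\<dots> = seq L'' (seq L'' (\<theta>' (fn0 F (src L f))) (fn1 G' (\<theta> (src L f)))) (fn1 G' (fn1 G f))"
      using f by (simp add: rules A.natural assoc B.G.fn1_seq)
    finally show ?case
      using f by (simp add: rules three_lie2_comp_def)
  next
    case (5 x y z)
    then have x: "x \<in> Ob L" "y \<in> Ob L" "z \<in> Ob L" by auto
    let ?F' = "fn2 F' (fn0 F x) (fn0 F y) (fn0 F z)" and ?G' = "fn2 G' (fn0 F x) (fn0 F y) (fn0 F z)"
    let ?b = "br1 L'' (\<theta>' (fn0 F x)) (\<theta>' (fn0 F y)) (\<theta>' (fn0 F z))"
    have "seq L'' (seq L'' ?F' (fn1 F' (fn2 F x y z)))
        (seq L'' (\<theta>' (fn0 F (br0 L x y z))) (fn1 G' (\<theta> (br0 L x y z))))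
      = seq L'' ?F' (seq L'' (seq L'' (fn1 F' (fn2 F x y z)) (\<theta>' (tgt L' (fn2 F x y z)))) (fn1 G' (\<theta> (br0 L x y z))))"
      using x by (simp add: rules assoc)
    also have "\<dots> = seq L'' (seq L'' ?F' (\<theta>' (br0 L' (fn0 F x) (fn0 F y) (fn0 F z))))
        (fn1 G' (seq L' (fn2 F x y z) (\<theta> (br0 L x y z))))"
      using x B.natural[of "fn2 F x y z"] by (simp add: rules assoc B.G.fn1_seq)
    also have "\<dots> = seq L'' ?b (seq L'' (seq L'' ?G' (fn1 G' (br1 L' (\<theta> x) (\<theta> y) (\<theta> z)))) (fn1 G' (fn2 G x y z)))"
      using x by (simp add: rules A.bracket' B.bracket' assoc B.G.fn1_seq)
    also have "\<dots> = seq L'' (seq L'' ?b (br1 L'' (fn1 G' (\<theta> x)) (fn1 G' (\<theta> y)) (fn1 G' (\<theta> z))))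
        (seq L'' (fn2 G' (fn0 G x) (fn0 G y) (fn0 G z)) (fn1 G' (fn2 G x y z)))"
      using x B.G.fn2_nat[of "\<theta> x" "\<theta> y" "\<theta> z", symmetric] by (simp add: rules assoc)
    also have "seq L'' ?b (br1 L'' (fn1 G' (\<theta> x)) (fn1 G' (\<theta> y)) (fn1 G' (\<theta> z)))
      = br1 L'' (seq L'' (\<theta>' (fn0 F x)) (fn1 G' (\<theta> x))) (seq L'' (\<theta>' (fn0 F y)) (fn1 G' (\<theta> y)))
          (seq L'' (\<theta>' (fn0 F z)) (fn1 G' (\<theta> z)))"
      using x by (simp add: rules B.F.S'.br1_seq)
    finally show ?case
      using x by (simp add: rules three_lie2_comp_def)
  qed (auto simp: rules three_lie2_comp_def linear_map_def A.comp.rules B.comp.rules A.F.fn0.rules B.G.fn1.rules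
      B.F.S'.seq_add' B.F.S'.seq_smult' arr_def)
qed

lemma three_lie2_map_eqI:
  assumes "three_lie2_hom K L L' F" "three_lie2_hom K L L' G"
    "\<And>x. x \<in> Ob L \<Longrightarrow> fn0 F x = fn0 G x" "\<And>x. x \<in> Ar L \<Longrightarrow> fn1 F x = fn1 G x"
    "\<And>x y z. \<lbrakk>x \<in> Ob L; y \<in> Ob L; z \<in> Ob L\<rbrakk> \<Longrightarrow> fn2 F x y z = fn2 G x y z"
  shows "F = G"
proof -
  interpret F: three_lie2_hom K L L' F by fact
  interpret G: three_lie2_hom K L L' G by fact
  have "fn0 F = fn0 G" "fn1 F = fn1 G" "fn2 F = fn2 G"
    using F.fn_extensional G.fn_extensional assms(3-)
    by (blast intro: extensionalityI extensional3_eqI)+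
  then show ?thesis by simp
qed

lemma three_lie2_id_simps:
  "x \<in> Ob L \<Longrightarrow> fn0 (three_lie2_id L) x = x"
  "f \<in> Ar L \<Longrightarrow> fn1 (three_lie2_id L) f = f"
  "\<lbrakk>x \<in> Ob L; y \<in> Ob L; z \<in> Ob L\<rbrakk>
    \<Longrightarrow> fn2 (three_lie2_id L) x y z = unt L (br0 L x y z)"
  by (simp_all add: three_lie2_id_def)

lemma three_lie2_comp_simps:
  "x \<in> Ob L \<Longrightarrow> fn0 (three_lie2_comp L L' L'' G F) x = fn0 G (fn0 F x)"
  "f \<in> Ar L \<Longrightarrow> fn1 (three_lie2_comp L L' L'' G F) f = fn1 G (fn1 F f)"
  "\<lbrakk>x \<in> Ob L; y \<in> Ob L; z \<in> Ob L\<rbrakk>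
    \<Longrightarrow> fn2 (three_lie2_comp L L' L'' G F) x y z
      = seq L'' (fn2 G (fn0 F x) (fn0 F y) (fn0 F z)) (fn1 G (fn2 F x y z))"
  by (simp_all add: three_lie2_comp_def)

lemma ThreeLie2Alg_simps:
  "Obj (ThreeLie2Alg K) = {L. three_lie_2_algebra K L}"
  "Hom (ThreeLie2Alg K) L L' = {F. three_lie2_hom K L L' F}"
  "Cell (ThreeLie2Alg K) L L' F G = {\<theta>. three_lie2_2hom K L L' F G \<theta>}"
  "id1 (ThreeLie2Alg K) = three_lie2_id"
  "comp1 (ThreeLie2Alg K) = three_lie2_comp"
  "id2 (ThreeLie2Alg K) L L' F = (\<lambda>x\<in>Ob L. unt L' (fn0 F x))"
  "vcomp (ThreeLie2Alg K) L L' F G H \<theta>' \<theta> = (\<lambda>x\<in>Ob L. seq L' (\<theta> x) (\<theta>' x))"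
  "hcomp (ThreeLie2Alg K) L L' L'' F G F' G' \<theta>' \<theta>
    = (\<lambda>x\<in>Ob L. seq L'' (\<theta>' (fn0 F x)) (fn1 G' (\<theta> x)))"
  by (simp_all add: ThreeLie2Alg_def)

text \<open>Cells are extensional, so laws are checked on elements, where unit laws, associativity
  of \<open>seq\<close> and functoriality suffice; interchange alone calls for naturality of a
  2-cell.\<close>

theorem two_category_ThreeLie2Alg: "two_category (ThreeLie2Alg K)"
proof (standard, unfold ThreeLie2Alg_simps mem_Collect_eq insert_subset, goal_cases)
  case (1 A)
  then show ?case by (rule three_lie2_id_hom)
next
  case (2 A B D f g)
  then show ?case by (blast intro: three_lie2_comp_hom)
next
  case (3 A B f)
  then interpret f: lie2_hom_between K A B f by (simp add: lie2_hom_between_def)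
  note rules = f.hom_rules f.S.lie2_rules f.S'.lie2_rules
  have "three_lie2_hom K A B (three_lie2_comp A A B f (three_lie2_id A))"
    using 3 by (blast intro: three_lie2_comp_hom three_lie2_id_hom)
  then show ?case
    by (rule three_lie2_map_eqI[OF _ f.three_lie2_hom_axioms])
      (simp_all add: three_lie2_comp_simps three_lie2_id_simps rules f.fn_unt f.S'.seq_unt')
next
  case (4 A B f)
  then interpret f: lie2_hom_between K A B f by (simp add: lie2_hom_between_def)
  note rules = f.hom_rules f.S.lie2_rules f.S'.lie2_rules
  have "three_lie2_hom K A B (three_lie2_comp A B B (three_lie2_id B) f)"
    using 4 by (blast intro: three_lie2_comp_hom three_lie2_id_hom)
  then show ?case
    by (rule three_lie2_map_eqI[OF _ f.three_lie2_hom_axioms])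
      (simp_all add: three_lie2_comp_simps three_lie2_id_simps rules f.S'.unt_seq')
next
  case (5 A B D E f g h)
  then interpret f: lie2_hom_between K A B f by (simp add: lie2_hom_between_def)
  interpret g: lie2_hom_between K B D g using 5 by (simp add: lie2_hom_between_def)
  interpret h: lie2_hom_between K D E h using 5 by (simp add: lie2_hom_between_def)
  note rules = f.S.lie2_rules f.S'.lie2_rules g.S'.lie2_rules h.S'.lie2_rules f.hom_rules g.hom_rules h.hom_rules
  have "three_lie2_hom K A E (three_lie2_comp A D E h (three_lie2_comp A B D g f))"
    "three_lie2_hom K A E (three_lie2_comp A B E (three_lie2_comp B D E h g) f)"
    using 5 by (blast intro: three_lie2_comp_hom)+
  then show ?case
    by (rule three_lie2_map_eqI)
      (simp_all add: three_lie2_comp_simps rules h.S'.seq_assoc' h.fn1_seq)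
next
  case (6 A B f)
  then show ?case by (blast intro: three_lie2_id_cell)
next
  case (7 A B f g h \<alpha> \<beta>)
  then show ?case by (blast intro: three_lie2_vcomp_cell)
next
  case (8 A B f g \<alpha>)
  then interpret a: lie2_cell_between K A B f g \<alpha> by (blast intro: lie2_cell_betweenI)
  show ?case
    using 8 by (intro extensionalityI[OF restrict_extensional a.extensional])
      (simp add: a.F.S'.unt_seq' a.cell_rules)
next
  case (9 A B f g \<alpha>)
  then interpret a: lie2_cell_between K A B f g \<alpha> by (blast intro: lie2_cell_betweenI)
  show ?case
    using 9 by (intro extensionalityI[OF restrict_extensional a.extensional])
      (simp add: a.F.S'.seq_unt' a.cell_rules)
next
  case (10 A B f g h k \<alpha> \<beta> \<gamma>)
  interpret a: lie2_cell_between K A B f g \<alpha> using 10 by (blast intro: lie2_cell_betweenI)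
  interpret b: lie2_cell_between K A B g h \<beta> using 10 by (blast intro: lie2_cell_betweenI)
  interpret c: lie2_cell_between K A B h k \<gamma> using 10 by (blast intro: lie2_cell_betweenI)
  show ?case
    by (rule extensionalityI[OF restrict_extensional restrict_extensional])
      (simp add: a.F.S'.seq_assoc' a.cell_rules b.cell_rules c.cell_rules)
next
  case (11 A B D f g f' g' \<alpha> \<beta>)
  then show ?case by (blast intro: three_lie2_hcomp_cell)
next
  case (12 A B f g \<alpha>)
  then interpret a: lie2_cell_between K A B f g \<alpha> by (blast intro: lie2_cell_betweenI)
  show ?case
    by (intro extensionalityI[OF restrict_extensional a.extensional])
      (simp add: three_lie2_id_def a.G.fn_unt a.F.S'.seq_unt' a.cell_rules)
next
  case (13 A B f g \<alpha>)
  then interpret a: lie2_cell_between K A B f g \<alpha> by (blast intro: lie2_cell_betweenI)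
  show ?case
    by (intro extensionalityI[OF restrict_extensional a.extensional])
      (simp add: three_lie2_id_def a.F.S'.unt_seq' a.cell_rules)
next
  case (14 A B D E f g f' g' f'' g'' \<alpha> \<beta> \<gamma>)
  interpret a: lie2_cell_between K A B f g \<alpha> using 14 by (blast intro: lie2_cell_betweenI)
  interpret b: lie2_cell_between K B D f' g' \<beta> using 14 by (blast intro: lie2_cell_betweenI)
  interpret c: lie2_cell_between K D E f'' g'' \<gamma> using 14 by (blast intro: lie2_cell_betweenI)
  show ?case
    by (rule extensionalityI[OF restrict_extensional restrict_extensional])
      (simp add: three_lie2_comp_def c.F.S'.seq_assoc' c.G.fn1_seq a.cell_rules b.cell_rules c.cell_rules)
next
  case (15 A B D f g)
  then interpret f: lie2_hom_between K A B f by (simp add: lie2_hom_between_def)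
  interpret g: lie2_hom_between K B D g using 15 by (simp add: lie2_hom_between_def)
  show ?case
    by (rule extensionalityI[OF restrict_extensional restrict_extensional])
      (simp add: three_lie2_comp_def g.S'.seq_unt' g.fn_unt f.hom_rules g.hom_rules g.S'.lie2_rules)
next
  case (16 A B D f g h f' g' h' \<alpha> \<beta> \<alpha>' \<beta>')
  interpret a: lie2_cell_between K A B f g \<alpha> using 16 by (blast intro: lie2_cell_betweenI)
  interpret b: lie2_cell_between K A B g h \<beta> using 16 by (blast intro: lie2_cell_betweenI)
  interpret a': lie2_cell_between K B D f' g' \<alpha>' using 16 by (blast intro: lie2_cell_betweenI)
  interpret b': lie2_cell_between K B D g' h' \<beta>' using 16 by (blast intro: lie2_cell_betweenI)
  note rules = a.cell_rules b.cell_rules a'.cell_rules b'.cell_rules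
  show ?case
  proof (rule extensionalityI[OF restrict_extensional restrict_extensional], goal_cases)
    case (1 x)
    note x = this
    have "seq D (seq D (\<alpha>' (fn0 f x)) (\<beta>' (fn0 f x))) (fn1 h' (seq B (\<alpha> x) (\<beta> x)))
      = seq D (\<alpha>' (fn0 f x)) (seq D (seq D (\<beta>' (src B (\<alpha> x))) (fn1 h' (\<alpha> x))) (fn1 h' (\<beta> x)))"
      using x by (simp add: rules a'.F.S'.seq_assoc' b'.G.fn1_seq)
    \<comment> \<open>Naturality of \<beta>' at the arrow \<open>\<alpha> x\<close> exchanges the
      two middle factors.\<close>
    also have "seq D (\<beta>' (src B (\<alpha> x))) (fn1 h' (\<alpha> x)) = seq D (fn1 g' (\<alpha> x)) (\<beta>' (fn0 g x))"
      using x b'.natural[of "\<alpha> x"] by (simp add: rules)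
    also have "seq D (\<alpha>' (fn0 f x)) (seq D \<dots> (fn1 h' (\<beta> x)))
      = seq D (seq D (\<alpha>' (fn0 f x)) (fn1 g' (\<alpha> x))) (seq D (\<beta>' (fn0 g x)) (fn1 h' (\<beta> x)))"
      using x by (simp add: rules a'.F.S'.seq_assoc')
    finally show ?case
      using x by (simp add: rules)
  qed
qed

section \<open>Naturality of the Jacobiator\<close>

context bracket_functor
begin

lemma br1_swap:
  assumes "f \<in> Ar L" "g \<in> Ar L" "h \<in> Ar L"
  shows "br1 L g f h = \<ominus>\<^bsub>L1 L\<^esub> br1 L f g h" "br1 L f h g = \<ominus>\<^bsub>L1 L\<^esub> br1 L f g h"
  using skew3D[OF br1_skew assms] by auto

end

text \<open>The Jacobiator before naturality, invertibility and coherence are known. The reduction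
  of naturality to single arguments has to be at hand while the 3-Lie 2-algebra of a complex is
  still being verified.\<close>

locale jacobiator = bracket_functor K L
  for K :: "('k, 'r) ring_scheme" and L :: "('k, 'u) three_lie2" +
  assumes Jac_linear: "quintilinear K (L0 L) (L1 L) (Jac L)"
    and Jac_skew: "skew23 (L0 L) (L1 L) (Jac L)"
    and Jac_arr: "{x1, x2, x3, x4, x5} \<subseteq> Ob L \<Longrightarrow> Jac L x1 x2 x3 x4 x5
      \<in> arr L (br0 L x1 x2 (br0 L x3 x4 x5)) (br0 L (br0 L x1 x2 x3) x4 x5
          +\<^sub>0 br0 L x3 (br0 L x1 x2 x4) x5 +\<^sub>0 br0 L x3 x4 (br0 L x1 x2 x5))"
begin

text \<open>\<open>N\<close> and \<open>M\<close> are the actions on arrows of the source functor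
  and the target functor of the Jacobiator.\<close>

definition N :: "'u \<Rightarrow> 'u \<Rightarrow> 'u \<Rightarrow> 'u \<Rightarrow> 'u \<Rightarrow> 'u" where
  "N f1 f2 f3 f4 f5 = br1 L f1 f2 (br1 L f3 f4 f5)"

definition M :: "'u \<Rightarrow> 'u \<Rightarrow> 'u \<Rightarrow> 'u \<Rightarrow> 'u \<Rightarrow> 'u" where
  "M f1 f2 f3 f4 f5 = br1 L (br1 L f1 f2 f3) f4 f5 +\<^sub>1 br1 L f3 (br1 L f1 f2 f4) f5
    +\<^sub>1 br1 L f3 f4 (br1 L f1 f2 f5)"

definition natJ :: "'u \<Rightarrow> 'u \<Rightarrow> 'u \<Rightarrow> 'u \<Rightarrow> 'u \<Rightarrow> bool" where
  "natJ f1 f2 f3 f4 f5 \<longleftrightarrow>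
    seq L (N f1 f2 f3 f4 f5) (Jac L (tgt L f1) (tgt L f2) (tgt L f3) (tgt L f4) (tgt L f5))
    = seq L (Jac L (src L f1) (src L f2) (src L f3) (src L f4) (src L f5)) (M f1 f2 f3 f4 f5)"

lemma
  assumes "x1 \<in> Ob L" "x2 \<in> Ob L" "x3 \<in> Ob L" "x4 \<in> Ob L"
    "x5 \<in> Ob L"
  shows Jac_in: "Jac L x1 x2 x3 x4 x5 \<in> Ar L"
    and src_J: "src L (Jac L x1 x2 x3 x4 x5) = br0 L x1 x2 (br0 L x3 x4 x5)"
    and tgt_J: "tgt L (Jac L x1 x2 x3 x4 x5) = br0 L (br0 L x1 x2 x3) x4 x5
      +\<^sub>0 br0 L x3 (br0 L x1 x2 x4) x5 +\<^sub>0 br0 L x3 x4 (br0 L x1 x2 x5)"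
  using Jac_arr[of x1 x2 x3 x4 x5] assms by (auto simp: arr_def)

lemma Jac_swap:
  assumes "x1 \<in> Ob L" "x2 \<in> Ob L" "x3 \<in> Ob L" "x4 \<in> Ob L"
    "x5 \<in> Ob L"
  shows "Jac L x2 x1 x3 x4 x5 = \<ominus>\<^bsub>L1 L\<^esub> Jac L x1 x2 x3 x4 x5"
    and "Jac L x1 x2 x4 x3 x5 = \<ominus>\<^bsub>L1 L\<^esub> Jac L x1 x2 x3 x4 x5"
    and "Jac L x1 x2 x3 x5 x4 = \<ominus>\<^bsub>L1 L\<^esub> Jac L x1 x2 x3 x4 x5"
  using Jac_skew assms unfolding skew23_def skew3_def by blast+

lemmas jac_rules = br_rules Jac_in src_J tgt_J

context
  fixes f1 f2 f3 f4 f5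
  assumes f: "f1 \<in> Ar L" "f2 \<in> Ar L" "f3 \<in> Ar L" "f4 \<in> Ar L"
    "f5 \<in> Ar L"
begin

lemma NM_in: "N f1 f2 f3 f4 f5 \<in> Ar L" "M f1 f2 f3 f4 f5 \<in> Ar L"
  and NM_ends: "tgt L (N f1 f2 f3 f4 f5) = src L (Jac L (tgt L f1) (tgt L f2) (tgt L f3) (tgt L f4) (tgt L f5))"
    "tgt L (Jac L (src L f1) (src L f2) (src L f3) (src L f4) (src L f5)) = src L (M f1 f2 f3 f4 f5)"
  and J_ends_in: "Jac L (tgt L f1) (tgt L f2) (tgt L f3) (tgt L f4) (tgt L f5) \<in> Ar L"
    "Jac L (src L f1) (src L f2) (src L f3) (src L f4) (src L f5) \<in> Ar L"
  using f by (simp_all add: N_def M_def jac_rules)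

text \<open>A transposition negates all four edges of the naturality square, and
  \<open>seq_neg\<close> takes the sign out of both composites.\<close>

lemma natJ_swap12: "natJ f1 f2 f3 f4 f5 \<Longrightarrow> natJ f2 f1 f3 f4 f5"
proof -
  have "N f2 f1 f3 f4 f5 = \<ominus>\<^bsub>L1 L\<^esub> N f1 f2 f3 f4 f5" "M f2 f1 f3 f4 f5 = \<ominus>\<^bsub>L1 L\<^esub> M f1 f2 f3 f4 f5"
    unfolding N_def M_def
    using f br1_swap(1)[of f1 f2 "br1 L f3 f4 f5"] br1_swap(1)[of f1 f2 f3] br1_swap(1)[of f1 f2 f4]
      br1_swap(1)[of f1 f2 f5]
    by (simp_all add: jac_rules br1.rules L1.minus_add)
  moreover assume "natJ f1 f2 f3 f4 f5"
  ultimately show ?thesis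
    using f NM_in NM_ends J_ends_in Jac_swap(1)[of "tgt L f1" "tgt L f2" "tgt L f3" "tgt L f4" "tgt L f5"]
      Jac_swap(1)[of "src L f1" "src L f2" "src L f3" "src L f4" "src L f5"]
    by (simp add: natJ_def seq_neg src.closed tgt.closed)
qed

lemma natJ_swap34: "natJ f1 f2 f3 f4 f5 \<Longrightarrow> natJ f1 f2 f4 f3 f5"
proof -
  have "N f1 f2 f4 f3 f5 = \<ominus>\<^bsub>L1 L\<^esub> N f1 f2 f3 f4 f5" "M f1 f2 f4 f3 f5 = \<ominus>\<^bsub>L1 L\<^esub> M f1 f2 f3 f4 f5"
    unfolding N_def M_def
    using f br1_swap(1)[of f3 f4 f5] br1_swap(1)[of f3 "br1 L f1 f2 f4" f5]
      br1_swap(1)[of "br1 L f1 f2 f3" f4 f5] br1_swap(1)[of f3 f4 "br1 L f1 f2 f5"]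
    by (simp_all add: jac_rules br1.rules L1.minus_add L1.a_ac)
  moreover assume "natJ f1 f2 f3 f4 f5"
  ultimately show ?thesis
    using f NM_in NM_ends J_ends_in Jac_swap(2)[of "tgt L f1" "tgt L f2" "tgt L f3" "tgt L f4" "tgt L f5"]
      Jac_swap(2)[of "src L f1" "src L f2" "src L f3" "src L f4" "src L f5"]
    by (simp add: natJ_def seq_neg src.closed tgt.closed)
qed

lemma natJ_swap45: "natJ f1 f2 f3 f4 f5 \<Longrightarrow> natJ f1 f2 f3 f5 f4"
proof -
  have "N f1 f2 f3 f5 f4 = \<ominus>\<^bsub>L1 L\<^esub> N f1 f2 f3 f4 f5" "M f1 f2 f3 f5 f4 = \<ominus>\<^bsub>L1 L\<^esub> M f1 f2 f3 f4 f5"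
    unfolding N_def M_def
    using f br1_swap(2)[of f3 f4 f5] br1_swap(2)[of f3 "br1 L f1 f2 f4" f5]
      br1_swap(2)[of "br1 L f1 f2 f3" f4 f5] br1_swap(2)[of f3 f4 "br1 L f1 f2 f5"]
    by (simp_all add: jac_rules br1.rules L1.minus_add L1.a_ac)
  moreover assume "natJ f1 f2 f3 f4 f5"
  ultimately show ?thesis
    using f NM_in NM_ends J_ends_in Jac_swap(3)[of "tgt L f1" "tgt L f2" "tgt L f3" "tgt L f4" "tgt L f5"]
      Jac_swap(3)[of "src L f1" "src L f2" "src L f3" "src L f4" "src L f5"]
    by (simp add: natJ_def seq_neg src.closed tgt.closed)
qed

text \<open>Two naturality squares are stacked along the Jacobiator at the middle objects;
  \<open>N\<close> and \<open>M\<close> preserve composites because the bracket and addition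
  do.\<close>

lemma natJ_seq:
  assumes g: "g1 \<in> Ar L" "g2 \<in> Ar L" "g3 \<in> Ar L" "g4 \<in> Ar L"
      "g5 \<in> Ar L"
    and fg: "tgt L f1 = src L g1" "tgt L f2 = src L g2" "tgt L f3 = src L g3" "tgt L f4 = src L g4"
      "tgt L f5 = src L g5"
    and nat: "natJ f1 f2 f3 f4 f5" "natJ g1 g2 g3 g4 g5"
  shows "natJ (seq L f1 g1) (seq L f2 g2) (seq L f3 g3) (seq L f4 g4) (seq L f5 g5)"
proof -
  let ?Nf = "N f1 f2 f3 f4 f5" and ?Ng = "N g1 g2 g3 g4 g5" and ?Mf = "M f1 f2 f3 f4 f5" and ?Mg = "M g1 g2 g3 g4 g5"
  let ?J1 = "Jac L (src L f1) (src L f2) (src L f3) (src L f4) (src L f5)"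
  let ?J2 = "Jac L (src L g1) (src L g2) (src L g3) (src L g4) (src L g5)"
  let ?J3 = "Jac L (tgt L g1) (tgt L g2) (tgt L g3) (tgt L g4) (tgt L g5)"
  have in_L: "?Nf \<in> Ar L" "?Ng \<in> Ar L" "?Mf \<in> Ar L" "?Mg \<in> Ar L"
    "?J1 \<in> Ar L" "?J2 \<in> Ar L" "?J3 \<in> Ar L"
    using f g by (simp_all add: N_def M_def jac_rules)
  have ends: "tgt L ?Nf = src L ?Ng" "tgt L ?Nf = src L ?J2" "tgt L ?J1 = src L ?Mf" "tgt L ?Mf = src L ?Mg"
    "tgt L ?Ng = src L ?J3" "tgt L ?J2 = src L ?Mg"
    using f g fg by (simp_all add: N_def M_def jac_rules)
  have "N (seq L f1 g1) (seq L f2 g2) (seq L f3 g3) (seq L f4 g4) (seq L f5 g5) = seq L ?Nf ?Ng"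
    "M (seq L f1 g1) (seq L f2 g2) (seq L f3 g3) (seq L f4 g4) (seq L f5 g5) = seq L ?Mf ?Mg"
    using f g fg by (simp_all add: N_def M_def jac_rules br1_seq seq_add')
  moreover have "seq L (seq L ?Nf ?Ng) ?J3 = seq L ?Nf (seq L ?J2 ?Mg)"
    using nat(2) in_L ends by (simp add: natJ_def seq_assoc')
  moreover have "\<dots> = seq L (seq L ?J1 ?Mf) ?Mg"
    using nat(1) in_L ends fg by (simp add: natJ_def seq_assoc'[symmetric])
  moreover have "\<dots> = seq L ?J1 (seq L ?Mf ?Mg)"
    using in_L ends by (simp add: seq_assoc')
  ultimately show ?thesis
    using f g fg by (simp add: natJ_def src_seq tgt_seq)
qed

end

text \<open>Joint naturality follows from naturality in each argument separately;
  skew-symmetry reduces the five arguments to the first and the third.\<close>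

lemma natJ_all:
  assumes nat1: "\<And>f x2 x3 x4 x5. \<lbrakk>f \<in> Ar L; {x2, x3, x4, x5} \<subseteq> Ob L\<rbrakk>
      \<Longrightarrow> natJ f (\<iota> x2) (\<iota> x3) (\<iota> x4) (\<iota> x5)"
    and nat3: "\<And>f x1 x2 x4 x5. \<lbrakk>f \<in> Ar L; {x1, x2, x4, x5} \<subseteq> Ob L\<rbrakk>
      \<Longrightarrow> natJ (\<iota> x1) (\<iota> x2) f (\<iota> x4) (\<iota> x5)"
    and f: "f1 \<in> Ar L" "f2 \<in> Ar L" "f3 \<in> Ar L" "f4 \<in> Ar L"
      "f5 \<in> Ar L"
  shows "natJ f1 f2 f3 f4 f5"
proof -
  note rules = struct_rules
  \<comment> \<open>The arguments move one at a time: while one moves, the earlier ones rest at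
    their targets and the later ones at their sources. Composing the five moves returns the given
    arrows, each padded with units.\<close>
  let ?s = "\<lambda>f. \<iota> (src L f)" and ?t = "\<lambda>f. \<iota> (tgt L f)"
  have 1: "natJ f1 (?s f2) (?s f3) (?s f4) (?s f5)"
    using f by (intro nat1) (auto simp: rules)
  have 2: "natJ (?t f1) f2 (?s f3) (?s f4) (?s f5)"
    by (rule natJ_swap12[OF _ _ _ _ _ nat1]) (use f in \<open>auto simp: rules\<close>)
  have 3: "natJ (?t f1) (?t f2) f3 (?s f4) (?s f5)"
    using f by (intro nat3) (auto simp: rules)
  have 4: "natJ (?t f1) (?t f2) (?t f3) f4 (?s f5)"
    by (rule natJ_swap34[OF _ _ _ _ _ nat3]) (use f in \<open>auto simp: rules\<close>)
  have 5: "natJ (?t f1) (?t f2) (?t f3) (?t f4) f5"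
    by (rule natJ_swap45[OF _ _ _ _ _ natJ_swap34[OF _ _ _ _ _ nat3]]) (use f in \<open>auto simp: rules\<close>)
  have 12: "natJ f1 f2 (?s f3) (?s f4) (?s f5)"
    using natJ_seq[OF _ _ _ _ _ _ _ _ _ _ _ _ _ _ _ 1 2] f by (simp add: rules unt_seq' seq_unt')
  have 123: "natJ f1 f2 f3 (?s f4) (?s f5)"
    using natJ_seq[OF _ _ _ _ _ _ _ _ _ _ _ _ _ _ _ 12 3] f by (simp add: rules unt_seq' seq_unt')
  have 1234: "natJ f1 f2 f3 f4 (?s f5)"
    using natJ_seq[OF _ _ _ _ _ _ _ _ _ _ _ _ _ _ _ 123 4] f by (simp add: rules unt_seq' seq_unt')
  show ?thesis
    using natJ_seq[OF _ _ _ _ _ _ _ _ _ _ _ _ _ _ _ 1234 5] f by (simp add: rules unt_seq' seq_unt')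
qed

end

section \<open>Reduction to the brackets on objects and the action on degree one\<close>

text \<open>By skew-symmetry two components of \<open>l3\<close> determine those of total degree at
  most one: \<open>tri\<close> with all arguments in degree 0, and \<open>act\<close> with the
  argument of degree 1 put last.\<close>

definition tri :: "('k, 'u) lie3inf \<Rightarrow> 'u \<Rightarrow> 'u \<Rightarrow> 'u \<Rightarrow> 'u" where
  "tri V = l3 V 0 0 0"

definition act :: "('k, 'u) lie3inf \<Rightarrow> 'u \<Rightarrow> 'u \<Rightarrow> 'u \<Rightarrow> 'u" where
  "act V = l3 V 0 0 1"

context lie3inf_algebra
begin

sublocale V0: module K "V0 V" by (rule V0_module)
sublocale V1: module K "V1 V" by (rule V1_module)
sublocale dif: linear_between K "V1 V" "V0 V" "dif V" by standard (rule dif_linear)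
sublocale tri: trilinear_between K "V0 V" "V0 V" "V0 V" "V0 V" "tri V"
  using l3_trilinear[of 0 0 0] by unfold_locales (simp add: degree_part_def tri_def)
sublocale act: trilinear_between K "V0 V" "V0 V" "V1 V" "V1 V" "act V"
  using l3_trilinear[of 0 0 1] by unfold_locales (simp add: degree_part_def act_def)
sublocale l5: quintilinear_between K "V0 V" "V1 V" "l5 V"
  by standard (rule l5_linear)

lemma tri_swap:
  assumes "x \<in> deg0 V" "y \<in> deg0 V" "z \<in> deg0 V"
  shows "tri V y x z = \<ominus>\<^bsub>V0 V\<^esub> tri V x y z" "tri V x z y = \<ominus>\<^bsub>V0 V\<^esub> tri V x y z"
  using l3_skew[of 0 0 0 x y z] assms by (simp_all add: degree_part_def tri_def)

lemma tri_cycle: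
  "\<lbrakk>x \<in> deg0 V; y \<in> deg0 V; z \<in> deg0 V\<rbrakk> \<Longrightarrow> tri V y z x = tri V x y z"
  using tri_swap[of x y z] tri_swap[of y x z] by (simp add: tri.rules)

lemma act_swap:
  assumes "x \<in> deg0 V" "y \<in> deg0 V" "f \<in> deg1 V"
  shows "act V y x f = \<ominus>\<^bsub>V1 V\<^esub> act V x y f"
  using l3_skew[of 0 0 1 x y f] assms by (simp add: degree_part_def act_def)

text \<open>Moving the argument of degree 1 to the end is done by a cyclic, hence even, permutation,
  so no signs appear.\<close>

lemma l3_reduce:
  assumes "x \<in> deg0 V" "y \<in> deg0 V" "f \<in> deg1 V"
  shows l3_010: "l3 V 0 1 0 x f y = act V y x f" and l3_100: "l3 V 1 0 0 f x y = act V x y f"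
proof -
  have *: "l3 V 0 1 0 x f y = \<ominus>\<^bsub>V1 V\<^esub> act V x y f"
    using l3_skew[of 0 0 1 x y f] assms by (simp add: degree_part_def act_def)
  then show "l3 V 0 1 0 x f y = act V y x f"
    using act_swap[OF assms] by simp
  show "l3 V 1 0 0 f x y = act V x y f"
    using l3_skew[of 0 1 0 x f y] assms * by (simp add: degree_part_def act.rules)
qed

lemmas l3_eqs = tri_def[symmetric] act_def[symmetric] l3_010 l3_100
lemmas closed = tri.rules(1) act.rules(1) l5.rules(1) dif.closed

lemma dif_act: "\<lbrakk>x \<in> deg0 V; y \<in> deg0 V; f \<in> deg1 V\<rbrakk>
    \<Longrightarrow> dif V (act V x y f) = tri V x y (dif V f)"
  using ax_a[of x y f] by (simp only: l3_eqs insert_subset empty_subsetI simp_thms)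

lemma act_dif: "\<lbrakk>x \<in> deg0 V; f \<in> deg1 V; g \<in> deg1 V\<rbrakk>
    \<Longrightarrow> act V x (dif V f) g = act V (dif V g) x f"
  using ax_c[of x f g] by (simp only: l3_eqs insert_subset empty_subsetI simp_thms closed)

context
  fixes x1 x2 x3 x4 x5
  assumes x: "x1 \<in> deg0 V" "x2 \<in> deg0 V" "x3 \<in> deg0 V" "x4 \<in> deg0 V"
    "x5 \<in> deg0 V"
begin

lemma dif_l5: "dif V (l5 V x1 x2 x3 x4 x5) = \<ominus>\<^bsub>V0 V\<^esub> tri V x1 x2 (tri V x3 x4 x5)
    \<oplus>\<^bsub>V0 V\<^esub> tri V x3 (tri V x1 x2 x4) x5 \<oplus>\<^bsub>V0 V\<^esub> tri V (tri V x1 x2 x3) x4 x5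
    \<oplus>\<^bsub>V0 V\<^esub> tri V x3 x4 (tri V x1 x2 x5)"
  using ax_d[of x1 x2 x3 x4 x5] x by (simp only: l3_eqs insert_subset empty_subsetI simp_thms)

lemma l5_dif1: "f \<in> deg1 V \<Longrightarrow> l5 V (dif V f) x2 x3 x4 x5
    = \<ominus>\<^bsub>V1 V\<^esub> act V x2 (tri V x3 x4 x5) f \<oplus>\<^bsub>V1 V\<^esub> act V x5 x3 (act V x2 x4 f)
      \<oplus>\<^bsub>V1 V\<^esub> act V x4 x5 (act V x2 x3 f) \<oplus>\<^bsub>V1 V\<^esub> act V x3 x4 (act V x2 x5 f)"
  using ax_e[of f x2 x3 x4 x5] x by (simp only: l3_eqs insert_subset empty_subsetI simp_thms closed)

lemma l5_dif3: "f \<in> deg1 V \<Longrightarrow> l5 V x1 x2 (dif V f) x4 x5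
    = \<ominus>\<^bsub>V1 V\<^esub> act V x1 x2 (act V x4 x5 f) \<oplus>\<^bsub>V1 V\<^esub> act V (tri V x1 x2 x4) x5 f
      \<oplus>\<^bsub>V1 V\<^esub> act V x4 x5 (act V x1 x2 f) \<oplus>\<^bsub>V1 V\<^esub> act V x4 (tri V x1 x2 x5) f"
  using ax_f[of f x1 x2 x4 x5] x by (simp only: l3_eqs insert_subset empty_subsetI simp_thms closed)

lemma l5_coherence: "\<lbrakk>x6 \<in> deg0 V; x7 \<in> deg0 V\<rbrakk>
    \<Longrightarrow> act V x6 x7 (l5 V x1 x2 x3 x4 x5)
       \<oplus>\<^bsub>V1 V\<^esub> act V x7 x5 (l5 V x1 x2 x3 x4 x6)
       \<oplus>\<^bsub>V1 V\<^esub> act V x1 x2 (l5 V x3 x4 x5 x6 x7)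
       \<oplus>\<^bsub>V1 V\<^esub> act V x5 x6 (l5 V x1 x2 x3 x4 x7)
       \<oplus>\<^bsub>V1 V\<^esub> l5 V x1 x2 (tri V x3 x4 x5) x6 x7
       \<oplus>\<^bsub>V1 V\<^esub> l5 V x1 x2 x5 (tri V x3 x4 x6) x7
       \<oplus>\<^bsub>V1 V\<^esub> l5 V x1 x2 x5 x6 (tri V x3 x4 x7)
     = act V x3 x4 (l5 V x1 x2 x5 x6 x7)
       \<oplus>\<^bsub>V1 V\<^esub> l5 V (tri V x1 x2 x3) x4 x5 x6 x7
       \<oplus>\<^bsub>V1 V\<^esub> l5 V x3 (tri V x1 x2 x4) x5 x6 x7
       \<oplus>\<^bsub>V1 V\<^esub> l5 V x3 x4 (tri V x1 x2 x5) x6 x7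
       \<oplus>\<^bsub>V1 V\<^esub> l5 V x3 x4 x5 (tri V x1 x2 x6) x7
       \<oplus>\<^bsub>V1 V\<^esub> l5 V x1 x2 x3 x4 (tri V x5 x6 x7)
       \<oplus>\<^bsub>V1 V\<^esub> l5 V x3 x4 x5 x6 (tri V x1 x2 x7)"
  using ax_g[of x1 x2 x3 x4 x5 x6 x7] x by (simp only: l3_eqs insert_subset empty_subsetI simp_thms closed)

end

end

section \<open>The 2-vector space of a complex\<close>

text \<open>
  Arrows of \<open>V\<^sub>0 \<oplus> V\<^sub>1\<close> have to be elements of the universe, so that pairs are coded by an injection:
  \<open>mk x f\<close> is the arrow with source \<open>x\<close> and arrow part \<open>f\<close>, from \<open>x\<close> to \<open>x + df\<close>.
\<close>

locale pair_coding =
  fixes code :: "'u \<times> 'u \<Rightarrow> 'u"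
  assumes inj_code: "inj code"
begin

definition mk :: "'u \<Rightarrow> 'u \<Rightarrow> 'u" where "mk x f = code (x, f)"
definition ob :: "'u \<Rightarrow> 'u" where "ob u = fst (inv_into UNIV code u)"
definition pt :: "'u \<Rightarrow> 'u" where "pt u = snd (inv_into UNIV code u)"

lemma ob_mk [simp]: "ob (mk x f) = x" and pt_mk [simp]: "pt (mk x f) = f"
  by (simp_all add: mk_def ob_def pt_def inj_code)

lemma mk_eq_iff [simp]: "mk x f = mk y g \<longleftrightarrow> x = y \<and> f = g"
  using ob_mk pt_mk by metis

definition arrows :: "('k, 'u) module \<Rightarrow> ('k, 'u) module \<Rightarrow> ('k, 'u) module" where
  "arrows U W = \<lparr>carrier = {mk x f | x f. x \<in> carrier U \<and> f \<in> carrier W},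
    mult = undefined, one = undefined, zero = mk \<zero>\<^bsub>U\<^esub> \<zero>\<^bsub>W\<^esub>,
    add = \<lambda>u v. mk (ob u \<oplus>\<^bsub>U\<^esub> ob v) (pt u \<oplus>\<^bsub>W\<^esub> pt v),
    smult = \<lambda>a u. mk (a \<odot>\<^bsub>U\<^esub> ob u) (a \<odot>\<^bsub>W\<^esub> pt u)\<rparr>"

lemma arrows_simps [simp]:
  "mk x f \<in> carrier (arrows U W) \<longleftrightarrow> x \<in> carrier U \<and> f \<in> carrier W"
  "\<zero>\<^bsub>arrows U W\<^esub> = mk \<zero>\<^bsub>U\<^esub> \<zero>\<^bsub>W\<^esub>"
  "mk x f \<oplus>\<^bsub>arrows U W\<^esub> mk y g = mk (x \<oplus>\<^bsub>U\<^esub> y) (f \<oplus>\<^bsub>W\<^esub> g)"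
  "a \<odot>\<^bsub>arrows U W\<^esub> mk x f = mk (a \<odot>\<^bsub>U\<^esub> x) (a \<odot>\<^bsub>W\<^esub> f)"
  by (auto simp: arrows_def)

lemma arrowsE:
  assumes "u \<in> carrier (arrows U W)"
  obtains x f where "u = mk x f" "x \<in> carrier U" "f \<in> carrier W"
  using assms by (auto simp: arrows_def)

lemma ob_pt [simp]:
  "u \<in> carrier (arrows U W) \<Longrightarrow> ob u \<in> carrier U"
  "u \<in> carrier (arrows U W) \<Longrightarrow> pt u \<in> carrier W"
  "u \<in> carrier (arrows U W) \<Longrightarrow> mk (ob u) (pt u) = u"
  by (auto elim: arrowsE)

lemma arrows_module:
  assumes "module K U" "module K W"
  shows "module K (arrows U W)"
proof -
  interpret U: module K U by fact
  interpret W: module K W by fact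
  show ?thesis
  proof (rule moduleI)
    show "cring K" by (rule U.R.is_cring)
    show "abelian_group (arrows U W)"
    proof (rule abelian_groupI)
      fix u assume "u \<in> carrier (arrows U W)"
      then show "\<exists>v\<in>carrier (arrows U W). v \<oplus>\<^bsub>arrows U W\<^esub> u = \<zero>\<^bsub>arrows U W\<^esub>"
        by (elim arrowsE) (auto intro!: bexI[of _ "mk (\<ominus>\<^bsub>U\<^esub> ob u) (\<ominus>\<^bsub>W\<^esub> pt u)"] simp: U.l_neg W.l_neg)
    qed (auto elim!: arrowsE simp: U.a_ac W.a_ac)
  qed (auto elim!: arrowsE simp: U.smult_l_distr W.smult_l_distr U.smult_r_distr W.smult_r_distr
      U.smult_assoc1 W.smult_assoc1)
qed

lemma arrows_neg:
  assumes "module K U" "module K W" "x \<in> carrier U" "f \<in> carrier W"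
  shows "\<ominus>\<^bsub>arrows U W\<^esub> mk x f = mk (\<ominus>\<^bsub>U\<^esub> x) (\<ominus>\<^bsub>W\<^esub> f)"
proof -
  interpret U: module K U by fact
  interpret W: module K W by fact
  interpret A: module K "arrows U W" using assms(1,2) by (rule arrows_module)
  show ?thesis
    using assms(3,4) by (intro A.minus_equality) (simp_all add: U.l_neg W.l_neg)
qed

text \<open>The arrow part of \<open>br1\<close> sums three moves: \<open>u\<close> moves with
  \<open>v\<close> and \<open>w\<close> at their sources, then \<open>v\<close> with
  \<open>u\<close> at its target, then \<open>w\<close> with both others at their targets. Since
  \<open>act\<close> takes the moving argument last, the other two are shifted cyclically.\<close>

definition total :: "('k, 'u) lie3inf \<Rightarrow> ('k, 'u) three_lie2" where
  "total V = \<lparr>L0 = V0 V, L1 = arrows (V0 V) (V1 V), src = ob, tgt = \<lambda>u. ob u \<oplus>\<^bsub>V0 V\<^esub> dif V (pt u),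
    unt = \<lambda>x. mk x \<zero>\<^bsub>V1 V\<^esub>, seq = \<lambda>u v. mk (ob u) (pt u \<oplus>\<^bsub>V1 V\<^esub> pt v),
    br0 = tri V,
    br1 = \<lambda>u v w. mk (tri V (ob u) (ob v) (ob w))
      (act V (ob v) (ob w) (pt u) \<oplus>\<^bsub>V1 V\<^esub> act V (ob w) (ob u \<oplus>\<^bsub>V0 V\<^esub> dif V (pt u)) (pt v)
        \<oplus>\<^bsub>V1 V\<^esub> act V (ob u \<oplus>\<^bsub>V0 V\<^esub> dif V (pt u)) (ob v \<oplus>\<^bsub>V0 V\<^esub> dif V (pt v)) (pt w)),
    Jac = \<lambda>x1 x2 x3 x4 x5. mk (tri V x1 x2 (tri V x3 x4 x5)) (l5 V x1 x2 x3 x4 x5)\<rparr>"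

lemma total_simps [simp]:
  "L0 (total V) = V0 V" "L1 (total V) = arrows (V0 V) (V1 V)"
  "src (total V) = ob" "tgt (total V) (mk x f) = x \<oplus>\<^bsub>V0 V\<^esub> dif V f" "unt (total V) x = mk x \<zero>\<^bsub>V1 V\<^esub>"
  "seq (total V) (mk x f) (mk y g) = mk x (f \<oplus>\<^bsub>V1 V\<^esub> g)"
  "br0 (total V) = tri V"
  "br1 (total V) (mk x f) (mk y g) (mk z h) = mk (tri V x y z)
    (act V y z f \<oplus>\<^bsub>V1 V\<^esub> act V z (x \<oplus>\<^bsub>V0 V\<^esub> dif V f) g
      \<oplus>\<^bsub>V1 V\<^esub> act V (x \<oplus>\<^bsub>V0 V\<^esub> dif V f) (y \<oplus>\<^bsub>V0 V\<^esub> dif V g) h)"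
  "Jac (total V) x1 x2 x3 x4 x5 = mk (tri V x1 x2 (tri V x3 x4 x5)) (l5 V x1 x2 x3 x4 x5)"
  by (simp_all add: total_def)

end

section \<open>The 3-Lie 2-algebra laws on the direct sum\<close>

locale total_space = lie3inf_algebra K V + pair_coding code
  for K :: "('k, 'r) ring_scheme" and V :: "('k, 'u) lie3inf" and code :: "'u \<times> 'u \<Rightarrow> 'u"
begin

lemmas expand = tri.rules act.rules dif.rules V0.minus_add V1.minus_add V0.smult_r_distr V1.smult_r_distr
lemmas neg_mk = arrows_neg[OF V0_module V1_module]

lemma two_vector_space_total: "two_vector_space K (total V)"
proof (rule two_vector_space.intro)
  show "module K (L0 (total V))" by (simp add: V0_module)
  show "module K (L1 (total V))" by (simp add: arrows_module V0_module V1_module)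
  show "linear_map K (L1 (total V)) (L0 (total V)) (src (total V))"
    "linear_map K (L0 (total V)) (L1 (total V)) (unt (total V))"
    by (auto simp: linear_map_def elim!: arrowsE)
  show "linear_map K (L1 (total V)) (L0 (total V)) (tgt (total V))"
    by (auto simp: linear_map_def expand V0.a_ac elim!: arrowsE)
qed (auto simp: arr_def composable_def dif.rules V0.a_ac V1.a_ac V1.smult_r_distr elim!: arrowsE)

text \<open>The form in which \<open>ax_c\<close> is used: the mixed term is skew in
  \<open>f\<close> and \<open>g\<close>.\<close>

lemma act_dif_swap: "\<lbrakk>x \<in> deg0 V; f \<in> deg1 V; g \<in> deg1 V\<rbrakk>
    \<Longrightarrow> act V x (dif V g) f = \<ominus>\<^bsub>V1 V\<^esub> act V x (dif V f) g"
  using act_dif[of x g f] act_swap[of x "dif V f" g] by (simp add: closed)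

text \<open>The formula for \<open>br1\<close> singles out an order of moves. Another order differs
  by mixed terms such as \<open>act V z (dif V f) g\<close>, which \<open>act_dif_swap\<close>
  cancels.\<close>

lemma br1_total_swap:
  assumes "u \<in> carrier (arrows (V0 V) (V1 V))" "v \<in> carrier (arrows (V0 V) (V1 V))"
    "w \<in> carrier (arrows (V0 V) (V1 V))"
  shows "br1 (total V) v u w = \<ominus>\<^bsub>arrows (V0 V) (V1 V)\<^esub> br1 (total V) u v w"
    and "br1 (total V) u w v = \<ominus>\<^bsub>arrows (V0 V) (V1 V)\<^esub> br1 (total V) u v w"
proof -
  obtain x f where u: "u = mk x f" and x: "x \<in> deg0 V" "f \<in> deg1 V"
    using assms(1) by (rule arrowsE)
  obtain y g where v: "v = mk y g" and y: "y \<in> deg0 V" "g \<in> deg1 V"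
    using assms(2) by (rule arrowsE)
  obtain z h where w: "w = mk z h" and z: "z \<in> deg0 V" "h \<in> deg1 V"
    using assms(3) by (rule arrowsE)
  note xyz = x y z
  let ?x = "x \<oplus>\<^bsub>V0 V\<^esub> dif V f" and ?y = "y \<oplus>\<^bsub>V0 V\<^esub> dif V g" and ?z = "z \<oplus>\<^bsub>V0 V\<^esub> dif V h"
  have [simp]: "?x \<in> deg0 V" "?y \<in> deg0 V" "?z \<in> deg0 V"
    using xyz by (simp_all add: closed)
  have 1: "act V z ?y f = \<ominus>\<^bsub>V1 V\<^esub> act V y z f \<ominus>\<^bsub>V1 V\<^esub> act V z (dif V f) g"
    "act V z ?x g = \<ominus>\<^bsub>V1 V\<^esub> act V x z g \<oplus>\<^bsub>V1 V\<^esub> act V z (dif V f) g"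
    using xyz by (simp_all add: act.rules dif.closed act_swap[of y z f] act_swap[of x z g]
      act_dif_swap[of z f g] V1.minus_eq)
  have "act V x z g \<oplus>\<^bsub>V1 V\<^esub> act V z ?y f \<oplus>\<^bsub>V1 V\<^esub> act V ?y ?x h
    = \<ominus>\<^bsub>V1 V\<^esub> (act V y z f \<oplus>\<^bsub>V1 V\<^esub> act V z ?x g \<oplus>\<^bsub>V1 V\<^esub> act V ?x ?y h)"
    unfolding 1 using xyz
    by (subst act_swap[of ?x ?y h]; simp) (rule V1.combines_unique, (rule V1.combines_ops | (rule V1.combines_atom, simp add: xyz closed))+,
        simp add: algebra_simps)
  then show "br1 (total V) v u w = \<ominus>\<^bsub>arrows (V0 V) (V1 V)\<^esub> br1 (total V) u v w"
    using tri_swap[OF x(1) y(1) z(1)]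
    by (simp only: u v w total_simps mk_eq_iff neg_mk closed V0.a_closed V1.a_closed xyz simp_thms)
  have 2: "act V y ?x h = \<ominus>\<^bsub>V1 V\<^esub> act V ?x y h" "act V z y f = \<ominus>\<^bsub>V1 V\<^esub> act V y z f"
    using xyz act_swap[of ?x y h] act_swap[of y z f] by simp_all
  have 3: "act V ?x ?z g = \<ominus>\<^bsub>V1 V\<^esub> act V z ?x g \<ominus>\<^bsub>V1 V\<^esub> act V ?x (dif V g) h"
    using xyz act_swap[of z ?x g] act_dif_swap[of ?x g h]
    by (simp add: act.rules(6) dif.closed V1.minus_eq)
  have 4: "act V ?x ?y h = act V ?x y h \<oplus>\<^bsub>V1 V\<^esub> act V ?x (dif V g) h"
    using xyz by (simp add: act.rules(6) dif.closed)
  have "act V z y f \<oplus>\<^bsub>V1 V\<^esub> act V y ?x h \<oplus>\<^bsub>V1 V\<^esub> act V ?x ?z g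
    = \<ominus>\<^bsub>V1 V\<^esub> (act V y z f \<oplus>\<^bsub>V1 V\<^esub> act V z ?x g \<oplus>\<^bsub>V1 V\<^esub> act V ?x ?y h)"
    unfolding 2 3 4
    by (rule V1.combines_unique, (rule V1.combines_ops | (rule V1.combines_atom, simp add: xyz closed))+,
        simp add: algebra_simps)
  then show "br1 (total V) u w v = \<ominus>\<^bsub>arrows (V0 V) (V1 V)\<^esub> br1 (total V) u v w"
    using tri_swap[OF x(1) y(1) z(1)]
    by (simp only: u v w total_simps mk_eq_iff neg_mk closed V0.a_closed V1.a_closed xyz simp_thms)
qed

text \<open>On the left each argument passes through both of its arrows before the next one moves;
  on the right all arguments pass through their first arrows, then all through their second. The
  cross terms agree by \<open>act_dif\<close>.\<close>

lemma act_seq: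
  assumes "x' \<in> deg0 V" "y \<in> deg0 V" "z \<in> deg0 V"
    "f \<in> deg1 V" "g \<in> deg1 V" "h \<in> deg1 V"
    "f' \<in> deg1 V" "g' \<in> deg1 V" "h' \<in> deg1 V"
    and eqs: "x'' = x' \<oplus>\<^bsub>V0 V\<^esub> dif V f'" "y' = y \<oplus>\<^bsub>V0 V\<^esub> dif V g" "y'' = y' \<oplus>\<^bsub>V0 V\<^esub> dif V g'"
      "z' = z \<oplus>\<^bsub>V0 V\<^esub> dif V h"
  shows "act V y z (f \<oplus>\<^bsub>V1 V\<^esub> f') \<oplus>\<^bsub>V1 V\<^esub> act V z x'' (g \<oplus>\<^bsub>V1 V\<^esub> g') \<oplus>\<^bsub>V1 V\<^esub> act V x'' y'' (h \<oplus>\<^bsub>V1 V\<^esub> h')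
    = (act V y z f \<oplus>\<^bsub>V1 V\<^esub> act V z x' g \<oplus>\<^bsub>V1 V\<^esub> act V x' y' h)
      \<oplus>\<^bsub>V1 V\<^esub> (act V y' z' f' \<oplus>\<^bsub>V1 V\<^esub> act V z' x'' g' \<oplus>\<^bsub>V1 V\<^esub> act V x'' y'' h')"
proof -
  note a = assms(1-9)
  have b: "x'' \<in> deg0 V" "y' \<in> deg0 V" "y'' \<in> deg0 V" "z' \<in> deg0 V"
    using a by (simp_all add: eqs closed)
  have "act V y z (f \<oplus>\<^bsub>V1 V\<^esub> f') = act V y z f \<oplus>\<^bsub>V1 V\<^esub> act V y z f'"
    "act V z x'' (g \<oplus>\<^bsub>V1 V\<^esub> g') = act V z x'' g \<oplus>\<^bsub>V1 V\<^esub> act V z x'' g'"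
    "act V x'' y'' (h \<oplus>\<^bsub>V1 V\<^esub> h') = act V x'' y'' h \<oplus>\<^bsub>V1 V\<^esub> act V x'' y'' h'"
    using a b by (simp_all add: act.rules)
  moreover have "act V y' z' f' = act V y z f' \<oplus>\<^bsub>V1 V\<^esub> act V z (dif V f') g \<oplus>\<^bsub>V1 V\<^esub> act V y' (dif V h) f'"
    using a b act_dif[of z f' g] by (simp add: eqs(4)) (simp add: eqs(2) act.rules closed)
  moreover have "act V z x'' g = act V z x' g \<oplus>\<^bsub>V1 V\<^esub> act V z (dif V f') g"
    using a b by (simp add: eqs(1) act.rules closed)
  moreover have "act V z' x'' g' = act V z x'' g' \<oplus>\<^bsub>V1 V\<^esub> act V x'' (dif V g') h"
    using a b act_dif[of x'' g' h] by (simp add: eqs(4) act.rules(5) closed)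
  moreover have "act V x'' y' h = act V x' y' h \<oplus>\<^bsub>V1 V\<^esub> act V y' (dif V h) f'"
    using a b act_dif[of y' h f'] by (simp add: eqs(1) act.rules(5) closed)
  moreover have "act V x'' y'' h = act V x'' y' h \<oplus>\<^bsub>V1 V\<^esub> act V x'' (dif V g') h"
    using a b by (simp add: eqs(3) act.rules(6) closed)
  ultimately show ?thesis
    by (simp only:) (rule V1.combines_unique, (rule V1.combines_ops | (rule V1.combines_atom, simp add: a b closed))+,
      simp add: algebra_simps)
qed

text \<open>By \<open>dif_act\<close> the differential of each summand is the change of the bracket
  under one move; the changes telescope from sources to targets.\<close>

lemma tri_tgt:
  assumes "x \<in> deg0 V" "y \<in> deg0 V" "z \<in> deg0 V"
    "f \<in> deg1 V" "g \<in> deg1 V" "h \<in> deg1 V"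
    and eqs: "x' = x \<oplus>\<^bsub>V0 V\<^esub> dif V f" "y' = y \<oplus>\<^bsub>V0 V\<^esub> dif V g" "z' = z \<oplus>\<^bsub>V0 V\<^esub> dif V h"
  shows "tri V x y z \<oplus>\<^bsub>V0 V\<^esub> dif V (act V y z f \<oplus>\<^bsub>V1 V\<^esub> act V z x' g \<oplus>\<^bsub>V1 V\<^esub> act V x' y' h) = tri V x' y' z'"
proof -
  note a = assms(1-6)
  have b: "x' \<in> deg0 V" "y' \<in> deg0 V" "z' \<in> deg0 V"
    using a by (simp_all add: eqs closed)
  have "dif V (act V y z f \<oplus>\<^bsub>V1 V\<^esub> act V z x' g \<oplus>\<^bsub>V1 V\<^esub> act V x' y' h)
    = tri V (dif V f) y z \<oplus>\<^bsub>V0 V\<^esub> tri V x' (dif V g) z \<oplus>\<^bsub>V0 V\<^esub> tri V x' y' (dif V h)"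
    using a b tri_cycle[of "dif V f" y z] tri_cycle[of z x' "dif V g"] by (simp add: dif.rules dif_act closed)
  moreover have "tri V x' y' z' = tri V x' y' z \<oplus>\<^bsub>V0 V\<^esub> tri V x' y' (dif V h)"
    using a b by (simp add: eqs(3) tri.rules(7) closed)
  moreover have "tri V x' y' z = tri V x' y z \<oplus>\<^bsub>V0 V\<^esub> tri V x' (dif V g) z"
    using a b by (simp add: eqs(2) tri.rules(6) closed)
  moreover have "tri V x' y z = tri V x y z \<oplus>\<^bsub>V0 V\<^esub> tri V (dif V f) y z"
    using a b by (simp add: eqs(1) tri.rules(5) closed)
  ultimately show ?thesis
    by (simp only:) (rule V0.combines_unique, (rule V0.combines_ops | (rule V0.combines_atom, simp add: a b closed))+,
      simp add: algebra_simps)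
qed

lemma bracket_functor_total: "bracket_functor K (total V)"
proof (rule bracket_functor.intro[OF two_vector_space_total], rule bracket_functor_axioms.intro)
  show "trilinear K (L0 (total V)) (L0 (total V)) (L0 (total V)) (L0 (total V)) (br0 (total V))"
    using tri.tri by simp
  show "skew3 (L0 (total V)) (L0 (total V)) (br0 (total V))"
    by (rule skew3I; simp only: total_simps; rule tri_swap; assumption)
  show sk: "skew3 (L1 (total V)) (L1 (total V)) (br1 (total V))"
    unfolding total_simps by (rule skew3I; rule br1_total_swap; assumption)
  show "trilinear K (L1 (total V)) (L1 (total V)) (L1 (total V)) (L1 (total V)) (br1 (total V))"
  proof (rule trilinearI_skew[OF _ _ sk])
    show "module K (L1 (total V))" "module K (L1 (total V))"
      by (simp_all add: arrows_module V0_module V1_module)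
    fix v w assume "v \<in> Ar (total V)" "w \<in> Ar (total V)"
    then obtain y g z h where v: "v = mk y g" and w: "w = mk z h" and yz: "y \<in> deg0 V" "g \<in> deg1 V"
      "z \<in> deg0 V" "h \<in> deg1 V"
      by (auto elim!: arrowsE)
    \<comment> \<open>The target of a sum of arrows regroups into the sum of the targets, as
      additivity in the moving argument requires.\<close>
    have "(x \<oplus>\<^bsub>V0 V\<^esub> x') \<oplus>\<^bsub>V0 V\<^esub> (k \<oplus>\<^bsub>V0 V\<^esub> k') = (x \<oplus>\<^bsub>V0 V\<^esub> k) \<oplus>\<^bsub>V0 V\<^esub> (x' \<oplus>\<^bsub>V0 V\<^esub> k')"
      if "x \<in> deg0 V" "x' \<in> deg0 V" "k \<in> deg0 V" "k' \<in> deg0 V" for x x' k k'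
      using that by (simp add: V0.a_ac)
    then show "linear_map K (L1 (total V)) (L1 (total V)) (\<lambda>u. br1 (total V) u v w)"
      unfolding v w using yz
      by (auto simp: linear_map_def closed tri.rules(5,14) act.rules(5-7,14-16) dif.rules V1.a_ac
          V0.smult_r_distr V1.smult_r_distr elim!: arrowsE)
  qed
  fix u v w assume uvw: "{u, v, w} \<subseteq> Ar (total V)"
  then show "src (total V) (br1 (total V) u v w) = br0 (total V) (src (total V) u) (src (total V) v) (src (total V) w)"
    by (auto elim!: arrowsE)
  show "tgt (total V) (br1 (total V) u v w) = br0 (total V) (tgt (total V) u) (tgt (total V) v) (tgt (total V) w)"
    using uvw by (auto simp: tri_tgt elim!: arrowsE)
next
  fix x y z assume "{x, y, z} \<subseteq> Ob (total V)"
  then show "br1 (total V) (unt (total V) x) (unt (total V) y) (unt (total V) z) = unt (total V) (br0 (total V) x y z)"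
    by (simp add: dif.rules act.rules)
next
  fix u u' v v' w w' assume "composable (total V) u u'" "composable (total V) v v'" "composable (total V) w w'"
  then obtain x f y g z h f' g' h' where c: "x \<in> deg0 V" "f \<in> deg1 V"
      "y \<in> deg0 V" "g \<in> deg1 V" "z \<in> deg0 V" "h \<in> deg1 V"
      "f' \<in> deg1 V" "g' \<in> deg1 V" "h' \<in> deg1 V"
    and eqs: "u = mk x f" "v = mk y g" "w = mk z h" "u' = mk (x \<oplus>\<^bsub>V0 V\<^esub> dif V f) f'"
      "v' = mk (y \<oplus>\<^bsub>V0 V\<^esub> dif V g) g'" "w' = mk (z \<oplus>\<^bsub>V0 V\<^esub> dif V h) h'"
    by (auto simp: composable_def elim!: arrowsE)
  have "x \<oplus>\<^bsub>V0 V\<^esub> dif V (f \<oplus>\<^bsub>V1 V\<^esub> f') = x \<oplus>\<^bsub>V0 V\<^esub> dif V f \<oplus>\<^bsub>V0 V\<^esub> dif V f'"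
    "y \<oplus>\<^bsub>V0 V\<^esub> dif V (g \<oplus>\<^bsub>V1 V\<^esub> g') = y \<oplus>\<^bsub>V0 V\<^esub> dif V g \<oplus>\<^bsub>V0 V\<^esub> dif V g'"
    using c by (simp_all add: dif.rules V0.a_assoc)
  then show "br1 (total V) (seq (total V) u u') (seq (total V) v v') (seq (total V) w w')
    = seq (total V) (br1 (total V) u v w) (br1 (total V) u' v' w')"
    unfolding eqs total_simps mk_eq_iff
    using c by (simp only: simp_thms) (intro act_seq; simp add: closed)
qed

lemma jacobiator_total: "jacobiator K (total V)"
proof (rule jacobiator.intro[OF bracket_functor_total], rule jacobiator_axioms.intro)
  show "quintilinear K (L0 (total V)) (L1 (total V)) (Jac (total V))"
    by (simp add: quintilinear_def linear_map_def tri.rules l5.rules)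
  show "skew23 (L0 (total V)) (L1 (total V)) (Jac (total V))"
    unfolding skew23_def
  proof (intro conjI ballI skew3I, unfold total_simps)
    fix p q x y z
    assume p: "p \<in> deg0 V" "q \<in> deg0 V" and x: "x \<in> deg0 V" "y \<in> deg0 V" "z \<in> deg0 V"
    have l5: "l5 V q p x y z = \<ominus>\<^bsub>V1 V\<^esub> l5 V p q x y z" "l5 V p q y x z = \<ominus>\<^bsub>V1 V\<^esub> l5 V p q x y z"
      "l5 V p q x z y = \<ominus>\<^bsub>V1 V\<^esub> l5 V p q x y z"
      using l5_skew p x unfolding skew23_def skew3_def by blast+
    show "mk (tri V p q (tri V y x z)) (l5 V p q y x z) = \<ominus>\<^bsub>arrows (V0 V) (V1 V)\<^esub> mk (tri V p q (tri V x y z)) (l5 V p q x y z)"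
      "mk (tri V p q (tri V x z y)) (l5 V p q x z y) = \<ominus>\<^bsub>arrows (V0 V) (V1 V)\<^esub> mk (tri V p q (tri V x y z)) (l5 V p q x y z)"
      using p x tri_swap[OF x] l5(2,3) by (simp_all add: neg_mk closed tri.rules(10))
    show "mk (tri V q p (tri V x y z)) (l5 V q p x y z) = \<ominus>\<^bsub>arrows (V0 V) (V1 V)\<^esub> mk (tri V p q (tri V x y z)) (l5 V p q x y z)"
      using p x tri_swap(1)[of p q "tri V x y z"] l5(1) by (simp add: neg_mk closed)
  qed
  show "Jac (total V) x1 x2 x3 x4 x5 \<in> arr (total V) (br0 (total V) x1 x2 (br0 (total V) x3 x4 x5))
      (br0 (total V) (br0 (total V) x1 x2 x3) x4 x5 \<oplus>\<^bsub>L0 (total V)\<^esub> br0 (total V) x3 (br0 (total V) x1 x2 x4) x5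
        \<oplus>\<^bsub>L0 (total V)\<^esub> br0 (total V) x3 x4 (br0 (total V) x1 x2 x5))"
    if "{x1, x2, x3, x4, x5} \<subseteq> Ob (total V)" for x1 x2 x3 x4 x5
  proof -
    have x: "x1 \<in> deg0 V" "x2 \<in> deg0 V" "x3 \<in> deg0 V" "x4 \<in> deg0 V"
      "x5 \<in> deg0 V"
      using that by auto
    \<comment> \<open>\<open>ax_d\<close> states that the differential of \<open>l5\<close> is the
      prescribed target minus the source.\<close>
    have "tri V x1 x2 (tri V x3 x4 x5) \<oplus>\<^bsub>V0 V\<^esub> dif V (l5 V x1 x2 x3 x4 x5)
      = tri V (tri V x1 x2 x3) x4 x5 \<oplus>\<^bsub>V0 V\<^esub> tri V x3 (tri V x1 x2 x4) x5 \<oplus>\<^bsub>V0 V\<^esub> tri V x3 x4 (tri V x1 x2 x5)"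
      unfolding dif_l5[OF x]
      by (rule V0.combines_unique, (rule V0.combines_ops | (rule V0.combines_atom, simp add: x closed))+,
        simp add: algebra_simps)
    then show ?thesis
      using x by (simp add: arr_def closed)
  qed
qed

text \<open>On arrow parts, naturality in the first argument is \<open>ax_e\<close>, naturality in
  the third is \<open>ax_f\<close>, and the coherence law is \<open>ax_g\<close>.\<close>

lemma three_lie_2_algebra_total: "three_lie_2_algebra K (total V)"
proof -
  interpret T: jacobiator K "total V" by (rule jacobiator_total)
  have nat1: "T.natJ u (unt (total V) x2) (unt (total V) x3) (unt (total V) x4) (unt (total V) x5)"
    if u: "u \<in> Ar (total V)" and x: "{x2, x3, x4, x5} \<subseteq> Ob (total V)" for u x2 x3 x4 x5
  proof -
    obtain x1 f where u: "u = mk x1 f" and x: "x1 \<in> deg0 V" "f \<in> deg1 V"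
      "x2 \<in> deg0 V" "x3 \<in> deg0 V" "x4 \<in> deg0 V" "x5 \<in> deg0 V"
      using u x by (auto elim: arrowsE)
    have eq: "act V x2 (tri V x3 x4 x5) f \<oplus>\<^bsub>V1 V\<^esub> (l5 V x1 x2 x3 x4 x5 \<oplus>\<^bsub>V1 V\<^esub> l5 V (dif V f) x2 x3 x4 x5)
      = l5 V x1 x2 x3 x4 x5 \<oplus>\<^bsub>V1 V\<^esub> (act V x4 x5 (act V x2 x3 f) \<oplus>\<^bsub>V1 V\<^esub> act V x5 x3 (act V x2 x4 f)
        \<oplus>\<^bsub>V1 V\<^esub> act V x3 x4 (act V x2 x5 f))"
      unfolding l5_dif1[OF x(1,3-6,2)]
      by (rule V1.combines_unique, (rule V1.combines_ops | (rule V1.combines_atom, simp add: x closed))+,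
        simp add: algebra_simps)
    show ?thesis
      unfolding T.natJ_def T.N_def T.M_def u using x eq
      by (simp add: closed dif.zero act.rules(2-4) l5.rules(7))
  qed
  have nat3: "T.natJ (unt (total V) x1) (unt (total V) x2) u (unt (total V) x4) (unt (total V) x5)"
    if u: "u \<in> Ar (total V)" and x: "{x1, x2, x4, x5} \<subseteq> Ob (total V)" for u x1 x2 x4 x5
  proof -
    obtain x3 f where u: "u = mk x3 f" and x: "x3 \<in> deg0 V" "f \<in> deg1 V"
      "x1 \<in> deg0 V" "x2 \<in> deg0 V" "x4 \<in> deg0 V" "x5 \<in> deg0 V"
      using u x by (auto elim: arrowsE)
    have eq: "act V x1 x2 (act V x4 x5 f) \<oplus>\<^bsub>V1 V\<^esub> (l5 V x1 x2 x3 x4 x5 \<oplus>\<^bsub>V1 V\<^esub> l5 V x1 x2 (dif V f) x4 x5)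
      = l5 V x1 x2 x3 x4 x5 \<oplus>\<^bsub>V1 V\<^esub> (act V x4 x5 (act V x1 x2 f) \<oplus>\<^bsub>V1 V\<^esub> act V (tri V x1 x2 x4) x5 f
        \<oplus>\<^bsub>V1 V\<^esub> act V x4 (tri V x1 x2 x5) f)"
      unfolding l5_dif3[OF x(3,4,1,5,6,2)]
      by (rule V1.combines_unique, (rule V1.combines_ops | (rule V1.combines_atom, simp add: x closed))+,
        simp add: algebra_simps)
    show ?thesis
      unfolding T.natJ_def T.N_def T.M_def u using x eq
      by (simp add: closed dif.zero act.rules(2-4) l5.rules(9))
  qed
  show ?thesis
  proof (rule three_lie_2_algebra.intro[OF bracket_functor_total], rule three_lie_2_algebra_axioms.intro,
      goal_cases)
    case 1 show ?case by (rule T.Jac_linear)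
  next
    case 2 show ?case by (rule T.Jac_skew)
  next
    case 3 then show ?case by (rule T.Jac_arr)
  next
    case (4 f1 f2 f3 f4 f5)
    then show ?case
      using T.natJ_all[OF nat1 nat3, of f1 f2 f3 f4 f5] by (simp add: T.natJ_def T.N_def T.M_def)
  next
    case (5 x1 x2 x3 x4 x5)
    then have x: "x1 \<in> deg0 V" "x2 \<in> deg0 V" "x3 \<in> deg0 V" "x4 \<in> deg0 V"
      "x5 \<in> deg0 V"
      by auto
    let ?s = "tri V x1 x2 (tri V x3 x4 x5)" and ?f = "l5 V x1 x2 x3 x4 x5"
    \<comment> \<open>The inverse starts at the target and has the negative arrow part.\<close>
    have "mk (?s \<oplus>\<^bsub>V0 V\<^esub> dif V ?f) (\<ominus>\<^bsub>V1 V\<^esub> ?f) \<in> arr (total V) (tgt (total V) (mk ?s ?f)) ?s"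
      using x by (simp add: arr_def closed dif.rules V0.a_assoc V0.r_neg)
    then show ?case
      unfolding invertible_arr_def using x by (auto simp: closed V1.r_neg V1.l_neg intro!: bexI)
  next
    case (6 x1 x2 x3 x4 x5 x6 x7)
    then have x: "x1 \<in> deg0 V" "x2 \<in> deg0 V" "x3 \<in> deg0 V" "x4 \<in> deg0 V"
      "x5 \<in> deg0 V" "x6 \<in> deg0 V" "x7 \<in> deg0 V"
      by auto
    \<comment> \<open>Units have arrow part zero, so the two composites have the two sides of
      \<open>ax_g\<close> as arrow parts, up to the order of summands.\<close>
    then show ?case
      using l5_coherence[OF x]
      by (simp add: closed dif.zero act.rules(2-4) V1.a_ac)
  qed
qed

end

section \<open>Homomorphisms and 2-homomorphisms\<close>

context pair_coding
begin

text \<open>A component of \<open>fn2\<close> must start at the bracket of the images, so only its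
  arrow part is free, and that is \<open>ph2\<close>.\<close>

definition total_hom :: "('k, 'u) lie3inf \<Rightarrow> ('k, 'u) lie3inf \<Rightarrow> 'u lie3inf_map \<Rightarrow> 'u three_lie2_map" where
  "total_hom V V' \<phi> = \<lparr>fn0 = ph0 \<phi>,
    fn1 = \<lambda>u\<in>carrier (arrows (V0 V) (V1 V)). mk (ph0 \<phi> (ob u)) (ph1 \<phi> (pt u)),
    fn2 = \<lambda>x\<in>deg0 V. \<lambda>y\<in>deg0 V. \<lambda>z\<in>deg0 V.
      mk (tri V' (ph0 \<phi> x) (ph0 \<phi> y) (ph0 \<phi> z)) (ph2 \<phi> x y z)\<rparr>"

text \<open>\<open>ph1\<close> is \<open>fn1\<close> on the arrows out of zero, the copy of
  \<open>V1\<close> among all arrows.\<close>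

definition part_hom :: "('k, 'u) lie3inf \<Rightarrow> ('k, 'u) lie3inf \<Rightarrow> 'u three_lie2_map \<Rightarrow> 'u lie3inf_map" where
  "part_hom V V' F = \<lparr>ph0 = fn0 F, ph1 = \<lambda>f\<in>deg1 V. pt (fn1 F (mk \<zero>\<^bsub>V0 V\<^esub> f)),
    ph2 = \<lambda>x\<in>deg0 V. \<lambda>y\<in>deg0 V. \<lambda>z\<in>deg0 V. pt (fn2 F x y z)\<rparr>"

lemma total_hom_simps [simp]:
  "fn0 (total_hom V V' \<phi>) = ph0 \<phi>"
  "\<lbrakk>x \<in> deg0 V; f \<in> deg1 V\<rbrakk> \<Longrightarrow> fn1 (total_hom V V' \<phi>) (mk x f) = mk (ph0 \<phi> x) (ph1 \<phi> f)"
  "\<lbrakk>x \<in> deg0 V; y \<in> deg0 V; z \<in> deg0 V\<rbrakk> \<Longrightarrow> fn2 (total_hom V V' \<phi>) x y z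
    = mk (tri V' (ph0 \<phi> x) (ph0 \<phi> y) (ph0 \<phi> z)) (ph2 \<phi> x y z)"
  by (simp_all add: total_hom_def)

lemma part_hom_simps [simp]:
  "ph0 (part_hom V V' F) = fn0 F"
  "f \<in> deg1 V \<Longrightarrow> ph1 (part_hom V V' F) f = pt (fn1 F (mk \<zero>\<^bsub>V0 V\<^esub> f))"
  "\<lbrakk>x \<in> deg0 V; y \<in> deg0 V; z \<in> deg0 V\<rbrakk>
    \<Longrightarrow> ph2 (part_hom V V' F) x y z = pt (fn2 F x y z)"
  by (simp_all add: part_hom_def)

end

lemma lie3inf_map_eqI:
  fixes f g :: "'u lie3inf_map"
  assumes "ph0 f \<in> extensional (deg0 V)" "ph1 f \<in> extensional (deg1 V)" "ph2 f \<in> extensional3 (V0 V)"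
    "ph0 g \<in> extensional (deg0 V)" "ph1 g \<in> extensional (deg1 V)" "ph2 g \<in> extensional3 (V0 V)"
    "\<And>x. x \<in> deg0 V \<Longrightarrow> ph0 f x = ph0 g x" "\<And>x. x \<in> deg1 V \<Longrightarrow> ph1 f x = ph1 g x"
    "\<And>x y z. \<lbrakk>x \<in> deg0 V; y \<in> deg0 V; z \<in> deg0 V\<rbrakk> \<Longrightarrow> ph2 f x y z = ph2 g x y z"
  shows "f = g"
proof -
  have "ph0 f = ph0 g" "ph1 f = ph1 g" "ph2 f = ph2 g"
    using assms by (blast intro: extensionalityI extensional3_eqI)+
  then show ?thesis by simp
qed

text \<open>The linear data of a homomorphism without its equations. Kept apart, the equations can
  be compared with the functor laws also for \<open>part_hom V V' F\<close> before it is known to be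
  a homomorphism.\<close>

locale multilinear_maps = S: total_space K V code + S': total_space K V' code
  for K :: "('k, 'r) ring_scheme" and V V' :: "('k, 'u) lie3inf" and code :: "'u \<times> 'u \<Rightarrow> 'u" +
  fixes \<phi> :: "'u lie3inf_map"
  assumes ph_ext: "ph0 \<phi> \<in> extensional (deg0 V)" "ph1 \<phi> \<in> extensional (deg1 V)"
      "ph2 \<phi> \<in> extensional3 (V0 V)"
    and ph0_lin: "linear_map K (V0 V) (V0 V') (ph0 \<phi>)"
    and ph1_lin: "linear_map K (V1 V) (V1 V') (ph1 \<phi>)"
    and ph2_tri: "trilinear K (V0 V) (V0 V) (V0 V) (V1 V') (ph2 \<phi>)"
    and ph2_skw: "skew3 (V0 V) (V1 V') (ph2 \<phi>)"
begin

sublocale ph0: linear_between K "V0 V" "V0 V'" "ph0 \<phi>" by standard (rule ph0_lin)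
sublocale ph1: linear_between K "V1 V" "V1 V'" "ph1 \<phi>" by standard (rule ph1_lin)
sublocale ph2: trilinear_between K "V0 V" "V0 V" "V0 V" "V1 V'" "ph2 \<phi>" by standard (rule ph2_tri)

lemmas hclosed = S.closed S'.closed ph0.closed ph1.closed ph2.rules(1)

definition reduced :: bool where
  "reduced \<longleftrightarrow>
    (\<forall>f\<in>deg1 V. ph0 \<phi> (dif V f) = dif V' (ph1 \<phi> f)) \<and>
    (\<forall>x\<in>deg0 V. \<forall>y\<in>deg0 V. \<forall>z\<in>deg0 V. dif V' (ph2 \<phi> x y z)
      = ph0 \<phi> (tri V x y z) \<ominus>\<^bsub>V0 V'\<^esub> tri V' (ph0 \<phi> x) (ph0 \<phi> y) (ph0 \<phi> z)) \<and>
    (\<forall>x\<in>deg0 V. \<forall>y\<in>deg0 V. \<forall>h\<in>deg1 V. ph2 \<phi> x y (dif V h)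
      = ph1 \<phi> (act V x y h) \<ominus>\<^bsub>V1 V'\<^esub> act V' (ph0 \<phi> x) (ph0 \<phi> y) (ph1 \<phi> h)) \<and>
    (\<forall>x1\<in>deg0 V. \<forall>x2\<in>deg0 V. \<forall>x3\<in>deg0 V. \<forall>x4\<in>deg0 V. \<forall>x5\<in>deg0 V.
      l5 V' (ph0 \<phi> x1) (ph0 \<phi> x2) (ph0 \<phi> x3) (ph0 \<phi> x4) (ph0 \<phi> x5)
      \<oplus>\<^bsub>V1 V'\<^esub> act V' (ph0 \<phi> x4) (ph0 \<phi> x5) (ph2 \<phi> x1 x2 x3)
      \<oplus>\<^bsub>V1 V'\<^esub> act V' (ph0 \<phi> x5) (ph0 \<phi> x3) (ph2 \<phi> x1 x2 x4)
      \<oplus>\<^bsub>V1 V'\<^esub> act V' (ph0 \<phi> x3) (ph0 \<phi> x4) (ph2 \<phi> x1 x2 x5)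
      \<oplus>\<^bsub>V1 V'\<^esub> ph2 \<phi> (tri V x1 x2 x3) x4 x5
      \<oplus>\<^bsub>V1 V'\<^esub> ph2 \<phi> x3 (tri V x1 x2 x4) x5
      \<oplus>\<^bsub>V1 V'\<^esub> ph2 \<phi> x3 x4 (tri V x1 x2 x5)
      = act V' (ph0 \<phi> x1) (ph0 \<phi> x2) (ph2 \<phi> x3 x4 x5)
      \<oplus>\<^bsub>V1 V'\<^esub> ph2 \<phi> x1 x2 (tri V x3 x4 x5)
      \<oplus>\<^bsub>V1 V'\<^esub> ph1 \<phi> (l5 V x1 x2 x3 x4 x5))"

lemma reduced_iff: "lie3inf_hom K V V' \<phi> \<longleftrightarrow> reduced"
proof
  assume "lie3inf_hom K V V' \<phi>"
  then interpret lie3inf_hom K V V' \<phi> .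
  show reduced
    unfolding reduced_def
  proof (intro conjI ballI, goal_cases)
    case (1 f)
    then show ?case by (rule chain_map)
  next
    case (2 x y z)
    then show ?case using dif_ph2[of x y z] by (simp add: tri_def)
  next
    case (3 x y h)
    then show ?case using ph2_dif[of x y h] by (simp add: act_def)
  next
    case (4 x1 x2 x3 x4 x5)
    then show ?case
      using ph_coherence[of x1 x2 x3 x4 x5]
      by (simp only: S.l3_eqs S'.l3_eqs hclosed insert_subset empty_subsetI simp_thms)
  qed
next
  assume red: reduced
  note red = red[unfolded reduced_def]
  show "lie3inf_hom K V V' \<phi>"
  proof (rule lie3inf_hom.intro[OF ph_ext ph0_lin ph1_lin _ ph2_tri ph2_skw], goal_cases)
    case (1 f)
    then show ?case using red by blast
  next
    case (2 x y z)
    then show ?case using red by (simp add: tri_def)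
  next
    case (3 x y h)
    then show ?case using red by (simp add: act_def)
  next
    case (4 x1 x2 x3 x4 x5)
    then have x: "x1 \<in> deg0 V" "x2 \<in> deg0 V" "x3 \<in> deg0 V" "x4 \<in> deg0 V"
      "x5 \<in> deg0 V"
      by auto
    then show ?case
      using red[THEN conjunct2, THEN conjunct2, THEN conjunct2, rule_format, OF x]
      by (simp only: S.l3_eqs S'.l3_eqs hclosed insert_subset empty_subsetI simp_thms)
  qed
qed

text \<open>Specialisation recovers every equation: targets of arrows out of zero give the chain map
  law, the target of \<open>fn2\<close> gives its differential, naturality at two units and one
  arrow out of zero gives \<open>ph2\<close> on boundaries, and arrow parts of the coherence law
  give the last.\<close>

lemma total_hom_reduced:
  assumes "three_lie2_hom K (S.total V) (S.total V') (S.total_hom V V' \<phi>)"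
  shows reduced
proof -
  interpret three_lie2_hom K "S.total V" "S.total V'" "S.total_hom V V' \<phi>" by fact
  show ?thesis
    unfolding reduced_def
  proof (intro conjI ballI, goal_cases)
    case (1 f)
    then show ?case
      using fn_tgt[of "S.mk \<zero>\<^bsub>V0 V\<^esub> f"] by (simp add: hclosed ph0.rules)
  next
    case (2 x y z)
    then have "tri V' (ph0 \<phi> x) (ph0 \<phi> y) (ph0 \<phi> z) \<oplus>\<^bsub>V0 V'\<^esub> dif V' (ph2 \<phi> x y z) = ph0 \<phi> (tri V x y z)"
      using fn2_arr[of x y z] by (simp add: hclosed arr_def)
    then have "ph0 \<phi> (tri V x y z) \<ominus>\<^bsub>V0 V'\<^esub> tri V' (ph0 \<phi> x) (ph0 \<phi> y) (ph0 \<phi> z)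
      = tri V' (ph0 \<phi> x) (ph0 \<phi> y) (ph0 \<phi> z) \<oplus>\<^bsub>V0 V'\<^esub> dif V' (ph2 \<phi> x y z) \<ominus>\<^bsub>V0 V'\<^esub> tri V' (ph0 \<phi> x) (ph0 \<phi> y) (ph0 \<phi> z)"
      by simp
    also have "\<dots> = dif V' (ph2 \<phi> x y z)"
      by (rule S'.V0.combines_unique, (rule S'.V0.combines_ops | (rule S'.V0.combines_atom, simp add: 2 hclosed))+,
        simp add: algebra_simps)
    finally show ?case ..
  next
    case (3 x y h)
    then have "act V' (ph0 \<phi> x) (ph0 \<phi> y) (ph1 \<phi> h) \<oplus>\<^bsub>V1 V'\<^esub> ph2 \<phi> x y (dif V h) = ph1 \<phi> (act V x y h)"
      using fn2_natural[of "S.mk x \<zero>\<^bsub>V1 V\<^esub>" "S.mk y \<zero>\<^bsub>V1 V\<^esub>" "S.mk \<zero>\<^bsub>V0 V\<^esub> h"]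
      by (simp add: hclosed ph0.rules ph1.rules ph2.rules(2-4) S.dif.zero S'.dif.zero S.tri.rules(2-4) S'.tri.rules(2-4)
        S.act.rules(2-4) S'.act.rules(2-4))
    then have "ph1 \<phi> (act V x y h) \<ominus>\<^bsub>V1 V'\<^esub> act V' (ph0 \<phi> x) (ph0 \<phi> y) (ph1 \<phi> h)
      = act V' (ph0 \<phi> x) (ph0 \<phi> y) (ph1 \<phi> h) \<oplus>\<^bsub>V1 V'\<^esub> ph2 \<phi> x y (dif V h) \<ominus>\<^bsub>V1 V'\<^esub> act V' (ph0 \<phi> x) (ph0 \<phi> y) (ph1 \<phi> h)"
      by simp
    also have "\<dots> = ph2 \<phi> x y (dif V h)"
      by (rule S'.V1.combines_unique, (rule S'.V1.combines_ops | (rule S'.V1.combines_atom, simp add: 3 hclosed))+,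
        simp add: algebra_simps)
    finally show ?case ..
  next
    case (4 x1 x2 x3 x4 x5)
    then show ?case
      using fn_coherence[of x1 x2 x3 x4 x5]
      by (simp add: hclosed ph0.rules ph1.rules S.dif.zero S'.dif.zero S'.act.rules(2-4) S'.V1.a_assoc)
  qed
qed

text \<open>The point is naturality of \<open>fn2\<close>, which concerns three arrows at once while
  the equation for \<open>ph2\<close> on boundaries concerns one. Expanding \<open>ph2\<close> at
  the targets argument by argument reduces it to three instances of that equation.\<close>

lemma total_hom_hom:
  assumes red: reduced
  shows "three_lie2_hom K (S.total V) (S.total V') (S.total_hom V V' \<phi>)"
proof -
  have chain: "ph0 \<phi> (dif V f) = dif V' (ph1 \<phi> f)" if "f \<in> deg1 V" for f
    using red that unfolding reduced_def by blast
  have ph2_dif: "ph2 \<phi> x y (dif V h) = ph1 \<phi> (act V x y h) \<ominus>\<^bsub>V1 V'\<^esub> act V' (ph0 \<phi> x) (ph0 \<phi> y) (ph1 \<phi> h)"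
    if "x \<in> deg0 V" "y \<in> deg0 V" "h \<in> deg1 V" for x y h
    using red that unfolding reduced_def by blast
  have ph2_cyc: "ph2 \<phi> y z x = ph2 \<phi> x y z"
    if "x \<in> deg0 V" "y \<in> deg0 V" "z \<in> deg0 V" for x y z
    using skew3D[OF ph2_skw, of x y z] skew3D[OF ph2_skw, of y x z] that by (simp add: hclosed)
  have tgt: "tri V' (ph0 \<phi> x) (ph0 \<phi> y) (ph0 \<phi> z) \<oplus>\<^bsub>V0 V'\<^esub> dif V' (ph2 \<phi> x y z) = ph0 \<phi> (tri V x y z)"
    if x: "x \<in> deg0 V" "y \<in> deg0 V" "z \<in> deg0 V" for x y z
  proof -
    have "dif V' (ph2 \<phi> x y z) = ph0 \<phi> (tri V x y z) \<ominus>\<^bsub>V0 V'\<^esub> tri V' (ph0 \<phi> x) (ph0 \<phi> y) (ph0 \<phi> z)"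
      using red x unfolding reduced_def by blast
    then show ?thesis
      by (simp only:) (rule S'.V0.combines_unique, (rule S'.V0.combines_ops | (rule S'.V0.combines_atom, simp add: x hclosed))+,
        simp add: algebra_simps)
  qed
  have sk: "skew3 (L0 (S.total V)) (L1 (S.total V')) (fn2 (S.total_hom V V' \<phi>))"
  proof (rule skew3I, unfold S.total_simps)
    fix x y z assume x: "x \<in> deg0 V" "y \<in> deg0 V" "z \<in> deg0 V"
    show "fn2 (S.total_hom V V' \<phi>) y x z = \<ominus>\<^bsub>S.arrows (V0 V') (V1 V')\<^esub> fn2 (S.total_hom V V' \<phi>) x y z"
      "fn2 (S.total_hom V V' \<phi>) x z y = \<ominus>\<^bsub>S.arrows (V0 V') (V1 V')\<^esub> fn2 (S.total_hom V V' \<phi>) x y z"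
      using x skew3D[OF ph2_skw x] S'.tri_swap[of "ph0 \<phi> x" "ph0 \<phi> y" "ph0 \<phi> z"]
      by (simp_all add: S'.neg_mk hclosed)
  qed
  show ?thesis
  proof (rule three_lie2_hom.intro, goal_cases)
    case 1 show ?case using ph_ext by simp
  next
    case 2 show ?case by (simp add: S.total_hom_def)
  next
    case 3 show ?case by (simp only: S.total_hom_def three_lie2_map.simps S.total_simps extensional3_restrict)
  next
    case 4 show ?case using ph0_lin by simp
  next
    case 5 show ?case
      by (auto simp: linear_map_def hclosed ph0.rules ph1.rules elim!: S.arrowsE)
  next
    case (6 f) then show ?case by (auto elim!: S.arrowsE)
  next
    case (7 f) then show ?case by (auto simp: hclosed chain ph0.add elim!: S.arrowsE)
  next
    case (8 x) then show ?case by (simp add: ph1.zero)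
  next
    case (9 f g) then show ?case by (auto simp: hclosed composable_def ph1.add elim!: S.arrowsE)
  next
    case 10
    show ?case
    proof (rule trilinearI_skew[OF _ _ sk])
      show "module K (L0 (S.total V))" "module K (L1 (S.total V'))"
        by (simp_all add: S.V0_module S.arrows_module S'.V0_module S'.V1_module)
      show "linear_map K (L0 (S.total V)) (L1 (S.total V')) (\<lambda>x. fn2 (S.total_hom V V' \<phi>) x y z)"
        if "y \<in> Ob (S.total V)" "z \<in> Ob (S.total V)" for y z
        using that by (auto simp: linear_map_def hclosed ph0.rules ph2.rules S'.tri.rules)
    qed
  next
    case 11 show ?case by (rule sk)
  next
    case (12 x y z) then show ?case by (simp add: arr_def hclosed tgt)
  next
    case (13 u v w)
    then obtain x f y g z h where c: "x \<in> deg0 V" "f \<in> deg1 V"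
        "y \<in> deg0 V" "g \<in> deg1 V" "z \<in> deg0 V" "h \<in> deg1 V"
      and eqs: "u = S.mk x f" "v = S.mk y g" "w = S.mk z h"
      by (auto elim!: S.arrowsE)
    let ?x = "x \<oplus>\<^bsub>V0 V\<^esub> dif V f" and ?y = "y \<oplus>\<^bsub>V0 V\<^esub> dif V g" and ?z = "z \<oplus>\<^bsub>V0 V\<^esub> dif V h"
    have c': "?x \<in> deg0 V" "?y \<in> deg0 V" "?z \<in> deg0 V"
      using c by (simp_all add: hclosed)
    have "ph2 \<phi> ?x ?y ?z = ph2 \<phi> ?x ?y z \<oplus>\<^bsub>V1 V'\<^esub> ph2 \<phi> ?x ?y (dif V h)"
      using c c' by (simp add: ph2.rules(7) hclosed)
    moreover have "ph2 \<phi> ?x ?y z = ph2 \<phi> ?x y z \<oplus>\<^bsub>V1 V'\<^esub> ph2 \<phi> z ?x (dif V g)"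
      using c c' ph2_cyc[of z ?x "dif V g"] by (simp add: ph2.rules(6) hclosed)
    moreover have "ph2 \<phi> ?x y z = ph2 \<phi> x y z \<oplus>\<^bsub>V1 V'\<^esub> ph2 \<phi> y z (dif V f)"
      using c ph2_cyc[of "dif V f" y z] by (simp add: ph2.rules(5) hclosed)
    ultimately have exp: "ph2 \<phi> ?x ?y ?z = ph2 \<phi> x y z
        \<oplus>\<^bsub>V1 V'\<^esub> (ph1 \<phi> (act V y z f) \<ominus>\<^bsub>V1 V'\<^esub> act V' (ph0 \<phi> y) (ph0 \<phi> z) (ph1 \<phi> f))
        \<oplus>\<^bsub>V1 V'\<^esub> (ph1 \<phi> (act V z ?x g) \<ominus>\<^bsub>V1 V'\<^esub> act V' (ph0 \<phi> z) (ph0 \<phi> ?x) (ph1 \<phi> g))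
        \<oplus>\<^bsub>V1 V'\<^esub> (ph1 \<phi> (act V ?x ?y h) \<ominus>\<^bsub>V1 V'\<^esub> act V' (ph0 \<phi> ?x) (ph0 \<phi> ?y) (ph1 \<phi> h))"
      using c c' by (simp only: ph2_dif)
    have "act V' (ph0 \<phi> y) (ph0 \<phi> z) (ph1 \<phi> f) \<oplus>\<^bsub>V1 V'\<^esub> act V' (ph0 \<phi> z) (ph0 \<phi> ?x) (ph1 \<phi> g)
        \<oplus>\<^bsub>V1 V'\<^esub> act V' (ph0 \<phi> ?x) (ph0 \<phi> ?y) (ph1 \<phi> h) \<oplus>\<^bsub>V1 V'\<^esub> ph2 \<phi> ?x ?y ?z
      = ph2 \<phi> x y z \<oplus>\<^bsub>V1 V'\<^esub> (ph1 \<phi> (act V y z f) \<oplus>\<^bsub>V1 V'\<^esub> ph1 \<phi> (act V z ?x g) \<oplus>\<^bsub>V1 V'\<^esub> ph1 \<phi> (act V ?x ?y h))"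
      unfolding exp
      by (rule S'.V1.combines_unique, (rule S'.V1.combines_ops | (rule S'.V1.combines_atom, simp add: c c' hclosed))+,
        simp add: algebra_simps)
    then show ?case
      unfolding eqs using c c'
      by (simp add: hclosed ph1.add chain[symmetric] ph0.add[symmetric])
  next
    case (14 x1 x2 x3 x4 x5)
    then have x: "x1 \<in> deg0 V" "x2 \<in> deg0 V" "x3 \<in> deg0 V" "x4 \<in> deg0 V"
      "x5 \<in> deg0 V"
      by auto
    show ?case
      using red[unfolded reduced_def, THEN conjunct2, THEN conjunct2, THEN conjunct2, rule_format, OF x] x
      by (simp add: hclosed ph0.rules ph1.rules S.dif.zero S'.dif.zero S'.act.rules(2-4) S'.V1.a_assoc)
  qed
qed

end

lemma (in abelian_group) eq_minus_iff:
  assumes "a \<in> carrier G" "b \<in> carrier G" "c \<in> carrier G"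
  shows "a = b \<ominus> c \<longleftrightarrow> c \<oplus> a = b"
proof
  assume "a = b \<ominus> c"
  then show "c \<oplus> a = b"
    by (simp only:) (rule combines_unique, (rule combines_ops | (rule combines_atom, simp add: assms))+,
      simp add: algebra_simps)
next
  assume "c \<oplus> a = b"
  then have "b \<ominus> c = c \<oplus> a \<ominus> c" by simp
  also have "\<dots> = a"
    by (rule combines_unique, (rule combines_ops | (rule combines_atom, simp add: assms))+,
      simp add: algebra_simps)
  finally show "a = b \<ominus> c" ..
qed

text \<open>The left side has the shape of the homotopy equation for \<open>ph2\<close>; moving the
  subtracted terms across turns it into an equality of arrow parts of two composites.\<close>

lemma (in abelian_group) minus_eq_minus_iff:
  assumes "a \<in> carrier G" "b \<in> carrier G" "s \<in> carrier G" "t \<in> carrier G" "q \<in> carrier G"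
  shows "a \<ominus> b = s \<ominus> t \<oplus> q \<longleftrightarrow> a \<oplus> t = s \<oplus> q \<oplus> b"
proof -
  have "s \<oplus> q \<oplus> b \<ominus> t = b \<oplus> (s \<ominus> t \<oplus> q)"
    by (rule combines_unique, (rule combines_ops | (rule combines_atom, simp add: assms))+,
      simp add: algebra_simps)
  then have "a \<oplus> t = s \<oplus> q \<oplus> b \<longleftrightarrow> a = b \<oplus> (s \<ominus> t \<oplus> q)"
    using eq_minus_iff[of a "s \<oplus> q \<oplus> b" t] assms by (auto simp: a_comm)
  also have "\<dots> \<longleftrightarrow> a \<ominus> b = s \<ominus> t \<oplus> q"
    using eq_minus_iff[of "s \<ominus> t \<oplus> q" a b] assms by auto
  finally show ?thesis ..
qed

context pair_coding
begin

lemma multilinear_mapsI: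
  assumes "lie3inf_algebra K V" "lie3inf_algebra K V'" "lie3inf_hom K V V' \<phi>"
  shows "multilinear_maps K V V' code \<phi>"
proof -
  interpret lie3inf_hom K V V' \<phi> by fact
  show ?thesis
    using assms(1,2) pair_coding_axioms ph_extensional ph0_linear ph1_linear ph2_trilinear ph2_skew
    by (simp add: multilinear_maps_def multilinear_maps_axioms_def total_space_def)
qed

lemma total_hom_in:
  assumes "lie3inf_algebra K V" "lie3inf_algebra K V'" "lie3inf_hom K V V' \<phi>"
  shows "three_lie2_hom K (total V) (total V') (total_hom V V' \<phi>)"
proof -
  interpret multilinear_maps K V V' code \<phi> using assms by (rule multilinear_mapsI)
  show ?thesis using assms(3) total_hom_hom reduced_iff by simp
qed

lemma part_total_hom:
  assumes "lie3inf_algebra K V" "lie3inf_algebra K V'" "lie3inf_hom K V V' \<phi>"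
  shows "part_hom V V' (total_hom V V' \<phi>) = \<phi>"
proof -
  interpret multilinear_maps K V V' code \<phi> using assms by (rule multilinear_mapsI)
  show ?thesis
  proof (rule lie3inf_map_eqI[OF _ _ _ ph_ext])
    show "ph0 (part_hom V V' (total_hom V V' \<phi>)) \<in> extensional (deg0 V)"
      using ph_ext by simp
    show "ph1 (part_hom V V' (total_hom V V' \<phi>)) \<in> extensional (deg1 V)"
      "ph2 (part_hom V V' (total_hom V V' \<phi>)) \<in> extensional3 (V0 V)"
      by (simp_all only: part_hom_def lie3inf_map.simps restrict_extensional extensional3_restrict)
  qed simp_all
qed

text \<open>\<open>F\<close> is additive and preserves units, so \<open>fn1 F\<close> is fixed by
  \<open>fn0 F\<close> and by its values on arrows out of zero; \<open>fn2 F\<close> is fixed by its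
  sources and arrow parts. Hence \<open>F\<close> is rebuilt from its parts, and
  \<open>total_hom_reduced\<close> then yields the equations for them.\<close>

lemma
  assumes V: "lie3inf_algebra K V" and V': "lie3inf_algebra K V'"
    and F: "three_lie2_hom K (total V) (total V') F"
  shows part_hom_in: "lie3inf_hom K V V' (part_hom V V' F)"
    and total_part_hom: "total_hom V V' (part_hom V V' F) = F"
proof -
  interpret V: total_space K V code
    using V pair_coding_axioms by (simp add: total_space_def)
  interpret V': total_space K V' code
    using V' pair_coding_axioms by (simp add: total_space_def)
  interpret F: lie2_hom_between K "total V" "total V'" F
    using F V.three_lie_2_algebra_total V'.three_lie_2_algebra_total by (simp add: lie2_hom_between_def)
  let ?\<phi> = "part_hom V V' F"
  have fn0: "fn0 F x \<in> deg0 V'" if "x \<in> deg0 V" for x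
    using F.fn0.closed[of x] that by simp
  have fn1: "fn1 F u \<in> carrier (arrows (V0 V') (V1 V'))" if "u \<in> carrier (arrows (V0 V) (V1 V))" for u
    using F.fn1.closed[of u] that by simp
  have fn2: "fn2 F x y z \<in> carrier (arrows (V0 V') (V1 V'))"
    if "x \<in> deg0 V" "y \<in> deg0 V" "z \<in> deg0 V" for x y z
    using F.fn2.rules(1)[of y z x] that by simp
  have lin_pt: "linear_map K (arrows (V0 V') (V1 V')) (V1 V') pt"
    by (auto simp: linear_map_def elim!: arrowsE)
  have lin_mk: "linear_map K (V1 V) (arrows (V0 V) (V1 V)) (mk \<zero>\<^bsub>V0 V\<^esub>)"
    by (auto simp: linear_map_def)
  have fn1_mk: "fn1 F (mk x f) = mk (fn0 F x) (pt (fn1 F (mk \<zero>\<^bsub>V0 V\<^esub> f)))"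
    if xf: "x \<in> deg0 V" "f \<in> deg1 V" for x f
  proof -
    have f: "fn1 F (mk \<zero>\<^bsub>V0 V\<^esub> f) = mk \<zero>\<^bsub>V0 V'\<^esub> (pt (fn1 F (mk \<zero>\<^bsub>V0 V\<^esub> f)))" (is "_ = mk _ ?p")
      using F.fn_src[of "mk \<zero>\<^bsub>V0 V\<^esub> f"] F.fn0.zero ob_pt(3)[OF fn1[of "mk \<zero>\<^bsub>V0 V\<^esub> f"]] xf by simp
    have p: "?p \<in> deg1 V'"
      using ob_pt(2)[OF fn1[of "mk \<zero>\<^bsub>V0 V\<^esub> f"]] xf by simp
    \<comment> \<open>An arrow is the unit of its source plus an arrow out of zero.\<close>
    have "fn1 F (mk x f) = fn1 F (mk x \<zero>\<^bsub>V1 V\<^esub> \<oplus>\<^bsub>L1 (total V)\<^esub> mk \<zero>\<^bsub>V0 V\<^esub> f)"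
      using xf by simp
    also have "\<dots> = fn1 F (mk x \<zero>\<^bsub>V1 V\<^esub>) \<oplus>\<^bsub>L1 (total V')\<^esub> fn1 F (mk \<zero>\<^bsub>V0 V\<^esub> f)"
      using xf by (intro F.fn1.add) simp_all
    also have "\<dots> = mk (fn0 F x) \<zero>\<^bsub>V1 V'\<^esub> \<oplus>\<^bsub>L1 (total V')\<^esub> mk \<zero>\<^bsub>V0 V'\<^esub> ?p"
      using F.fn_unt[of x] xf f by simp
    also have "\<dots> = mk (fn0 F x) ?p"
      using xf p fn0[of x] by simp
    finally show ?thesis .
  qed
  have fn2_mk: "fn2 F x y z = mk (tri V' (fn0 F x) (fn0 F y) (fn0 F z)) (pt (fn2 F x y z))"
    if "x \<in> deg0 V" "y \<in> deg0 V" "z \<in> deg0 V" for x y z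
    using F.src_fn2[of x y z] ob_pt(3)[OF fn2[of x y z]] that by simp
  have sk: "skew3 (V0 V) (V1 V') (ph2 ?\<phi>)"
  proof (rule skew3I)
    have neg: "pt (\<ominus>\<^bsub>arrows (V0 V') (V1 V')\<^esub> u) = \<ominus>\<^bsub>V1 V'\<^esub> pt u" if "u \<in> carrier (arrows (V0 V') (V1 V'))" for u
      using that by (auto simp: V'.neg_mk elim!: arrowsE)
    fix x y z assume x: "x \<in> deg0 V" "y \<in> deg0 V" "z \<in> deg0 V"
    then show "ph2 ?\<phi> y x z = \<ominus>\<^bsub>V1 V'\<^esub> ph2 ?\<phi> x y z" "ph2 ?\<phi> x z y = \<ominus>\<^bsub>V1 V'\<^esub> ph2 ?\<phi> x y z"
      using skew3D[OF F.fn2_skew, of x y z] by (simp_all add: neg fn2)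
  qed
  have "multilinear_maps K V V' code ?\<phi>"
  proof (rule multilinear_maps.intro[OF V.total_space_axioms V'.total_space_axioms],
      rule multilinear_maps_axioms.intro)
    show "ph0 ?\<phi> \<in> extensional (deg0 V)" using F.fn_extensional(1) by simp
    show "ph1 ?\<phi> \<in> extensional (deg1 V)" "ph2 ?\<phi> \<in> extensional3 (V0 V)"
      by (simp_all only: part_hom_def lie3inf_map.simps restrict_extensional extensional3_restrict)
    show "linear_map K (V0 V) (V0 V') (ph0 ?\<phi>)" using F.fn0_linear by simp
    show "linear_map K (V1 V) (V1 V') (ph1 ?\<phi>)"
      using F.fn1_linear
      by (intro linear_map_cong[OF V.V1_module linear_map_comp[OF linear_map_comp[OF lin_mk] lin_pt], of "fn1 F"]) simp_all
    show "skew3 (V0 V) (V1 V') (ph2 ?\<phi>)" by (rule sk)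
    show "trilinear K (V0 V) (V0 V) (V0 V) (V1 V') (ph2 ?\<phi>)"
    proof (rule trilinearI_skew[OF V.V0_module V'.V1_module sk])
      fix y z assume yz: "y \<in> deg0 V" "z \<in> deg0 V"
      then have "linear_map K (V0 V) (arrows (V0 V') (V1 V')) (\<lambda>x. fn2 F x y z)"
        using F.fn2_trilinear by (simp add: trilinear_def)
      then show "linear_map K (V0 V) (V1 V') (\<lambda>x. ph2 ?\<phi> x y z)"
        by (rule linear_map_cong[OF V.V0_module linear_map_comp[OF _ lin_pt]]) (use yz in simp)
    qed
  qed
  then interpret P: multilinear_maps K V V' code ?\<phi> .
  show tp: "total_hom V V' ?\<phi> = F"
  proof -
    have "fn1 (total_hom V V' ?\<phi>) = fn1 F"
    proof (rule extensionalityI[of _ "carrier (arrows (V0 V) (V1 V))"])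
      show "fn1 (total_hom V V' ?\<phi>) \<in> extensional (carrier (arrows (V0 V) (V1 V)))"
        by (simp add: total_hom_def)
      show "fn1 F \<in> extensional (carrier (arrows (V0 V) (V1 V)))"
        using F.fn_extensional(2) by simp
      fix u assume "u \<in> carrier (arrows (V0 V) (V1 V))"
      then obtain x f where "u = mk x f" "x \<in> deg0 V" "f \<in> deg1 V"
        by (rule arrowsE)
      then show "fn1 (total_hom V V' ?\<phi>) u = fn1 F u"
        using fn1_mk[of x f] by simp
    qed
    moreover have "fn2 (total_hom V V' ?\<phi>) = fn2 F"
    proof (rule extensional3_eqI[of _ "V0 V"])
      show "fn2 (total_hom V V' ?\<phi>) \<in> extensional3 (V0 V)"
        by (simp only: total_hom_def three_lie2_map.simps extensional3_restrict)
      show "fn2 F \<in> extensional3 (V0 V)" using F.fn_extensional(3) by simp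
    qed (simp add: fn2_mk[symmetric])
    ultimately show ?thesis by simp
  qed
  show "lie3inf_hom K V V' ?\<phi>"
    using P.total_hom_reduced F P.reduced_iff tp by simp
qed

section \<open>Chain homotopies as natural transformations\<close>

definition total_cell :: "('k, 'u) lie3inf \<Rightarrow> 'u lie3inf_map \<Rightarrow> ('u \<Rightarrow> 'u) \<Rightarrow> 'u \<Rightarrow> 'u" where
  "total_cell V \<phi> \<tau> = (\<lambda>x\<in>deg0 V. mk (ph0 \<phi> x) (\<tau> x))"

definition part_cell :: "('k, 'u) lie3inf \<Rightarrow> ('u \<Rightarrow> 'u) \<Rightarrow> 'u \<Rightarrow> 'u" where
  "part_cell V \<theta> = (\<lambda>x\<in>deg0 V. pt (\<theta> x))"

lemma cell_simps [simp]:
  "x \<in> deg0 V \<Longrightarrow> total_cell V \<phi> \<tau> x = mk (ph0 \<phi> x) (\<tau> x)"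
  "x \<in> deg0 V \<Longrightarrow> part_cell V \<theta> x = pt (\<theta> x)"
  by (simp_all add: total_cell_def part_cell_def)

end

context total_space
begin

text \<open>The arrow part of a bracket of three arrows, expanded into the terms of the homotopy
  equation: six cyclic ones and a cubic one. \<open>act_dif\<close> turns
  \<open>act V (dif V f) y h\<close> into the cyclic term
  \<open>act V y (dif V h) f\<close>.\<close>

lemma act_sum:
  assumes "x \<in> deg0 V" "y \<in> deg0 V" "z \<in> deg0 V"
    "f \<in> deg1 V" "g \<in> deg1 V" "h \<in> deg1 V"
  shows "act V y z f \<oplus>\<^bsub>V1 V\<^esub> act V z (x \<oplus>\<^bsub>V0 V\<^esub> dif V f) g \<oplus>\<^bsub>V1 V\<^esub> act V (x \<oplus>\<^bsub>V0 V\<^esub> dif V f) (y \<oplus>\<^bsub>V0 V\<^esub> dif V g) h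
    = (act V x y h \<oplus>\<^bsub>V1 V\<^esub> act V z (dif V f) g \<oplus>\<^bsub>V1 V\<^esub> act V y z f \<oplus>\<^bsub>V1 V\<^esub> act V x (dif V g) h
        \<oplus>\<^bsub>V1 V\<^esub> act V z x g \<oplus>\<^bsub>V1 V\<^esub> act V y (dif V h) f) \<oplus>\<^bsub>V1 V\<^esub> act V (dif V f) (dif V g) h"
proof -
  have 1: "act V z (x \<oplus>\<^bsub>V0 V\<^esub> dif V f) g = act V z x g \<oplus>\<^bsub>V1 V\<^esub> act V z (dif V f) g"
    using assms by (simp add: act.rules closed)
  have 2: "act V (x \<oplus>\<^bsub>V0 V\<^esub> dif V f) (y \<oplus>\<^bsub>V0 V\<^esub> dif V g) h
    = act V x y h \<oplus>\<^bsub>V1 V\<^esub> act V y (dif V h) f \<oplus>\<^bsub>V1 V\<^esub> (act V x (dif V g) h \<oplus>\<^bsub>V1 V\<^esub> act V (dif V f) (dif V g) h)"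
    unfolding act_dif[OF assms(2,6,4)] using assms by (simp add: act.rules closed)
  show ?thesis
    unfolding 1 2
    by (rule V1.combines_unique, (rule V1.combines_ops | (rule V1.combines_atom, simp add: assms closed))+,
      simp add: algebra_simps)
qed

end

context pair_coding
begin

text \<open>The equations of a homotopy say, up to moving terms across, that components have the
  right targets, that they are natural, and that they satisfy the bracket law. In naturality the
  source object drops out by additivity, leaving arrows out of zero.\<close>

lemma total_cell_iff:
  assumes V: "lie3inf_algebra K V" "lie3inf_algebra K V'" "lie3inf_hom K V V' \<phi>" "lie3inf_hom K V V' \<psi>"
    and ext: "\<tau> \<in> extensional (deg0 V)" and lin: "linear_map K (V0 V) (V1 V') \<tau>"
  shows "three_lie2_2hom K (total V) (total V') (total_hom V V' \<phi>) (total_hom V V' \<psi>) (total_cell V \<phi> \<tau>)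
    \<longleftrightarrow> lie3inf_2hom K V V' \<phi> \<psi> \<tau>"
proof -
  interpret P: multilinear_maps K V V' code \<phi> using V(1,2,3) by (rule multilinear_mapsI)
  interpret Q: multilinear_maps K V V' code \<psi> using V(1,2,4) by (rule multilinear_mapsI)
  interpret phi: lie3inf_hom K V V' \<phi> by fact
  interpret psi: lie3inf_hom K V V' \<psi> by fact
  interpret tau: linear_between K "V0 V" "V1 V'" \<tau> by standard (rule lin)
  note closed = P.hclosed Q.hclosed tau.closed
  have dif_eq: "dif V' (\<tau> x) = ph0 \<psi> x \<ominus>\<^bsub>V0 V'\<^esub> ph0 \<phi> x \<longleftrightarrow> ph0 \<phi> x \<oplus>\<^bsub>V0 V'\<^esub> dif V' (\<tau> x) = ph0 \<psi> x"
    if "x \<in> deg0 V" for x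
    using that by (intro P.S'.V0.eq_minus_iff) (simp_all add: closed)
  have tau_eq: "\<tau> (dif V f) = ph1 \<psi> f \<ominus>\<^bsub>V1 V'\<^esub> ph1 \<phi> f \<longleftrightarrow> ph1 \<phi> f \<oplus>\<^bsub>V1 V'\<^esub> \<tau> (dif V f) = ph1 \<psi> f"
    if "f \<in> deg1 V" for f
    using that by (intro P.S'.V1.eq_minus_iff) (simp_all add: closed)
  have ph2_eq: "ph2 \<phi> x1 x2 x3 \<ominus>\<^bsub>V1 V'\<^esub> ph2 \<psi> x1 x2 x3
         = (l3 V' 0 0 1 (ph0 \<phi> x1) (ph0 \<phi> x2) (\<tau> x3)
             \<oplus>\<^bsub>V1 V'\<^esub> l3 V' 0 1 0 (dif V' (\<tau> x1)) (\<tau> x2) (ph0 \<phi> x3)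
             \<oplus>\<^bsub>V1 V'\<^esub> l3 V' 0 0 1 (ph0 \<phi> x2) (ph0 \<phi> x3) (\<tau> x1)
             \<oplus>\<^bsub>V1 V'\<^esub> l3 V' 0 1 0 (dif V' (\<tau> x2)) (\<tau> x3) (ph0 \<phi> x1)
             \<oplus>\<^bsub>V1 V'\<^esub> l3 V' 0 0 1 (ph0 \<phi> x3) (ph0 \<phi> x1) (\<tau> x2)
             \<oplus>\<^bsub>V1 V'\<^esub> l3 V' 0 1 0 (dif V' (\<tau> x3)) (\<tau> x1) (ph0 \<phi> x2))
           \<ominus>\<^bsub>V1 V'\<^esub> \<tau> (l3 V 0 0 0 x1 x2 x3)
           \<oplus>\<^bsub>V1 V'\<^esub> l3 V' 0 0 1 (dif V' (\<tau> x1)) (dif V' (\<tau> x2)) (\<tau> x3)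
    \<longleftrightarrow> ph2 \<phi> x1 x2 x3 \<oplus>\<^bsub>V1 V'\<^esub> \<tau> (tri V x1 x2 x3)
      = act V' (ph0 \<phi> x2) (ph0 \<phi> x3) (\<tau> x1)
        \<oplus>\<^bsub>V1 V'\<^esub> act V' (ph0 \<phi> x3) (ph0 \<phi> x1 \<oplus>\<^bsub>V0 V'\<^esub> dif V' (\<tau> x1)) (\<tau> x2)
        \<oplus>\<^bsub>V1 V'\<^esub> act V' (ph0 \<phi> x1 \<oplus>\<^bsub>V0 V'\<^esub> dif V' (\<tau> x1)) (ph0 \<phi> x2 \<oplus>\<^bsub>V0 V'\<^esub> dif V' (\<tau> x2)) (\<tau> x3)
        \<oplus>\<^bsub>V1 V'\<^esub> ph2 \<psi> x1 x2 x3"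
    if x: "x1 \<in> deg0 V" "x2 \<in> deg0 V" "x3 \<in> deg0 V" for x1 x2 x3
    using x
    by (simp only: P.S'.act_sum P.S.l3_eqs P.S'.l3_eqs closed)
      (rule P.S'.V1.minus_eq_minus_iff; simp only: closed P.S'.V1.a_closed)
  show ?thesis
  proof
    assume "lie3inf_2hom K V V' \<phi> \<psi> \<tau>"
    then interpret T: lie3inf_2hom K V V' \<phi> \<psi> \<tau> .
    have h1: "ph0 \<phi> x \<oplus>\<^bsub>V0 V'\<^esub> dif V' (\<tau> x) = ph0 \<psi> x" if "x \<in> deg0 V" for x
      using T.dif_homotopy that dif_eq by simp
    have h2: "ph1 \<phi> f \<oplus>\<^bsub>V1 V'\<^esub> \<tau> (dif V f) = ph1 \<psi> f" if "f \<in> deg1 V" for f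
      using T.homotopy_dif that tau_eq by simp
    show "three_lie2_2hom K (total V) (total V') (total_hom V V' \<phi>) (total_hom V V' \<psi>) (total_cell V \<phi> \<tau>)"
    proof (rule three_lie2_2hom.intro, goal_cases)
      case 1 show ?case by (simp add: total_cell_def)
    next
      case 2 show ?case by (auto simp: linear_map_def closed P.ph0.rules tau.rules)
    next
      case (3 x) then show ?case by (simp add: arr_def closed h1)
    next
      case (4 u)
      then obtain x f where u: "u = mk x f" and x: "x \<in> deg0 V" "f \<in> deg1 V"
        by (auto elim!: arrowsE)
      have "ph1 \<phi> f \<oplus>\<^bsub>V1 V'\<^esub> \<tau> (x \<oplus>\<^bsub>V0 V\<^esub> dif V f) = \<tau> x \<oplus>\<^bsub>V1 V'\<^esub> (ph1 \<phi> f \<oplus>\<^bsub>V1 V'\<^esub> \<tau> (dif V f))"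
        using x by (simp add: closed tau.add P.S'.V1.a_ac)
      then show ?case
        unfolding u using x by (simp add: closed h2)
    next
      case (5 x y z)
      then show ?case
        using T.homotopy_ph2[of x y z] ph2_eq[of x y z] by (simp add: closed)
    qed
  next
    assume "three_lie2_2hom K (total V) (total V') (total_hom V V' \<phi>) (total_hom V V' \<psi>) (total_cell V \<phi> \<tau>)"
    then interpret T: three_lie2_2hom K "total V" "total V'" "total_hom V V' \<phi>" "total_hom V V' \<psi>" "total_cell V \<phi> \<tau>" .
    show "lie3inf_2hom K V V' \<phi> \<psi> \<tau>"
    proof (rule lie3inf_2hom.intro[OF ext lin], goal_cases)
      case (1 x)
      then show ?case using T.component[of x] dif_eq[of x] by (simp add: arr_def closed)
    next
      case (2 f)
      then show ?case
        using T.natural[of "mk \<zero>\<^bsub>V0 V\<^esub> f"] tau_eq[of f] by (simp add: closed tau.zero)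
    next
      case (3 x1 x2 x3)
      then show ?case
        using T.bracket[of x1 x2 x3] ph2_eq[of x1 x2 x3] by (simp add: closed)
    qed
  qed
qed

end

context pair_coding
begin

text \<open>The source of each component is prescribed by \<phi>, so arrow parts determine \<theta>;
  the equations then come from \<open>total_cell_iff\<close>.\<close>

lemma
  assumes V: "lie3inf_algebra K V" "lie3inf_algebra K V'" "lie3inf_hom K V V' \<phi>" "lie3inf_hom K V V' \<psi>"
    and \<theta>: "three_lie2_2hom K (total V) (total V') (total_hom V V' \<phi>) (total_hom V V' \<psi>) \<theta>"
  shows part_cell_in: "lie3inf_2hom K V V' \<phi> \<psi> (part_cell V \<theta>)"
    and total_part_cell: "total_cell V \<phi> (part_cell V \<theta>) = \<theta>"
proof -
  interpret P: multilinear_maps K V V' code \<phi> using V(1,2,3) by (rule multilinear_mapsI)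
  interpret T: three_lie2_2hom K "total V" "total V'" "total_hom V V' \<phi>" "total_hom V V' \<psi>" \<theta> by fact
  have lin_pt: "linear_map K (arrows (V0 V') (V1 V')) (V1 V') pt"
    by (auto simp: linear_map_def elim!: arrowsE)
  have \<theta>_eq: "mk (ph0 \<phi> x) (pt (\<theta> x)) = \<theta> x" if "x \<in> deg0 V" for x
    using T.component[of x] ob_pt(3)[of "\<theta> x" "V0 V'" "V1 V'"] that by (simp add: arr_def)
  show eq: "total_cell V \<phi> (part_cell V \<theta>) = \<theta>"
  proof (rule extensionalityI[of _ "deg0 V"])
    show "\<theta> \<in> extensional (deg0 V)" using T.extensional by simp
  qed (simp_all add: total_cell_def \<theta>_eq)
  have "linear_map K (V0 V) (V1 V') (part_cell V \<theta>)"
    using T.linear by (intro linear_map_cong[OF P.S.V0_module linear_map_comp[OF _ lin_pt], of \<theta>]) simp_all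
  moreover have "part_cell V \<theta> \<in> extensional (deg0 V)"
    by (simp add: part_cell_def)
  ultimately show "lie3inf_2hom K V V' \<phi> \<psi> (part_cell V \<theta>)"
    using total_cell_iff[OF V, of "part_cell V \<theta>"] \<theta> eq by simp
qed

lemma
  assumes V: "lie3inf_algebra K V" "lie3inf_algebra K V'" "lie3inf_hom K V V' \<phi>" "lie3inf_hom K V V' \<psi>"
    and \<tau>: "lie3inf_2hom K V V' \<phi> \<psi> \<tau>"
  shows total_cell_in: "three_lie2_2hom K (total V) (total V') (total_hom V V' \<phi>) (total_hom V V' \<psi>) (total_cell V \<phi> \<tau>)"
    and part_total_cell: "part_cell V (total_cell V \<phi> \<tau>) = \<tau>"
proof -
  interpret lie3inf_2hom K V V' \<phi> \<psi> \<tau> by fact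
  show "three_lie2_2hom K (total V) (total V') (total_hom V V' \<phi>) (total_hom V V' \<psi>) (total_cell V \<phi> \<tau>)"
    using total_cell_iff[OF V extensional linear] \<tau> by simp
  show "part_cell V (total_cell V \<phi> \<tau>) = \<tau>"
    by (rule extensionalityI[OF _ extensional]) (simp_all add: part_cell_def)
qed

text \<open>Composing arrows adds arrow parts, which produces the sum in \<open>ph2\<close> of a
  composite.\<close>

lemma lie3inf_comp_eq:
  assumes V: "lie3inf_algebra K V" "lie3inf_algebra K V'" "lie3inf_algebra K V''"
    "lie3inf_hom K V V' \<phi>" "lie3inf_hom K V' V'' \<psi>"
  shows "lie3inf_comp V V' V'' \<psi> \<phi> = part_hom V V''
    (three_lie2_comp (total V) (total V') (total V'') (total_hom V' V'' \<psi>) (total_hom V V' \<phi>))"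
    (is "?l = ?r")
proof -
  interpret P: multilinear_maps K V V' code \<phi> using V(1,2,4) by (rule multilinear_mapsI)
  interpret Q: multilinear_maps K V' V'' code \<psi> using V(2,3,5) by (rule multilinear_mapsI)
  show ?thesis
  proof (rule lie3inf_map_eqI[of _ V])
    show "ph0 ?l \<in> extensional (deg0 V)" "ph1 ?l \<in> extensional (deg1 V)"
      "ph2 ?l \<in> extensional3 (V0 V)" "ph0 ?r \<in> extensional (deg0 V)"
      "ph1 ?r \<in> extensional (deg1 V)" "ph2 ?r \<in> extensional3 (V0 V)"
      by (simp_all only: lie3inf_comp_def part_hom_def three_lie2_comp_def lie3inf_map.simps three_lie2_map.simps
          total_simps restrict_extensional extensional3_restrict)
  qed (simp_all add: lie3inf_comp_def three_lie2_comp_simps P.hclosed Q.hclosed)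
qed

lemma lie3inf_id_eq:
  assumes "lie3inf_algebra K V"
  shows "lie3inf_id V = part_hom V V (three_lie2_id (total V))" (is "?l = ?r")
proof -
  interpret total_space K V code using assms pair_coding_axioms by (simp add: total_space_def)
  show ?thesis
  proof (rule lie3inf_map_eqI[of _ V])
    show "ph0 ?l \<in> extensional (deg0 V)" "ph1 ?l \<in> extensional (deg1 V)"
      "ph2 ?l \<in> extensional3 (V0 V)" "ph0 ?r \<in> extensional (deg0 V)"
      "ph1 ?r \<in> extensional (deg1 V)" "ph2 ?r \<in> extensional3 (V0 V)"
      by (simp_all only: lie3inf_id_def part_hom_def three_lie2_id_def lie3inf_map.simps three_lie2_map.simps
          total_simps restrict_extensional extensional3_restrict)
  qed (simp_all add: lie3inf_id_def three_lie2_id_simps closed)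
qed

definition T :: "(('k, 'u) lie3inf, 'u lie3inf_map, 'u \<Rightarrow> 'u,
    ('k, 'u) three_lie2, 'u three_lie2_map, 'u \<Rightarrow> 'u) two_fun" where
  "T = \<lparr>on_obj = total, on_hom = total_hom, on_cell = \<lambda>V V' \<phi> \<psi>. total_cell V \<phi>\<rparr>"

lemma T_simps [simp]: "on_obj T = total" "on_hom T = total_hom" "on_cell T V V' \<phi> \<psi> = total_cell V \<phi>"
  by (simp_all add: T_def)

lemma TwoTerm3LieInf_simps:
  "Obj (TwoTerm3LieInf K) = {V. lie3inf_algebra K V}"
  "Hom (TwoTerm3LieInf K) V V' = {\<phi>. lie3inf_hom K V V' \<phi>}"
  "Cell (TwoTerm3LieInf K) V V' \<phi> \<psi> = {\<tau>. lie3inf_2hom K V V' \<phi> \<psi> \<tau>}"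
  "id1 (TwoTerm3LieInf K) = lie3inf_id"
  "comp1 (TwoTerm3LieInf K) = lie3inf_comp"
  "id2 (TwoTerm3LieInf K) V V' \<phi> = (\<lambda>x\<in>deg0 V. \<zero>\<^bsub>V1 V'\<^esub>)"
  "vcomp (TwoTerm3LieInf K) V V' \<phi> \<psi> \<mu> \<tau>' \<tau> = (\<lambda>x\<in>deg0 V. \<tau>' x \<oplus>\<^bsub>V1 V'\<^esub> \<tau> x)"
  "hcomp (TwoTerm3LieInf K) V V' V'' \<phi> \<psi> \<phi>' \<psi>' \<tau>' \<tau>
    = (\<lambda>x\<in>deg0 V. \<tau>' (ph0 \<phi> x) \<oplus>\<^bsub>V1 V''\<^esub> ph1 \<psi>' (\<tau> x))"
  by (simp_all add: TwoTerm3LieInf_def)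

lemma local_iso_T:
  "local_iso (TwoTerm3LieInf K) (ThreeLie2Alg K) T part_hom (\<lambda>V V' \<phi> \<psi>. part_cell V)"
proof (rule local_iso.intro[OF two_category_ThreeLie2Alg], rule local_iso_axioms.intro,
    unfold TwoTerm3LieInf_simps ThreeLie2Alg_simps T_simps mem_Collect_eq, goal_cases)
  case (1 V)
  then interpret total_space K V code using pair_coding_axioms by (simp add: total_space_def)
  show ?case by (rule three_lie_2_algebra_total)
next
  case 2 then show ?case by (rule total_hom_in)
next
  case 3 then show ?case by (rule part_hom_in)
next
  case 4 then show ?case by (rule part_total_hom)
next
  case 5 then show ?case by (rule total_part_hom)
next
  case 6 then show ?case by (rule total_cell_in)
next
  case 7 then show ?case by (rule part_cell_in)
next
  case 8 then show ?case by (rule part_total_cell)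
next
  case 9 then show ?case by (rule total_part_cell)
next
  case 10 then show ?case by (rule lie3inf_id_eq)
next
  case 11 then show ?case by (rule lie3inf_comp_eq)
next
  case (12 V V' \<phi>)
  then interpret P: multilinear_maps K V V' code \<phi> by (rule multilinear_mapsI)
  show ?case by (rule extensionalityI[OF restrict_extensional]) (simp_all add: part_cell_def P.hclosed)
next
  case (13 V V' \<phi> \<psi> \<mu> \<alpha> \<beta>)
  interpret P: multilinear_maps K V V' code \<phi> using 13(1,2,3) by (rule multilinear_mapsI)
  interpret a: lie3inf_2hom K V V' \<phi> \<psi> \<alpha> using 13 by simp
  interpret b: lie3inf_2hom K V V' \<psi> \<mu> \<beta> using 13 by simp
  \<comment> \<open>The summands come in opposite order because \<open>seq\<close> is
    diagrammatic.\<close>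
  show ?case
    by (rule extensionalityI[OF restrict_extensional])
      (simp_all add: part_cell_def P.S'.V1.a_comm linear_map_closed[OF a.linear] linear_map_closed[OF b.linear])
next
  case (14 V V' V'' \<phi> \<psi> \<phi>' \<psi>' \<alpha> \<beta>)
  interpret P: multilinear_maps K V V' code \<phi> using 14(1,2,4) by (rule multilinear_mapsI)
  interpret Q: multilinear_maps K V V' code \<psi> using 14(1,2,5) by (rule multilinear_mapsI)
  interpret a: lie3inf_2hom K V V' \<phi> \<psi> \<alpha> using 14 by simp
  show ?case
    by (rule extensionalityI[OF restrict_extensional])
      (simp_all add: part_cell_def P.hclosed Q.hclosed linear_map_closed[OF a.linear])
qed

end

text \<open>Solves a naturality equation for the Jacobiator term \<open>j\<close>, with the summands
  in the order of \<open>ax_e\<close> and \<open>ax_f\<close>.\<close>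

lemma (in abelian_group) solve_sum:
  assumes "n \<oplus> j = m1 \<oplus> m2 \<oplus> m3"
    and "n \<in> carrier G" "j \<in> carrier G" "m1 \<in> carrier G" "m2 \<in> carrier G" "m3 \<in> carrier G"
  shows "j = \<ominus> n \<oplus> m2 \<oplus> m1 \<oplus> m3"
proof -
  have "\<ominus> n \<oplus> m2 \<oplus> m1 \<oplus> m3 = \<ominus> n \<oplus> (m1 \<oplus> m2 \<oplus> m3)"
    using assms(2-) by (simp add: a_ac)
  also have "\<dots> = j"
    unfolding assms(1)[symmetric] using assms(2,3) by (simp add: r_neg1)
  finally show ?thesis ..
qed

section \<open>Strict homomorphisms\<close>

text \<open>Meant for functors that preserve the bracket on the nose, so that the structure
  transformation consists of units.\<close>

definition strict_map :: "('k, 'u) three_lie2 \<Rightarrow> ('k, 'u) three_lie2 \<Rightarrow> ('u \<Rightarrow> 'u) \<Rightarrow> ('u \<Rightarrow> 'u) \<Rightarrow> 'u three_lie2_map" where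
  "strict_map L L' g0 g1 = \<lparr>fn0 = restrict g0 (Ob L), fn1 = restrict g1 (Ar L),
    fn2 = \<lambda>x\<in>Ob L. \<lambda>y\<in>Ob L. \<lambda>z\<in>Ob L. unt L' (g0 (br0 L x y z))\<rparr>"

lemma strict_map_simps [simp]:
  "x \<in> Ob L \<Longrightarrow> fn0 (strict_map L L' g0 g1) x = g0 x"
  "f \<in> Ar L \<Longrightarrow> fn1 (strict_map L L' g0 g1) f = g1 f"
  "\<lbrakk>x \<in> Ob L; y \<in> Ob L; z \<in> Ob L\<rbrakk>
    \<Longrightarrow> fn2 (strict_map L L' g0 g1) x y z = unt L' (g0 (br0 L x y z))"
  by (simp_all add: strict_map_def)

locale strict_hom = S: three_lie_2_algebra K L + S': three_lie_2_algebra K L'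
  for K :: "('k, 'r) ring_scheme" and L L' :: "('k, 'u) three_lie2" +
  fixes g0 g1
  assumes g0_lin: "linear_map K (L0 L) (L0 L') g0" and g1_lin: "linear_map K (L1 L) (L1 L') g1"
    and src_g1: "f \<in> Ar L \<Longrightarrow> src L' (g1 f) = g0 (src L f)"
    and tgt_g1: "f \<in> Ar L \<Longrightarrow> tgt L' (g1 f) = g0 (tgt L f)"
    and g1_unt: "x \<in> Ob L \<Longrightarrow> g1 (unt L x) = unt L' (g0 x)"
    and g0_br0: "\<lbrakk>x \<in> Ob L; y \<in> Ob L; z \<in> Ob L\<rbrakk>
      \<Longrightarrow> g0 (br0 L x y z) = br0 L' (g0 x) (g0 y) (g0 z)"
    and g1_br1: "\<lbrakk>f \<in> Ar L; g \<in> Ar L; h \<in> Ar L\<rbrakk>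
      \<Longrightarrow> g1 (br1 L f g h) = br1 L' (g1 f) (g1 g) (g1 h)"
    and g1_Jac: "{x1, x2, x3, x4, x5} \<subseteq> Ob L
      \<Longrightarrow> g1 (Jac L x1 x2 x3 x4 x5) = Jac L' (g0 x1) (g0 x2) (g0 x3) (g0 x4) (g0 x5)"
begin

sublocale g0: linear_between K "L0 L" "L0 L'" g0 by standard (rule g0_lin)
sublocale g1: linear_between K "L1 L" "L1 L'" g1 by standard (rule g1_lin)

text \<open>Preservation of composition is automatic, since \<open>seq_eq\<close> expresses a
  composite through sums and units.\<close>

lemma g1_seq:
  assumes "f \<in> Ar L" "g \<in> Ar L" "tgt L f = src L g"
  shows "g1 (seq L f g) = seq L' (g1 f) (g1 g)"
  using assms by (simp add: S.seq_eq S'.seq_eq g1.rules S.struct_rules src_g1 tgt_g1 g1_unt)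

lemma strict_map_hom: "three_lie2_hom K L L' (strict_map L L' g0 g1)"
proof -
  note rules = S.lie2_rules S'.lie2_rules g0.closed g1.closed src_g1 tgt_g1
  have sk: "skew3 (L0 L) (L1 L') (fn2 (strict_map L L' g0 g1))"
  proof (rule skew3I)
    fix x y z assume x: "x \<in> Ob L" "y \<in> Ob L" "z \<in> Ob L"
    then show "fn2 (strict_map L L' g0 g1) y x z = \<ominus>\<^bsub>L1 L'\<^esub> fn2 (strict_map L L' g0 g1) x y z"
      "fn2 (strict_map L L' g0 g1) x z y = \<ominus>\<^bsub>L1 L'\<^esub> fn2 (strict_map L L' g0 g1) x y z"
      using skew3D[OF S.br0_skew x] by (simp_all add: rules g0.neg)
  qed
  show ?thesis
  proof (rule three_lie2_hom.intro, goal_cases)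
    case 3 show ?case by (simp only: strict_map_def three_lie2_map.simps extensional3_restrict)
  next
    case 4 show ?case using g0_lin by (rule linear_map_cong[OF S.L0_module]) simp
  next
    case 5 show ?case using g1_lin by (rule linear_map_cong[OF S.L1_module]) simp
  next
    case 10
    show ?case
      by (rule trilinearI_skew[OF S.L0_module S'.L1_module sk])
        (auto simp: linear_map_def rules g0.rules S.br0.rules)
  next
    case 11 show ?case by (rule sk)
  next
    case (13 f g h)
    then show ?case by (simp add: rules g0_br0 g1_br1 S'.unt_seq' S'.seq_unt')
  next
    case (14 x1 x2 x3 x4 x5)
    then have x: "x1 \<in> Ob L" "x2 \<in> Ob L" "x3 \<in> Ob L" "x4 \<in> Ob L"
      "x5 \<in> Ob L"
      by auto
    let ?J = "Jac L' (g0 x1) (g0 x2) (g0 x3) (g0 x4) (g0 x5)"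
    have "seq L' (seq L' ?J (unt L' (tgt L' ?J))) (unt L' (tgt L' ?J))
      = seq L' (seq L' (unt L' (src L' ?J)) (unt L' (src L' ?J))) ?J"
      using x S'.Jac.rules(1)[of "g0 x2" "g0 x3" "g0 x4" "g0 x5" "g0 x1"]
      by (simp add: S'.unt_seq' S'.seq_unt' S'.src.closed S'.tgt.closed S'.src_unt S'.unt.closed g0.closed)
    with x show ?case
      by (simp add: rules S'.br1_unt g0_br0 g1_Jac)
  qed (auto simp: strict_map_def rules arr_def composable_def g1_unt g1_seq g0_br0)
qed

end

lemma strict_map_inverse:
  assumes G: "strict_hom K L L' g0 g1" and H: "strict_hom K L' L h0 h1"
    and "\<And>x. x \<in> Ob L \<Longrightarrow> h0 (g0 x) = x" "\<And>f. f \<in> Ar L \<Longrightarrow> h1 (g1 f) = f"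
  shows "three_lie2_comp L L' L (strict_map L' L h0 h1) (strict_map L L' g0 g1) = three_lie2_id L"
proof -
  interpret G: strict_hom K L L' g0 g1 by fact
  interpret H: strict_hom K L' L h0 h1 by fact
  have "three_lie2_hom K L L (three_lie2_comp L L' L (strict_map L' L h0 h1) (strict_map L L' g0 g1))"
    using three_lie2_comp_hom G.S.three_lie_2_algebra_axioms G.S'.three_lie_2_algebra_axioms
      G.strict_map_hom H.strict_map_hom by blast
  moreover have "three_lie2_hom K L L (three_lie2_id L)"
    using G.S.three_lie_2_algebra_axioms by (rule three_lie2_id_hom)
  ultimately show ?thesis
  proof (rule three_lie2_map_eqI)
    fix x y z assume x: "x \<in> Ob L" "y \<in> Ob L" "z \<in> Ob L"
    then have "h0 (br0 L' (g0 x) (g0 y) (g0 z)) = br0 L x y z"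
      using assms(3) by (simp add: G.g0_br0[symmetric] G.S.br0.rules(1))
    with x show "fn2 (three_lie2_comp L L' L (strict_map L' L h0 h1) (strict_map L L' g0 g1)) x y z
      = fn2 (three_lie2_id L) x y z"
      by (simp add: three_lie2_comp_simps three_lie2_id_simps G.g0.closed G.S.lie2_rules G.S'.lie2_rules H.g1_unt
          assms(3) G.S.seq_unt')
  qed (simp_all add: three_lie2_comp_simps three_lie2_id_simps G.g0.closed G.g1.closed assms(3,4))
qed

section \<open>The complex of a 3-Lie 2-algebra\<close>

text \<open>Only the carrier changes, so sums and scalar multiples in the kernel are literally those
  of arrows.\<close>

definition src_kernel :: "('k, 'u) three_lie2 \<Rightarrow> ('k, 'u) module" where
  "src_kernel L = (L1 L)\<lparr>carrier := {f \<in> Ar L. src L f = \<zero>\<^bsub>L0 L\<^esub>}\<rparr>"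

lemma src_kernel_simps [simp]:
  "f \<in> carrier (src_kernel L) \<longleftrightarrow> f \<in> Ar L \<and> src L f = \<zero>\<^bsub>L0 L\<^esub>"
  "\<zero>\<^bsub>src_kernel L\<^esub> = \<zero>\<^bsub>L1 L\<^esub>" "f \<oplus>\<^bsub>src_kernel L\<^esub> g = f \<oplus>\<^bsub>L1 L\<^esub> g" "a \<odot>\<^bsub>src_kernel L\<^esub> f = a \<odot>\<^bsub>L1 L\<^esub> f"
  by (simp_all add: src_kernel_def)

definition part :: "('k, 'u) three_lie2 \<Rightarrow> 'u \<Rightarrow> 'u" where
  "part L f = f \<ominus>\<^bsub>L1 L\<^esub> unt L (src L f)"

definition lift :: "('k, 'u) three_lie2 \<Rightarrow> nat \<Rightarrow> 'u \<Rightarrow> 'u" where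
  "lift L i x = (if i = 0 then unt L x else x)"

text \<open>The three components of total degree one share the bracket of arrows, objects entering
  through their units; their skew-symmetry is thus that of \<open>br1\<close>. The last branch is
  the zero demanded by \<open>ax_b\<close>.\<close>

definition core :: "('k, 'u) three_lie2 \<Rightarrow> ('k, 'u) lie3inf" where
  "core L = \<lparr>V0 = L0 L, V1 = src_kernel L, dif = tgt L,
    l3 = \<lambda>i j k x y z. if i + j + k = 0 then br0 L x y z
      else if i + j + k = 1 then br1 L (lift L i x) (lift L j y) (lift L k z) else \<zero>\<^bsub>L1 L\<^esub>,
    l5 = \<lambda>x1 x2 x3 x4 x5. part L (Jac L x1 x2 x3 x4 x5)\<rparr>"

lemma core_simps [simp]:
  "V0 (core L) = L0 L" "V1 (core L) = src_kernel L" "dif (core L) = tgt L"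
  "l5 (core L) x1 x2 x3 x4 x5 = part L (Jac L x1 x2 x3 x4 x5)"
  "l3 (core L) 0 0 0 = br0 L"
  "l3 (core L) 1 0 0 f y z = br1 L f (unt L y) (unt L z)"
  "l3 (core L) 0 1 0 x f z = br1 L (unt L x) f (unt L z)"
  "l3 (core L) 0 0 1 x y f = br1 L (unt L x) (unt L y) f"
  "l3 (core L) (Suc 0) 0 0 f y z = br1 L f (unt L y) (unt L z)"
  "l3 (core L) 0 (Suc 0) 0 x f z = br1 L (unt L x) f (unt L z)"
  "l3 (core L) 0 0 (Suc 0) x y f = br1 L (unt L x) (unt L y) f"
  by (simp_all add: core_def lift_def)

section \<open>The kernel complex as a 2-term 3-Lie-infinity algebra\<close>

context three_lie_2_algebra
begin

lemma src_kernel_module: "module K (src_kernel L)"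
proof (rule moduleI)
  show "cring K" by (rule L0.R.is_cring)
  show "abelian_group (src_kernel L)"
  proof (rule abelian_groupI)
    fix f assume "f \<in> carrier (src_kernel L)"
    then show "\<exists>g\<in>carrier (src_kernel L). g \<oplus>\<^bsub>src_kernel L\<^esub> f = \<zero>\<^bsub>src_kernel L\<^esub>"
      by (intro bexI[of _ "\<ominus>\<^bsub>L1 L\<^esub> f"]) (simp_all add: src.rules L1.l_neg)
  qed (auto simp: src.rules L1.a_ac)
qed (auto simp: src.rules L1.smult_l_distr L1.smult_r_distr L1.smult_assoc1)

text \<open>Negatives are defined by a description over the carrier, so those of the kernel have to
  be compared with those of \<open>L1 L\<close>.\<close>

lemma src_kernel_neg: "f \<in> carrier (src_kernel L) \<Longrightarrow> \<ominus>\<^bsub>src_kernel L\<^esub> f = \<ominus>\<^bsub>L1 L\<^esub> f"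
proof -
  interpret ker: module K "src_kernel L" by (rule src_kernel_module)
  assume "f \<in> carrier (src_kernel L)"
  then show ?thesis by (intro ker.minus_equality) (simp_all add: src.rules L1.l_neg)
qed

sublocale part: linear_between K "L1 L" "L1 L" "part L"
  by standard (auto simp: linear_map_def part_def src.rules unt.rules L1.minus_eq L1.minus_add L1.a_ac
      L1.smult_r_distr L1.smult_r_minus)

lemma src_part: "f \<in> Ar L \<Longrightarrow> src L (part L f) = \<zero>\<^bsub>L0 L\<^esub>"
  by (simp add: part_def struct_rules L0.minus_eq L0.r_neg)

lemma tgt_part: "f \<in> Ar L \<Longrightarrow> tgt L (part L f) = tgt L f \<ominus>\<^bsub>L0 L\<^esub> src L f"
  by (simp add: part_def struct_rules)

lemma part_unt: "x \<in> Ob L \<Longrightarrow> part L (\<iota> x) = \<zero>\<^bsub>L1 L\<^esub>"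
  by (simp add: part_def struct_rules L1.minus_eq L1.r_neg)

lemma part_src_kernel: "\<lbrakk>f \<in> Ar L; src L f = \<zero>\<^bsub>L0 L\<^esub>\<rbrakk> \<Longrightarrow> part L f = f"
  by (simp add: part_def unt.zero L1.minus_eq)

lemma unt_part: "f \<in> Ar L \<Longrightarrow> \<iota> (src L f) +\<^sub>1 part L f = f"
  by (simp add: part_def struct_rules L1.minus_eq L1.a_lcomm L1.r_neg)

lemma src_add_tgt_part: "f \<in> Ar L \<Longrightarrow> src L f +\<^sub>0 tgt L (part L f) = tgt L f"
  using arg_cong[OF unt_part, of f "tgt L"] by (simp add: struct_rules part.closed)

text \<open>By \<open>seq_eq\<close> the second arrow enters a composite through its arrow part
  only, and \<open>part\<close> fixes arrows out of zero.\<close>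

lemma part_seq:
  assumes "f \<in> Ar L" "g \<in> Ar L" "tgt L f = src L g"
  shows "part L (seq L f g) = part L f +\<^sub>1 part L g"
  using assms part_src_kernel[OF _ src_part[of g]]
  by (simp add: seq_eq part.add part.closed flip: part_def)

text \<open>The shape of the coherence law: four factors against three.\<close>

lemma part_seq4:
  assumes "seq L (seq L (seq L a1 a2) a3) a4 = seq L (seq L c1 c2) c3"
    and "a1 \<in> Ar L" "a2 \<in> Ar L" "a3 \<in> Ar L" "a4 \<in> Ar L"
      "c1 \<in> Ar L" "c2 \<in> Ar L" "c3 \<in> Ar L"
      "tgt L a1 = src L a2" "tgt L a2 = src L a3" "tgt L a3 = src L a4" "tgt L c1 = src L c2" "tgt L c2 = src L c3"
  shows "part L a1 +\<^sub>1 part L a2 +\<^sub>1 part L a3 +\<^sub>1 part L a4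
    = part L c1 +\<^sub>1 part L c2 +\<^sub>1 part L c3"
  using arg_cong[OF assms(1), of "part L"] assms(2-) by (simp add: part_seq struct_rules)

context
  fixes x y f assumes x: "x \<in> Ob L" "y \<in> Ob L" "f \<in> Ar L"
begin

lemma part_br1_3: "part L (br1 L (\<iota> x) (\<iota> y) f) = br1 L (\<iota> x) (\<iota> y) (part L f)"
  and part_br1_2: "part L (br1 L (\<iota> x) f (\<iota> y)) = br1 L (\<iota> x) (part L f) (\<iota> y)"
  and part_br1_1: "part L (br1 L f (\<iota> x) (\<iota> y)) = br1 L (part L f) (\<iota> x) (\<iota> y)"
  using x by (simp_all add: part_def br_rules br1.rules br1_unt)

end

lemmas part_rules = part.rules part_unt part_br1_1 part_br1_2 part_br1_3

lemma br1_cycle: "\<lbrakk>f \<in> Ar L; g \<in> Ar L; h \<in> Ar L\<rbrakk> \<Longrightarrow> br1 L f g h = br1 L g h f"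
  using br1_swap(1)[of f g h] br1_swap(2)[of g f h] by (simp add: br1.rules)

text \<open>Functoriality splits the bracket of three arrows into three brackets with a single
  moving argument, whose arrow parts add up. This is the origin of the formula for
  \<open>br1\<close> in \<open>total\<close>.\<close>

lemma part_br1:
  assumes "u \<in> Ar L" "v \<in> Ar L" "w \<in> Ar L"
  shows "part L (br1 L u v w) = br1 L (\<iota> (src L v)) (\<iota> (src L w)) (part L u)
    +\<^sub>1 br1 L (\<iota> (src L w)) (\<iota> (tgt L u)) (part L v)
    +\<^sub>1 br1 L (\<iota> (tgt L u)) (\<iota> (tgt L v)) (part L w)"
proof -
  let ?x = "\<iota> (tgt L u)" and ?y = "\<iota> (src L v)" and ?y' = "\<iota> (tgt L v)" and ?z = "\<iota> (src L w)"
  \<comment> \<open>Every argument is padded with units to a composite of three, so that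
    \<open>u\<close> moves in the first factor, \<open>v\<close> in the second and \<open>w\<close>
    in the third.\<close>
  have "br1 L (seq L (seq L u ?x) ?x) (seq L (seq L ?y v) ?y') (seq L (seq L ?z ?z) w)
    = seq L (seq L (br1 L u ?y ?z) (br1 L ?x v ?z)) (br1 L ?x ?y' w)"
    using assms by (simp add: br1_seq br_rules del: seq_unt unt_seq)
  then have "br1 L u v w = seq L (seq L (br1 L u ?y ?z) (br1 L ?x v ?z)) (br1 L ?x ?y' w)"
    using assms by (simp add: unt_seq' seq_unt' struct_rules)
  then have "part L (br1 L u v w) = br1 L (part L u) ?y ?z +\<^sub>1 br1 L ?x (part L v) ?z +\<^sub>1 br1 L ?x ?y' (part L w)"
    using assms by (simp add: part_seq br_rules part_rules)
  then show ?thesis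
    using assms br1_cycle[of "part L u" ?y ?z] br1_cycle[of ?z ?x "part L v"]
    by (simp add: struct_rules part.closed)
qed

lemmas core_closed = lie2_rules part.closed src_part

lemma core_trilinear:
  assumes "i + j + k \<le> 1"
  shows "trilinear K (degree_part (core L) i) (degree_part (core L) j) (degree_part (core L) k)
    (degree_part (core L) (i + j + k)) (l3 (core L) i j k)"
proof -
  consider "i = 0" "j = 0" "k = 0" | "i = 1" "j = 0" "k = 0" | "i = 0" "j = 1" "k = 0" | "i = 0" "j = 0" "k = 1"
    using assms by linarith
  then show ?thesis
    by cases (simp_all add: degree_part_def trilinear_def linear_map_def core_closed br0.rules br1.rules)
qed

lemma core_skew:
  assumes "i + j + k \<le> 1" "x \<in> carrier (degree_part (core L) i)" "y \<in> carrier (degree_part (core L) j)"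
    "z \<in> carrier (degree_part (core L) k)"
  shows "l3 (core L) j i k y x z = \<ominus>\<^bsub>degree_part (core L) (i + j + k)\<^esub> l3 (core L) i j k x y z \<and>
    l3 (core L) i k j x z y = \<ominus>\<^bsub>degree_part (core L) (i + j + k)\<^esub> l3 (core L) i j k x y z"
proof (cases "i + j + k = 0")
  case True
  then show ?thesis using assms skew3D[OF br0_skew, of x y z] by (simp add: degree_part_def)
next
  case False
  then have ijk: "i + j + k = 1" "j + i + k = 1" "i + k + j = 1" using assms(1) by auto
  have "lift L i x \<in> Ar L" "lift L j y \<in> Ar L" "lift L k z \<in> Ar L"
    using assms(2-) by (auto simp: lift_def degree_part_def unt.closed split: if_splits)
  note swap = br1_swap[OF this]
  have dp: "degree_part (core L) (i + j + k) = src_kernel L"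
    unfolding ijk by (simp add: degree_part_def)
  have "l3 (core L) i j k x y z \<in> carrier (degree_part (core L) (i + j + k))"
    using core_trilinear[OF assms(1)] assms(2-) unfolding trilinear_def linear_map_def by (auto simp: Pi_iff)
  then have "\<ominus>\<^bsub>degree_part (core L) (i + j + k)\<^esub> l3 (core L) i j k x y z = \<ominus>\<^bsub>L1 L\<^esub> l3 (core L) i j k x y z"
    unfolding dp by (rule src_kernel_neg)
  moreover have "l3 (core L) i j k x y z = br1 L (lift L i x) (lift L j y) (lift L k z)"
    "l3 (core L) j i k y x z = br1 L (lift L j y) (lift L i x) (lift L k z)"
    "l3 (core L) i k j x z y = br1 L (lift L i x) (lift L k z) (lift L j y)"
    using ijk by (auto simp: core_def)
  ultimately show ?thesis using swap by simp
qed

text \<open>An interchange argument: the bracket of \<open>f\<close>, \<open>g\<close> and the unit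
  of \<open>x\<close> is computed by moving \<open>f\<close> before \<open>g\<close> and by moving
  \<open>g\<close> before \<open>f\<close>. The zero arrow is the unit of the zero object and
  brackets with it vanish, so each order leaves one of the two sides.\<close>

lemma core_c:
  assumes "x \<in> Ob L" "f \<in> carrier (src_kernel L)" "g \<in> carrier (src_kernel L)"
  shows "br1 L (\<iota> (tgt L f)) g (\<iota> x) = br1 L f (\<iota> (tgt L g)) (\<iota> x)"
proof -
  have fg: "f \<in> Ar L" "src L f = \<zero>\<^bsub>L0 L\<^esub>" "g \<in> Ar L" "src L g = \<zero>\<^bsub>L0 L\<^esub>"
    using assms by auto
  note rules = br_rules br0.rules br1.rules unt_seq' seq_unt'
  have z: "seq L \<zero>\<^bsub>L1 L\<^esub> k = k" if "k \<in> Ar L" "src L k = \<zero>\<^bsub>L0 L\<^esub>" for k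
    using unt_seq'[OF that] by (simp add: unt.zero)
  have "br1 L (seq L f (\<iota> (tgt L f))) (seq L \<zero>\<^bsub>L1 L\<^esub> g) (seq L (\<iota> x) (\<iota> x))
    = seq L \<zero>\<^bsub>L1 L\<^esub> (br1 L (\<iota> (tgt L f)) g (\<iota> x))"
    using assms(1) fg by (subst br1_seq) (simp_all add: rules)
  moreover have "br1 L (seq L \<zero>\<^bsub>L1 L\<^esub> f) (seq L g (\<iota> (tgt L g))) (seq L (\<iota> x) (\<iota> x))
    = seq L \<zero>\<^bsub>L1 L\<^esub> (br1 L f (\<iota> (tgt L g)) (\<iota> x))"
    using assms(1) fg by (subst br1_seq) (simp_all add: rules)
  ultimately show ?thesis
    using assms(1) fg by (simp add: z rules)
qed

context
  fixes f1 f2 f3 f4 f5 M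
  assumes f: "f1 \<in> Ar L" "f2 \<in> Ar L" "f3 \<in> Ar L" "f4 \<in> Ar L"
      "f5 \<in> Ar L"
    and M: "M = br1 L (br1 L f1 f2 f3) f4 f5 +\<^sub>1 br1 L f3 (br1 L f1 f2 f4) f5
      +\<^sub>1 br1 L f3 f4 (br1 L f1 f2 f5)"
begin

lemma part_Jac_natural:
  "part L (br1 L f1 f2 (br1 L f3 f4 f5)) +\<^sub>1 part L (Jac L (tgt L f1) (tgt L f2) (tgt L f3) (tgt L f4) (tgt L f5))
    = part L (Jac L (src L f1) (src L f2) (src L f3) (src L f4) (src L f5)) +\<^sub>1 part L M"
  using arg_cong[OF J_natural[of f1 f2 f3 f4 f5, folded M], of "part L"] f
  by (simp add: part_seq lie2_rules M)

end

lemma quintilinear_part_Jac: "quintilinear K (L0 L) (src_kernel L) (l5 (core L))"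
  by (simp add: quintilinear_def linear_map_def core_closed Jac.rules part.rules)

lemma skew_part_Jac: "skew23 (L0 L) (src_kernel L) (l5 (core L))"
  unfolding skew23_def
proof (intro conjI ballI skew3I)
  fix p q x y z
  assume p: "p \<in> Ob L" "q \<in> Ob L" and x: "x \<in> Ob L" "y \<in> Ob L" "z \<in> Ob L"
  have J: "Jac L q p x y z = \<ominus>\<^bsub>L1 L\<^esub> Jac L p q x y z" "Jac L p q y x z = \<ominus>\<^bsub>L1 L\<^esub> Jac L p q x y z"
    "Jac L p q x z y = \<ominus>\<^bsub>L1 L\<^esub> Jac L p q x y z"
    using J_skew p x unfolding skew23_def skew3_def by blast+
  show "l5 (core L) p q y x z = \<ominus>\<^bsub>src_kernel L\<^esub> l5 (core L) p q x y z"
    "l5 (core L) p q x z y = \<ominus>\<^bsub>src_kernel L\<^esub> l5 (core L) p q x y z"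
    "l5 (core L) q p x y z = \<ominus>\<^bsub>src_kernel L\<^esub> l5 (core L) p q x y z"
    using p x J by (simp_all add: src_kernel_neg core_closed part.neg)
qed

text \<open>\<open>ax_a\<close> is the target of a bracket, \<open>ax_c\<close> is interchange,
  \<open>ax_d\<close> compares the ends of the Jacobiator, \<open>ax_e\<close> and
  \<open>ax_f\<close> are its naturality at one arrow out of zero and four units, and
  \<open>ax_g\<close> is its coherence.\<close>

lemma core_algebra: "lie3inf_algebra K (core L)"
proof (rule lie3inf_algebra.intro, goal_cases)
  case 1 show ?case by (simp add: L0_module)
next
  case 2 show ?case by (simp add: src_kernel_module)
next
  case 3 show ?case by (simp add: linear_map_def tgt.rules)
next
  case (4 i j k) then show ?case by (rule core_trilinear)
next
  case (5 i j k x y z) then show ?case by (rule core_skew)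
next
  case 6 show ?case using quintilinear_part_Jac by simp
next
  case 7 show ?case using skew_part_Jac by simp
next
  case (8 x y f) then show ?case by (simp add: br_rules)
next
  case (9 i j k x y z)
  have "i + j + k \<noteq> 0" "i + j + k \<noteq> 1" using 9(4) by auto
  then show ?case by (simp only: core_def lie3inf.simps src_kernel_simps if_False)
next
  case (10 x f g) then show ?case using core_c[of x f g] by simp
next
  case (11 x1 x2 x3 x4 x5)
  then show ?case by (simp add: tgt_part lie2_rules L0.minus_eq L0.a_ac)
next
  case (12 f x2 x3 x4 x5)
  then have x: "x2 \<in> Ob L" "x3 \<in> Ob L" "x4 \<in> Ob L" "x5 \<in> Ob L"
    and f: "f \<in> Ar L" "src L f = \<zero>\<^bsub>L0 L\<^esub>"
    by auto
  note unit = unt.closed[OF x(1)] unt.closed[OF x(2)] unt.closed[OF x(3)] unt.closed[OF x(4)]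
  have "br1 L f (\<iota> x2) (\<iota> (br0 L x3 x4 x5)) +\<^sub>1 part L (Jac L (tgt L f) x2 x3 x4 x5)
    = br1 L (br1 L f (\<iota> x2) (\<iota> x3)) (\<iota> x4) (\<iota> x5)
      +\<^sub>1 br1 L (\<iota> x3) (br1 L f (\<iota> x2) (\<iota> x4)) (\<iota> x5)
      +\<^sub>1 br1 L (\<iota> x3) (\<iota> x4) (br1 L f (\<iota> x2) (\<iota> x5))"
    \<comment> \<open>\<open>f\<close> starts at zero, so the Jacobiator at the sources vanishes by
      linearity.\<close>
    using part_Jac_natural[OF f(1) unit refl] x f
    by (simp add: lie2_rules br1_unt part_rules part_src_kernel Jac.rules(2))
  moreover have "br1 L f (\<iota> x2) (\<iota> (br0 L x3 x4 x5)) \<in> carrier (src_kernel L)"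
    using x f by (simp add: lie2_rules br0.rules(2))
  ultimately show ?case
    using x f by (simp add: src_kernel_neg) (rule L1.solve_sum; simp add: core_closed)
next
  case (13 f x1 x2 x4 x5)
  then have x: "x1 \<in> Ob L" "x2 \<in> Ob L" "x4 \<in> Ob L" "x5 \<in> Ob L"
    and f: "f \<in> Ar L" "src L f = \<zero>\<^bsub>L0 L\<^esub>"
    by auto
  note unit = unt.closed[OF x(1)] unt.closed[OF x(2)] unt.closed[OF x(3)] unt.closed[OF x(4)]
  have "br1 L (\<iota> x1) (\<iota> x2) (br1 L f (\<iota> x4) (\<iota> x5)) +\<^sub>1 part L (Jac L x1 x2 (tgt L f) x4 x5)
    = br1 L (br1 L (\<iota> x1) (\<iota> x2) f) (\<iota> x4) (\<iota> x5)
      +\<^sub>1 br1 L f (\<iota> (br0 L x1 x2 x4)) (\<iota> x5)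
      +\<^sub>1 br1 L f (\<iota> x4) (\<iota> (br0 L x1 x2 x5))"
    using part_Jac_natural[OF unit(1,2) f(1) unit(3,4) refl] x f
    by (simp add: lie2_rules br1_unt part_rules part_src_kernel Jac.rules(4))
  moreover have "br1 L (\<iota> x1) (\<iota> x2) (br1 L f (\<iota> x4) (\<iota> x5)) \<in> carrier (src_kernel L)"
    using x f by (simp add: lie2_rules br0.rules(2,4))
  ultimately show ?case
    using x f by (simp add: src_kernel_neg) (rule L1.solve_sum; simp add: core_closed)
next
  case (14 x1 x2 x3 x4 x5 x6 x7)
  then show ?case
    using part_seq4[OF J_coherence[of x1 x2 x3 x4 x5 x6 x7]]
    by (simp add: lie2_rules br0.rules(5-7) part_rules L0.a_ac L1.a_ac)
qed

lemma tri_core: "tri (core L) = br0 L"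
  and act_core: "act (core L) x y f = br1 L (\<iota> x) (\<iota> y) f"
  by (simp_all add: tri_def act_def)

end

section \<open>The strict isomorphism between a 3-Lie 2-algebra and the one rebuilt from its kernel
  complex\<close>

locale coded_lie2 = S: three_lie_2_algebra K L + pair_coding code
  for K :: "('k, 'r) ring_scheme" and L :: "('k, 'u) three_lie2" and code :: "'u \<times> 'u \<Rightarrow> 'u"
begin

sublocale core: total_space K "core L" code
  using S.core_algebra pair_coding_axioms by (simp add: total_space_def)

definition e1 :: "'u \<Rightarrow> 'u" where "e1 u = unt L (ob u) \<oplus>\<^bsub>L1 L\<^esub> pt u"
definition e1' :: "'u \<Rightarrow> 'u" where "e1' f = mk (src L f) (part L f)"

lemma e1_mk [simp]: "e1 (mk x f) = unt L x \<oplus>\<^bsub>L1 L\<^esub> f"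
  by (simp add: e1_def)

lemma e1_rules:
  assumes "x \<in> Ob L" "f \<in> Ar L" "src L f = \<zero>\<^bsub>L0 L\<^esub>"
  shows "unt L x \<oplus>\<^bsub>L1 L\<^esub> f \<in> Ar L" "src L (unt L x \<oplus>\<^bsub>L1 L\<^esub> f) = x"
    "tgt L (unt L x \<oplus>\<^bsub>L1 L\<^esub> f) = x \<oplus>\<^bsub>L0 L\<^esub> tgt L f" "part L (unt L x \<oplus>\<^bsub>L1 L\<^esub> f) = f"
  using assms by (simp_all add: S.struct_rules S.part.rules S.part_unt S.part_src_kernel)

lemma strict_e: "strict_hom K (total (core L)) L (\<lambda>x. x) e1"
proof (rule strict_hom.intro[OF core.three_lie_2_algebra_total S.three_lie_2_algebra_axioms],
    rule strict_hom_axioms.intro, goal_cases)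
  case 1 show ?case by (simp add: linear_map_def)
next
  case 2 show ?case
    by (auto simp: linear_map_def S.struct_rules S.L1.a_ac S.L1.smult_r_distr elim!: arrowsE)
next
  case (3 u) then show ?case by (auto simp: e1_rules elim!: arrowsE)
next
  case (4 u) then show ?case by (auto simp: e1_rules elim!: arrowsE)
next
  case (5 x) then show ?case by (simp add: S.unt.closed)
next
  case (6 x y z) then show ?case by (simp add: S.tri_core)
next
  case (7 u v w)
  then obtain x f y g z h where c: "x \<in> Ob L" "f \<in> Ar L" "src L f = \<zero>\<^bsub>L0 L\<^esub>"
      "y \<in> Ob L" "g \<in> Ar L" "src L g = \<zero>\<^bsub>L0 L\<^esub>"
      "z \<in> Ob L" "h \<in> Ar L" "src L h = \<zero>\<^bsub>L0 L\<^esub>"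
    and eqs: "u = mk x f" "v = mk y g" "w = mk z h"
    by (auto elim!: arrowsE)
  let ?u = "unt L x \<oplus>\<^bsub>L1 L\<^esub> f" and ?v = "unt L y \<oplus>\<^bsub>L1 L\<^esub> g" and ?w = "unt L z \<oplus>\<^bsub>L1 L\<^esub> h"
  have "br1 L ?u ?v ?w = unt L (br0 L x y z) \<oplus>\<^bsub>L1 L\<^esub> part L (br1 L ?u ?v ?w)"
    using S.unt_part[of "br1 L ?u ?v ?w"] c by (simp add: e1_rules S.br1.rules(1) S.src_br1)
  \<comment> \<open>\<open>part_br1\<close> gives exactly the arrow part that \<open>br1\<close> of
    the rebuilt algebra prescribes.\<close>
  also have "part L (br1 L ?u ?v ?w) = br1 L (unt L y) (unt L z) f
    \<oplus>\<^bsub>L1 L\<^esub> br1 L (unt L z) (unt L (x \<oplus>\<^bsub>L0 L\<^esub> tgt L f)) g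
    \<oplus>\<^bsub>L1 L\<^esub> br1 L (unt L (x \<oplus>\<^bsub>L0 L\<^esub> tgt L f)) (unt L (y \<oplus>\<^bsub>L0 L\<^esub> tgt L g)) h"
    using S.part_br1[of ?u ?v ?w] c by (simp only: e1_rules)
  finally show ?case
    unfolding eqs by (simp only: total_simps e1_mk S.tri_core S.act_core core_simps src_kernel_simps)
next
  case (8 x1 x2 x3 x4 x5)
  then show ?case
    using S.unt_part[of "Jac L x1 x2 x3 x4 x5"] by (simp add: S.tri_core S.lie2_rules)
qed

lemma strict_e': "strict_hom K L (total (core L)) (\<lambda>x. x) e1'"
proof (rule strict_hom.intro[OF S.three_lie_2_algebra_axioms core.three_lie_2_algebra_total],
    rule strict_hom_axioms.intro, goal_cases)
  case 1 show ?case by (simp add: linear_map_def)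
next
  case 2 show ?case
    by (auto simp: linear_map_def e1'_def S.src.rules S.part.rules S.src_part)
next
  case (3 f) then show ?case by (simp add: e1'_def)
next
  case (4 f) then show ?case
    by (simp add: e1'_def S.src_add_tgt_part)
next
  case (5 x) then show ?case by (simp add: e1'_def S.src_unt S.part_unt)
next
  case (6 x y z) then show ?case by (simp add: S.tri_core)
next
  case (7 f g h)
  then show ?case
    using S.part_br1[of f g h]
    by (simp add: e1'_def S.tri_core S.act_core S.src_add_tgt_part S.src_br1)
next
  case (8 x1 x2 x3 x4 x5)
  then show ?case by (simp add: e1'_def S.tri_core S.lie2_rules)
qed

lemma e1'_e1: "u \<in> Ar (total (core L)) \<Longrightarrow> e1' (e1 u) = u"
  by (auto simp: e1'_def e1_rules elim!: arrowsE)

lemma e1_e1': "f \<in> Ar L \<Longrightarrow> e1 (e1' f) = f"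
  by (simp add: e1'_def S.unt_part)

end

section \<open>The 2-equivalence\<close>

context pair_coding
begin

lemma local_iso_dense_T:
  fixes K :: "('k, 'r) ring_scheme"
  shows "local_iso_dense (TwoTerm3LieInf K) (ThreeLie2Alg K) T part_hom (\<lambda>V V' \<phi> \<psi>. part_cell V) core
    (\<lambda>L. strict_map (total (core L)) L (\<lambda>x. x) (\<lambda>u. unt L (ob u) \<oplus>\<^bsub>L1 L\<^esub> pt u))
    (\<lambda>L. strict_map L (total (core L)) (\<lambda>x. x) (\<lambda>f. mk (src L f) (part L f)))"
proof (rule local_iso_dense.intro[OF local_iso_T], rule local_iso_dense_axioms.intro,
    unfold TwoTerm3LieInf_simps ThreeLie2Alg_simps T_simps mem_Collect_eq)
  fix L :: "('k, 'u) three_lie2" assume L: "three_lie_2_algebra K L"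
  interpret coded_lie2 K L code
    using L pair_coding_axioms by (simp add: coded_lie2_def)
  let ?e = "strict_map (total (core L)) L (\<lambda>x. x) (\<lambda>u. unt L (ob u) \<oplus>\<^bsub>L1 L\<^esub> pt u)"
  let ?e' = "strict_map L (total (core L)) (\<lambda>x. x) (\<lambda>f. mk (src L f) (part L f))"
  note e = strict_e[unfolded e1_def[abs_def]] and e' = strict_e'[unfolded e1'_def[abs_def]]
  show "lie3inf_algebra K (core L)" by (rule S.core_algebra)
  show "three_lie2_hom K (total (core L)) L ?e" "three_lie2_hom K L (total (core L)) ?e'"
    by (rule strict_hom.strict_map_hom[OF e] strict_hom.strict_map_hom[OF e'])+
  show "three_lie2_comp (total (core L)) L (total (core L)) ?e' ?e = three_lie2_id (total (core L))"
    by (rule strict_map_inverse[OF e e']) (use e1'_e1 in \<open>simp_all add: e1_def e1'_def\<close>)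
  show "three_lie2_comp L (total (core L)) L ?e ?e' = three_lie2_id L"
    by (rule strict_map_inverse[OF e' e]) (use e1_e1' in \<open>simp_all add: e1_def e1'_def\<close>)
qed

end

theorem theorem4p5:
  fixes K :: "('k, 'r) ring_scheme"
  assumes "field K" and "infinite (UNIV :: 'u set)"
  shows "two_equivalent
    (TwoTerm3LieInf K :: (('k, 'u) lie3inf, 'u lie3inf_map, 'u \<Rightarrow> 'u) two_cat)
    (ThreeLie2Alg K :: (('k, 'u) three_lie2, 'u three_lie2_map, 'u \<Rightarrow> 'u) two_cat)"
proof -
  \<comment> \<open>An infinite set is equinumerous with its square; such a bijection is in
    particular an injective coding of pairs.\<close>
  have "\<exists>code :: 'u \<times> 'u \<Rightarrow> 'u. bij_betw code (UNIV \<times> UNIV) (UNIV :: 'u set)"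
    unfolding card_of_ordIso by (rule card_of_Times_same_infinite[OF assms(2)])
  then obtain code :: "'u \<times> 'u \<Rightarrow> 'u" where "bij_betw code (UNIV \<times> UNIV) UNIV" ..
  then interpret pair_coding code
    by unfold_locales (simp add: bij_betw_def)
  show ?thesis
    by (rule local_iso_dense.equivalence[OF local_iso_dense_T])
qed

end
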